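(* Let $L>0$, let $H$ be the uniform distribution on $[-L,L]$, and let $\kappa_n>0$ satisfy $C_1\exp(-c_0\log^{b_0}n)\le\kappa_n\le C_2$ for all $n$, for some constants $b_0,c_0,C_1,C_2>0$. Let $\Pi_{\mathrm{DP}}$ be the Dirichlet process prior $\mathrm{DP}(\kappa_n,H)$ on the mixing distribution. Then there is a constant $M>0$, not depending on $n$ or $\nu^\star$, such that $$\sup_{\nu^\star\in\mathcal M}\mathsf P^{(n)}_{\nu^\star*\Phi}\Big[\Pi_{\mathrm{DP}}\Big(\mathsf W_1(\tilde\nu,\nu^\star)\ge M\frac{\log\log n}{\log n}\,\Big|\,X_{1:n}\Big)\Big]\to0\quad(n\to\infty).$$
   Context: $\mathcal M$ is the set of finitely supported distributions $\sum_{j=1}^kw_j\delta_{\theta_j}$, $k\in\mathbb N$, $w_j\ge0$, $\sum_jw_j=1$, $\theta_j\in[-L,L]$. For an atomic (finite or countably infinite) distribution $\nu=\sum_jw_j\delta_{\theta_j}$ on $[-L,L]$, $\nu*\Phi=\sum_jw_j\mathrm N(\theta_j,1)$. $\mathsf P^{(n)}_G$ denotes probability or expectation when $X_1,\dots,X_n$ are i.i.d. from $G$; $p_G^{(n)}$ is the joint Lebesgue density; $X_{1:n}=(X_1,\dots,X_n)$. $\mathsf W_1$ is the first-order Wasserstein distance with cost $|\theta-\theta'|$. Dirichlet process prior: $\tilde\nu\sim\mathrm{DP}(\kappa,H)$ is $\tilde\nu=\sum_{j=1}^\infty w_j\delta_{\theta_j}$ with $w_j=E_j\prod_{h=1}^{j-1}(1-E_h)$,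 $E_j$ i.i.d. $\mathrm{Beta}(1,\kappa)$ and, independently, $\theta_j$ i.i.d. $H$. The posterior of $\tilde\nu$ is $\Pi_{\mathrm{DP}}(\mathrm d\tilde\nu|X_{1:n})=p^{(n)}_{\tilde\nu*\Phi}(X_{1:n})\Pi_{\mathrm{DP}}(\mathrm d\tilde\nu)/\int p^{(n)}_{\tilde\nu*\Phi}(X_{1:n})\Pi_{\mathrm{DP}}(\mathrm d\tilde\nu)$. *)

theory Defs
  imports "HOL-Probability.Probability"
begin

definition atomic_measure :: "(nat \<Rightarrow> real) \<Rightarrow> (nat \<Rightarrow> real) \<Rightarrow> real measure" where
  "atomic_measure w \<theta> = distr (density (count_space UNIV) (\<lambda>j. ennreal (w j))) borel \<theta>"

lemma sets_atomic_measure [simp, measurable_cong]: "sets (atomic_measure w \<theta>) = sets borel"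
  by (simp add: atomic_measure_def)

lemma nn_integral_atomic_measure:
  assumes "f \<in> borel_measurable borel"
  shows "(\<integral>\<^sup>+t. f t \<partial>atomic_measure w \<theta>) = (\<Sum>j. ennreal (w j) * f (\<theta> j))"
  using assms
  by (simp add: atomic_measure_def nn_integral_distr nn_integral_density nn_integral_count_space_nat)

lemma emeasure_atomic_measure:
  assumes "A \<in> sets borel"
  shows "emeasure (atomic_measure w \<theta>) A = (\<Sum>j. ennreal (w j) * indicator A (\<theta> j))"
  using assms nn_integral_atomic_measure[of "indicator A" w \<theta>] by simp

lemma prob_space_atomic_measure:
  assumes "\<forall>j. 0 \<le> w j" "w sums 1" shows "prob_space (atomic_measure w \<theta>)"
proof
  have "emeasure (atomic_measure w \<theta>) UNIV = (\<Sum>j. ennreal (w j))"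
    by (simp add: emeasure_atomic_measure)
  also have "\<dots> = ennreal 1" using assms by (simp add: suminf_ennreal2 sums_iff)
  finally show "emeasure (atomic_measure w \<theta>) (space (atomic_measure w \<theta>)) = 1" by (simp add: atomic_measure_def)
qed

definition finite_mixing :: "real \<Rightarrow> real measure set" where
  "finite_mixing L = {atomic_measure (\<lambda>j. if j < k then w j else 0) \<theta> | k w \<theta>.
     (\<forall>j<k. 0 \<le> w j) \<and> (\<Sum>j<k. w j) = 1 \<and> (\<forall>j<k. \<theta> j \<in> {-L..L})}"

lemma prob_space_finite_mixing:
  "\<nu> \<in> finite_mixing L \<Longrightarrow> prob_space \<nu>"
  unfolding finite_mixing_def
proof clarify
  fix k :: nat and w \<theta> :: "nat \<Rightarrow> real" assume a: "\<forall>j<k. 0 \<le> w j" "(\<Sum>j<k. w j) = 1"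
  have "(\<lambda>j. if j < k then w j else 0) sums (\<Sum>j<k. if j < k then w j else 0)"
    by (rule sums_finite) auto
  with a show "prob_space (atomic_measure (\<lambda>j. if j < k then w j else 0) \<theta>)"
    by (intro prob_space_atomic_measure) auto
qed

definition gauss_mixture :: "real measure \<Rightarrow> real measure" where
  "gauss_mixture \<nu> = convolution \<nu> (density lborel std_normal_density)"

definition mixture_density :: "real measure \<Rightarrow> real \<Rightarrow> ennreal" where
  "mixture_density \<nu> x = (\<integral>\<^sup>+\<theta>. ennreal (normal_density \<theta> 1 x) \<partial>\<nu>)"

lemma mixture_density_atomic:
  "mixture_density (atomic_measure w \<theta>) x = (\<Sum>j. ennreal (w j) * ennreal (normal_density (\<theta> j) 1 x))"
  unfolding mixture_density_def
  by (intro nn_integral_atomic_measure) (simp add: normal_density_def)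

lemma gauss_mixture_density:
  assumes "finite_measure \<nu>" and S [measurable_cong, simp]: "sets \<nu> = sets borel"
  shows "gauss_mixture \<nu> = density lborel (mixture_density \<nu>)"
proof (rule measure_eqI)
  show "sets (gauss_mixture \<nu>) = sets (density lborel (mixture_density \<nu>))"
    by (simp add: gauss_mixture_def)
  fix A assume "A \<in> sets (gauss_mixture \<nu>)"
  then have A [measurable]: "A \<in> sets borel" by (simp add: gauss_mixture_def)
  interpret finite_measure \<nu> by fact
  interpret P: pair_sigma_finite \<nu> "lborel :: real measure" ..
  have N: "finite_measure (density lborel (\<lambda>x. ennreal (std_normal_density x)))"
    using prob_space_normal_density[of 1 0] by (simp add: prob_space.finite_measure)
  have m [measurable]: "(\<lambda>(\<theta>, x). ennreal (normal_density \<theta> 1 x)) \<in> borel_measurable (borel \<Otimes>\<^sub>M borel)"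
    unfolding normal_density_def by measurable
  have md [measurable]: "mixture_density \<nu> \<in> borel_measurable borel"
    unfolding mixture_density_def normal_density_def by measurable
  have "emeasure (gauss_mixture \<nu>) A
      = (\<integral>\<^sup>+\<theta>. \<integral>\<^sup>+y. indicator A (\<theta> + y) \<partial>density lborel std_normal_density \<partial>\<nu>)"
    unfolding gauss_mixture_def by (rule convolution_emeasure') (use assms N in auto)
  also have "\<dots> = (\<integral>\<^sup>+\<theta>. \<integral>\<^sup>+x. ennreal (normal_density \<theta> 1 x) * indicator A x \<partial>lborel \<partial>\<nu>)"
  proof (rule nn_integral_cong)
    fix \<theta>
    have "(\<integral>\<^sup>+x. ennreal (normal_density \<theta> 1 x) * indicator A x \<partial>lborel)
        = (\<integral>\<^sup>+y. ennreal (normal_density \<theta> 1 (\<theta> + 1 * y)) * indicator A (\<theta> + 1 * y) \<partial>lborel)"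
      by (subst nn_integral_real_affine[where c = 1 and t = \<theta>]) auto
    then show "(\<integral>\<^sup>+y. indicator A (\<theta> + y) \<partial>density lborel std_normal_density)
        = (\<integral>\<^sup>+x. ennreal (normal_density \<theta> 1 x) * indicator A x \<partial>lborel)"
      by (simp add: nn_integral_density normal_density_def)
  qed
  also have "\<dots> = (\<integral>\<^sup>+x. \<integral>\<^sup>+\<theta>. ennreal (normal_density \<theta> 1 x) * indicator A x \<partial>\<nu> \<partial>lborel)"
    by (rule P.Fubini'[symmetric]) measurable
  also have "\<dots> = (\<integral>\<^sup>+x. mixture_density \<nu> x * indicator A x \<partial>lborel)"
    by (simp add: mixture_density_def nn_integral_multc normal_density_def)
  finally show "emeasure (gauss_mixture \<nu>) A = emeasure (density lborel (mixture_density \<nu>)) A"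
    by (simp add: emeasure_density)
qed

definition joint_density :: "nat \<Rightarrow> real measure \<Rightarrow> (nat \<Rightarrow> real) \<Rightarrow> ennreal" where
  "joint_density n \<nu> x = (\<Prod>i<n. mixture_density \<nu> (x i))"

definition beta_density :: "real \<Rightarrow> real \<Rightarrow> real \<Rightarrow> real" where
  "beta_density a b x =
     (if 0 < x \<and> x < 1 then x powr (a - 1) * (1 - x) powr (b - 1) / Beta a b else 0)"

lemma prob_space_beta_density:
  assumes "a > 0" "b > 0" shows "prob_space (density lborel (beta_density a b))"
proof
  have B: "Beta a b > 0" using assms by (simp add: Beta_def Gamma_real_pos)
  have h: "((\<lambda>t. (t powr (a-1) * (1-t) powr (b-1)) / Beta a b) has_integral 1) {0..1}"
    using has_integral_divide[OF has_integral_Beta_real[OF assms], of "Beta a b"] B by simp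
  have I: "(\<integral>\<^sup>+t. ennreal (indicator {0..1} t * (t powr (a-1) * (1-t) powr (b-1) / Beta a b)) \<partial>lborel) = ennreal 1"
    using B by (intro nn_integral_has_integral_lebesgue h) auto
  have AE: "AE t in lborel. ennreal (indicator {0..1} t * (t powr (a-1) * (1-t) powr (b-1) / Beta a b)) = ennreal (beta_density a b t)"
    using AE_lborel_singleton[of 0] AE_lborel_singleton[of 1]
    by eventually_elim (auto simp: beta_density_def indicator_def)
  have "(\<integral>\<^sup>+t. ennreal (beta_density a b t) \<partial>lborel) = 1"
    using nn_integral_cong_AE[OF AE] I by (simp only: ennreal_1)
  moreover have "beta_density a b \<in> borel_measurable borel" unfolding beta_density_def by measurable
  ultimately show "emeasure (density lborel (beta_density a b)) (space (density lborel (beta_density a b))) = 1"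
    by (simp add: emeasure_density)
qed

text \<open>Sticks are indexed from 0.\<close>

definition stick_weight :: "(nat \<Rightarrow> real) \<Rightarrow> nat \<Rightarrow> real" where
  "stick_weight E j = E j * (\<Prod>h<j. 1 - E h)"

text \<open>The \<open>else\<close> branch makes the map total into probability measures. It is taken with probability
  zero when the \<open>E j\<close> are i.i.d. Beta variables.\<close>

definition stick_breaking :: "(nat \<Rightarrow> real) \<Rightarrow> (nat \<Rightarrow> real) \<Rightarrow> real measure" where
  "stick_breaking E \<theta> =
     (if (\<forall>j. 0 \<le> stick_weight E j) \<and> stick_weight E sums 1
      then atomic_measure (stick_weight E) \<theta> else return borel (\<theta> 0))"

lemma measurable_stick_breaking:
  "(\<lambda>(E,\<theta>). stick_breaking E \<theta>) \<in> (\<Pi>\<^sub>M j\<in>(UNIV :: nat set). borel) \<Otimes>\<^sub>M (\<Pi>\<^sub>M j\<in>(UNIV :: nat set). borel) \<rightarrow>\<^sub>M prob_algebra borel"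
proof (rule measurable_prob_algebraI)
  show ps: "prob_space (case x of (E,\<theta>) \<Rightarrow> stick_breaking E \<theta>)" for x
    by (auto simp: stick_breaking_def prob_space_atomic_measure prob_space_return split: prod.split)
  show "(\<lambda>(E,\<theta>). stick_breaking E \<theta>) \<in> (\<Pi>\<^sub>M j\<in>(UNIV :: nat set). borel) \<Otimes>\<^sub>M (\<Pi>\<^sub>M j\<in>(UNIV :: nat set). borel) \<rightarrow>\<^sub>M subprob_algebra borel"
  proof (rule measurable_subprob_algebra)
    show "subprob_space (case x of (E,\<theta>) \<Rightarrow> stick_breaking E \<theta>)" for x
      using ps by (rule prob_space_imp_subprob_space)
    show "sets (case x of (E,\<theta>) \<Rightarrow> stick_breaking E \<theta>) = sets borel" for x
      by (auto simp: stick_breaking_def split: prod.split)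
    fix A :: "real set" assume A[measurable]: "A \<in> sets borel"
    have [measurable]: "\<And>j. (\<lambda>E. stick_weight E j) \<in> borel_measurable (\<Pi>\<^sub>M j\<in>(UNIV :: nat set). borel)"
      unfolding stick_weight_def by measurable
    have "(\<lambda>x. if (\<forall>j. 0 \<le> stick_weight (fst x) j) \<and> stick_weight (fst x) sums 1 then (\<Sum>j. ennreal (stick_weight (fst x) j) * indicator A (snd x j)) else indicator A (snd x 0)) \<in> borel_measurable ((\<Pi>\<^sub>M j\<in>(UNIV :: nat set). borel) \<Otimes>\<^sub>M (\<Pi>\<^sub>M j\<in>(UNIV :: nat set). (borel :: real measure)))"
      unfolding sums_def by measurable
    also have "(\<lambda>x. if (\<forall>j. 0 \<le> stick_weight (fst x) j) \<and> stick_weight (fst x) sums 1 then (\<Sum>j. ennreal (stick_weight (fst x) j) * indicator A (snd x j)) else indicator A (snd x 0)) = (\<lambda>x. emeasure (case x of (E,\<theta>) \<Rightarrow> stick_breaking E \<theta>) A)"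
      by (auto simp: fun_eq_iff stick_breaking_def emeasure_atomic_measure)
    finally show "(\<lambda>x. emeasure (case x of (E,\<theta>) \<Rightarrow> stick_breaking E \<theta>) A) \<in> borel_measurable ((\<Pi>\<^sub>M j\<in>(UNIV :: nat set). borel) \<Otimes>\<^sub>M (\<Pi>\<^sub>M j\<in>(UNIV :: nat set). borel))" .
  qed
qed

definition dirichlet_process :: "real \<Rightarrow> real measure \<Rightarrow> real measure measure" where
  "dirichlet_process \<kappa> H =
     distr ((\<Pi>\<^sub>M j\<in>(UNIV :: nat set). density lborel (beta_density 1 \<kappa>)) \<Otimes>\<^sub>M (\<Pi>\<^sub>M j\<in>(UNIV :: nat set). H))
       (prob_algebra borel) (\<lambda>(E, \<theta>). stick_breaking E \<theta>)"

lemma prob_space_dirichlet_process: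
  assumes "\<kappa> > 0" "prob_space H" and S: "sets H = sets borel"
  shows "prob_space (dirichlet_process \<kappa> H)"
proof -
  let ?B = "density lborel (beta_density 1 \<kappa>)"
  interpret B: prob_space ?B using assms by (intro prob_space_beta_density) auto
  interpret H: prob_space H by fact
  interpret PB: product_prob_space "\<lambda>_. ?B" "UNIV :: nat set" ..
  interpret PH: product_prob_space "\<lambda>_. H" "UNIV :: nat set" ..
  interpret pair_prob_space "\<Pi>\<^sub>M j\<in>(UNIV :: nat set). ?B" "\<Pi>\<^sub>M j\<in>(UNIV :: nat set). H" ..
  have "sets ((\<Pi>\<^sub>M j\<in>(UNIV :: nat set). ?B) \<Otimes>\<^sub>M (\<Pi>\<^sub>M j\<in>(UNIV :: nat set). H))
      = sets ((\<Pi>\<^sub>M j\<in>(UNIV :: nat set). borel) \<Otimes>\<^sub>M (\<Pi>\<^sub>M j\<in>(UNIV :: nat set). borel))"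
    using S by (intro sets_pair_measure_cong sets_PiM_cong) auto
  from measurable_cong_sets[OF this refl] measurable_stick_breaking
  have "(\<lambda>(E, \<theta>). stick_breaking E \<theta>) \<in> (\<Pi>\<^sub>M j\<in>(UNIV :: nat set). ?B) \<Otimes>\<^sub>M (\<Pi>\<^sub>M j\<in>(UNIV :: nat set). H)
      \<rightarrow>\<^sub>M prob_algebra borel"
    by blast
  then show ?thesis
    unfolding dirichlet_process_def by (rule prob_space_distr)
qed

definition posterior :: "real measure measure \<Rightarrow> nat \<Rightarrow> (nat \<Rightarrow> real) \<Rightarrow> real measure measure" where
  "posterior P n x =
     density P (\<lambda>\<nu>. joint_density n \<nu> x / (\<integral>\<^sup>+\<mu>. joint_density n \<mu> x \<partial>P))"

definition couplings :: "real measure \<Rightarrow> real measure \<Rightarrow> (real \<times> real) measure set" where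
  "couplings \<mu> \<nu> = {\<gamma>. sets \<gamma> = sets (borel \<Otimes>\<^sub>M borel) \<and>
     distr \<gamma> borel fst = \<mu> \<and> distr \<gamma> borel snd = \<nu>}"

definition wasserstein1 :: "real measure \<Rightarrow> real measure \<Rightarrow> ennreal" where
  "wasserstein1 \<mu> \<nu> = (INF \<gamma>\<in>couplings \<mu> \<nu>. \<integral>\<^sup>+(s, t). ennreal \<bar>s - t\<bar> \<partial>\<gamma>)"

end

theory Submission
  imports Defs "HOL-Real_Asymp.Real_Asymp" "HOL-Computational_Algebra.Polynomial"
begin

text \<open>
  The posterior mass of a set is controlled by a lower bound on the evidence and by tests with
  exponentially small errors; a polynomial rate in \<open>n\<close> for smooth functionals suffices, because the
  final rate is logarithmic.

  Tests: if two mixing distributions on \<open>[-L, L]\<close> have characteristic functions that agree up to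
  \<open>n powr (-1/32)\<close> at the points \<open>j / D\<close> with \<open>\<bar>j\<bar> \<le> D\<close>, where \<open>D\<close> is a small multiple of
  \<open>ln n / ln (ln n)\<close>, then their Wasserstein distance is \<open>O(ln (ln n) / ln n)\<close>. Indeed, the distance is
  at most the integral of the difference of the distribution functions, and the Heaviside function is
  approximated on \<open>[-2L, 2L]\<close> with \<open>L\<^sup>1\<close> error \<open>O(1/D)\<close> by a polynomial in \<open>D sin (t / D)\<close> of degree
  at most \<open>D\<close> with coefficients at most \<open>D ^ D\<close>. Such a polynomial is a combination of the
  exponentials \<open>exp (\<i> j t / D)\<close>. Since these frequencies are at most 1, Gaussian smoothing costs only a
  constant factor, and Hoeffding's inequality tests each of them with error \<open>exp (- n powr (15/16) / 128)\<close>.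

  Evidence: split \<open>[-L, L]\<close> into about \<open>n powr (1/4)\<close> cells. If \<open>\<nu>\<close> gives every cell at least a fraction
  \<open>1 - O(n powr (-1/4))\<close> of its mass under the truth, the likelihood ratio is bounded below pointwise, and
  independent constraints on the first sticks and atoms bound the prior mass of such \<open>\<nu>\<close> from below. The
  evidence is at least \<open>exp (- O(n powr (7/8)))\<close>, which the testing errors beat; even a total mass \<open>\<kappa>\<close> as
  small as \<open>exp (- c0 * ln n powr b0)\<close> is harmless since only \<open>n powr (1/4)\<close> sticks are constrained.
\<close>

section \<open>Polynomial approximation of the Heaviside function\<close>

text \<open>The factor \<open>ln (ln n)\<close> in the rate is the price of the coefficients:
  \<open>D ^ O(D)\<close> has to stay below a power of \<open>n\<close>, so \<open>D * ln D\<close>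
  can only be of order \<open>ln n\<close>, while the resolution is \<open>1 / D\<close>. Powers of
  \<open>\<theta>\<close> would call for unbounded statistics of the data; the substitution
  \<open>D sin (t / D)\<close> gives bounded ones, and the \<open>k\<close>-th power of a sine
  contains only frequencies up to \<open>k\<close>. The approximant is the normalised antiderivative
  of the fourth power of a Taylor polynomial of \<open>sin (N v) / (N v)\<close>: a nonnegative
  kernel of width \<open>1 / N\<close>, which a degree of order \<open>N\<close> realises on a
  bounded interval. Nothing may depend on the number or the separation of the atoms of the truth.
  Likelihoods are therefore compared through masses of cells, never by matching atoms, and the data
  enter the comparison only through a bound \<open>n powr (9/8)\<close> on the sum of the
  \<open>\<bar>x i\<bar> + L\<close>. Cells of diameter \<open>O(n powr (-1/4))\<close> turn it into
  the exponent 9/8 - 1/4 = 7/8, below the exponent 1 - 2/32 = 15/16 of the tests.\<close>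

lemma abs_coeff_mult_le:
  fixes p q :: "real poly"
  assumes "degree p \<le> d" "\<And>k. \<bar>coeff p k\<bar> \<le> A" "\<And>k. \<bar>coeff q k\<bar> \<le> B"
  shows "\<bar>coeff (p * q) k\<bar> \<le> real (d + 1) * (A * B)"
proof -
  have A: "0 \<le> A" and B: "0 \<le> B" using assms(2,3)[of 0] by linarith+
  have "\<bar>coeff (p * q) k\<bar> \<le> (\<Sum>i\<le>k. \<bar>coeff p i\<bar> * \<bar>coeff q (k - i)\<bar>)"
    unfolding coeff_mult by (rule order_trans[OF sum_abs]) (simp add: abs_mult)
  also have "\<dots> = (\<Sum>i\<in>{..k} \<inter> {..d}. \<bar>coeff p i\<bar> * \<bar>coeff q (k - i)\<bar>)"
    using assms(1) by (intro sum.mono_neutral_right) (auto simp: coeff_eq_0)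
  also have "\<dots> \<le> (\<Sum>i\<in>{..k} \<inter> {..d}. A * B)"
    using A assms by (intro sum_mono mult_mono) auto
  also have "\<dots> \<le> (\<Sum>i\<in>{..d}. A * B)"
    using A B by (intro sum_mono2) auto
  finally show ?thesis by simp
qed

section \<open>Antiderivatives of polynomials\<close>

definition poly_integral :: "real poly \<Rightarrow> real poly" where
  "poly_integral p = (\<Sum>i\<le>degree p. monom (coeff p i / real (Suc i)) (Suc i))"

lemma coeff_poly_integral_0 [simp]: "coeff (poly_integral p) 0 = 0"
  by (simp add: poly_integral_def coeff_sum)

lemma coeff_poly_integral_Suc: "coeff (poly_integral p) (Suc k) = coeff p k / real (Suc k)"
proof -
  have "coeff (poly_integral p) (Suc k) = (\<Sum>i\<le>degree p. if i = k then coeff p i / real (Suc i) else 0)"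
    by (simp add: poly_integral_def coeff_sum)
  also have "\<dots> = coeff p k / real (Suc k)"
    by (subst sum.delta) (auto simp: coeff_eq_0)
  finally show ?thesis .
qed

lemma degree_poly_integral: "degree (poly_integral p) \<le> Suc (degree p)"
  unfolding poly_integral_def
  by (rule degree_sum_le) (auto intro: order_trans[OF degree_monom_le])

lemma poly_integral_0 [simp]: "poly (poly_integral p) 0 = 0"
  by (simp add: poly_0_coeff_0)

lemma pderiv_poly_integral [simp]: "pderiv (poly_integral p) = p"
  by (rule poly_eqI) (simp add: coeff_pderiv coeff_poly_integral_Suc)

lemma DERIV_poly_integral: "DERIV (poly (poly_integral p)) x :> poly p x"
  using poly_DERIV[of "poly_integral p" x] by simp

text \<open>Taylor polynomial in \<open>v\<close> of \<open>sin (c * v) / (c * v)\<close>; the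
  division by \<open>c * v\<close> shifts the sine coefficients by one.\<close>

definition sinc_poly :: "nat \<Rightarrow> real \<Rightarrow> real poly" where
  "sinc_poly m c = (\<Sum>i<m. monom (sin_coeff (Suc i) * c ^ i) i)"

lemma degree_sinc_poly: "degree (sinc_poly m c) \<le> m"
  unfolding sinc_poly_def
  by (rule degree_sum_le) (auto intro: order_trans[OF degree_monom_le])

lemma abs_sin_coeff_le_1: "\<bar>sin_coeff k\<bar> \<le> 1"
  by (auto simp: sin_coeff_def divide_simps abs_mult power_abs fact_ge_1)

lemma abs_coeff_sinc_poly:
  assumes "1 \<le> c" shows "\<bar>coeff (sinc_poly m c) k\<bar> \<le> c ^ m"
proof (cases "k < m")
  case True
  then have "coeff (sinc_poly m c) k = sin_coeff (Suc k) * c ^ k"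
    by (simp add: sinc_poly_def coeff_sum)
  also have "\<bar>\<dots>\<bar> \<le> 1 * c ^ m"
    unfolding abs_mult using assms True abs_sin_coeff_le_1
    by (intro mult_mono) (auto simp: power_increasing)
  finally show ?thesis by simp
next
  case False
  then show ?thesis using assms by (simp add: sinc_poly_def coeff_sum)
qed

lemma sinc_poly_times: "c * v * poly (sinc_poly m c) v = (\<Sum>i<Suc m. sin_coeff i * (c * v) ^ i)"
  unfolding sum.lessThan_Suc_shift
  by (simp add: sinc_poly_def poly_sum poly_monom sum_distrib_left power_mult_distrib mult_ac)

text \<open>Multiplied by \<open>c * v\<close>, the claim is the Maclaurin remainder of the sine at
  order \<open>Suc m\<close>.\<close>

lemma sinc_poly_error:
  assumes "c * v \<noteq> 0"
  shows "\<bar>poly (sinc_poly m c) v - sin (c * v) / (c * v)\<bar> \<le> \<bar>c * v\<bar> ^ m / fact m"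
proof -
  have "\<bar>c * v\<bar> * \<bar>poly (sinc_poly m c) v - sin (c * v) / (c * v)\<bar>
      = \<bar>sin (c * v) - (\<Sum>i<Suc m. sin_coeff i * (c * v) ^ i)\<bar>"
    unfolding abs_mult[symmetric] sinc_poly_times[symmetric] using assms
    by (simp add: algebra_simps abs_minus_commute)
  also have "\<dots> \<le> \<bar>c * v\<bar> ^ Suc m / fact (Suc m)"
    using Maclaurin_sin_bound[of "c * v" "Suc m"] by (simp add: divide_simps mult.commute)
  also have "\<dots> \<le> \<bar>c * v\<bar> ^ Suc m / fact m"
    by (intro divide_left_mono fact_mono) auto
  finally have "\<bar>c * v\<bar> * \<bar>poly (sinc_poly m c) v - sin (c * v) / (c * v)\<bar>
     \<le> \<bar>c * v\<bar> * (\<bar>c * v\<bar> ^ m / fact m)" by simp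
  moreover have "0 < \<bar>c * v\<bar>" using assms by (metis zero_less_abs_iff)
  ultimately show ?thesis by (rule mult_left_le_imp_le)
qed

text \<open>A single term of the exponential series gives
  \<open>m ^ m / fact m \<le> exp 1 ^ m \<le> 3 ^ m\<close>; the constant 12 is 3 times the 4 of the
  conclusion.\<close>

lemma power_over_fact_le:
  assumes "0 \<le> u" "12 * u \<le> real m" "0 < m"
  shows "u ^ m / fact m \<le> (1/4) ^ m"
proof -
  have "real m ^ m / fact m \<le> exp (real m)"
  proof -
    have s: "(\<lambda>k. inverse (fact k) * real m ^ k) sums exp (real m)"
      using exp_converges[of "real m"] by (simp add: scaleR_conv_of_real)
    have "(\<Sum>k\<in>{m}. inverse (fact k) * real m ^ k) \<le> (\<Sum>k. inverse (fact k) * real m ^ k)"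
      by (intro sum_le_suminf) (use s in \<open>auto simp: sums_iff\<close>)
    then show ?thesis using s by (simp add: sums_iff field_simps)
  qed
  also have "\<dots> = exp 1 ^ m" by (simp add: exp_of_nat_mult[symmetric])
  also have "\<dots> \<le> 3 ^ m" using exp_le by (intro power_mono) auto
  finally have *: "real m ^ m / fact m \<le> 3 ^ m" .
  have "u ^ m / fact m \<le> (real m / 12) ^ m / fact m"
    using assms by (intro divide_right_mono power_mono) auto
  also have "\<dots> = (real m ^ m / fact m) / 12 ^ m" by (simp add: power_divide)
  also have "\<dots> \<le> 3 ^ m / 12 ^ m" using * by (intro divide_right_mono) auto
  also have "\<dots> = (1/4) ^ m" by (simp add: power_divide[symmetric])
  finally show ?thesis .
qed

text \<open>The crude constant 1/2 serves twice: it keeps the sine quotient away from 0 near the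
  origin, and it makes \<open>sin (s * t) / s\<close> share the sign of \<open>t\<close> and at
  least half of its size.\<close>

lemma abs_sin_minus_self_le:
  fixes u :: real
  assumes "\<bar>u\<bar> \<le> 1"
  shows "\<bar>sin u - u\<bar> \<le> \<bar>u\<bar> / 2"
proof -
  have "\<bar>sin u - (\<Sum>m<3. sin_coeff m * u ^ m)\<bar> \<le> inverse (fact 3) * \<bar>u\<bar> ^ 3"
    by (rule Maclaurin_sin_bound)
  moreover have "(\<Sum>m<3. sin_coeff m * u ^ m) = u"
    by (simp add: numeral_3_eq_3 sin_coeff_def)
  moreover have "\<bar>u\<bar> ^ 3 \<le> \<bar>u\<bar>"
    using assms power_decreasing[of 1 3 "\<bar>u\<bar>"] by simp
  ultimately show ?thesis by (simp add: fact_numeral)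
qed

text \<open>Since \<open>\<bar>u\<bar> \<le> 2 * L * N\<close>, the degree \<open>24 * L * N\<close>
  is what \<open>power_over_fact_le\<close> asks for. The Taylor error is brought down to
  \<open>1 / (4 * N)\<close> so that it remains bounded after multiplication by
  \<open>\<bar>u\<bar>\<close>, where it contributes at most \<open>L\<close>. The lower bound 1/4
  is 1 - 1/2 - 1/4, from the sine estimate and the Taylor error.\<close>

lemma sinc_poly_bounds:
  assumes L: "0 < L" and N: "1 \<le> N" and m: "24 * L * real N \<le> real m" "N \<le> m"
    and v: "\<bar>v\<bar> \<le> 2 * L"
  defines "u \<equiv> real N * v"
  shows "\<bar>poly (sinc_poly m (real N)) v\<bar> \<le> 2"
    and "\<bar>u\<bar> * \<bar>poly (sinc_poly m (real N)) v\<bar> \<le> 1 + L"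
    and "\<bar>u\<bar> \<le> 1 \<Longrightarrow> 1/4 \<le> \<bar>poly (sinc_poly m (real N)) v\<bar>"
proof -
  let ?S = "poly (sinc_poly m (real N)) v"
  have m0: "0 < m" using N m by linarith
  have u: "\<bar>u\<bar> \<le> 2 * L * real N"
    using mult_left_mono[OF v, of "real N"] by (simp add: u_def abs_mult mult_ac)
  have four: "4 * real n \<le> 4 ^ n" if "1 \<le> n" for n :: nat
    using that by (induction n rule: dec_induct) auto
  have err: "\<bar>u\<bar> ^ m / fact m \<le> 1 / (4 * real N)"
  proof -
    have "\<bar>u\<bar> ^ m / fact m \<le> (1/4) ^ m"
      using u m by (intro power_over_fact_le m0) auto
    also have "\<dots> \<le> (1/4) ^ N" using m by (intro power_decreasing) auto
    also have "\<dots> = 1 / 4 ^ N" by (simp add: power_divide)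
    also have "\<dots> \<le> 1 / (4 * real N)" using four[OF N] N by (intro divide_left_mono) auto
    finally show ?thesis .
  qed
  have le14: "1 / (4 * real N) \<le> 1/4" using N by simp
  show "\<bar>?S\<bar> \<le> 2" "\<bar>u\<bar> * \<bar>?S\<bar> \<le> 1 + L" "\<bar>u\<bar> \<le> 1 \<Longrightarrow> 1/4 \<le> \<bar>?S\<bar>"
  proof -
    consider "u = 0" | "u \<noteq> 0" by auto
    then have "\<bar>?S\<bar> \<le> 2 \<and> \<bar>u\<bar> * \<bar>?S\<bar> \<le> 1 + L \<and> (\<bar>u\<bar> \<le> 1 \<longrightarrow> 1/4 \<le> \<bar>?S\<bar>)"
    proof cases
      case 1
      then have v0: "v = 0" using N by (simp add: u_def)
      have "coeff (sinc_poly m (real N)) 0 = 1"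
        using m0 by (simp add: sinc_poly_def coeff_sum sin_coeff_def)
      then have "?S = 1" by (simp add: v0 poly_0_coeff_0)
      then show ?thesis using 1 L by simp
    next
      case 2
      have d: "\<bar>?S - sin u / u\<bar> \<le> 1 / (4 * real N)"
        using sinc_poly_error[of "real N" v m] 2 err unfolding u_def by linarith
      have a: "\<bar>sin u / u\<bar> \<le> 1" using abs_sin_x_le_abs_x[of u] 2 by (simp add: divide_simps)
      have one: "\<bar>?S\<bar> \<le> 2" using d a le14 by linarith
      have "\<bar>u\<bar> * \<bar>?S\<bar> \<le> \<bar>u\<bar> * (\<bar>sin u / u\<bar> + 1 / (4 * real N))"
        using d by (intro mult_left_mono) linarith+
      also have "\<dots> = \<bar>sin u\<bar> + \<bar>u\<bar> / (4 * real N)" using 2 by (simp add: field_simps)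
      also have "\<dots> \<le> 1 + (2 * L * real N) / (4 * real N)"
        using u by (intro add_mono divide_right_mono) auto
      also have "\<dots> \<le> 1 + L" using N L by simp
      finally have two: "\<bar>u\<bar> * \<bar>?S\<bar> \<le> 1 + L" .
      have "1/4 \<le> \<bar>?S\<bar>" if "\<bar>u\<bar> \<le> 1"
      proof -
        have "\<bar>sin u - u\<bar> \<le> \<bar>u\<bar> / 2" using that by (rule abs_sin_minus_self_le)
        then have "\<bar>u\<bar> * \<bar>sin u / u - 1\<bar> \<le> \<bar>u\<bar> * (1/2)"
          unfolding abs_mult[symmetric] using 2 by (simp add: algebra_simps)
        then have "\<bar>sin u / u - 1\<bar> \<le> 1/2"
          by (rule mult_left_le_imp_le) (use 2 in simp)
        then show ?thesis using d le14 by linarith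
      qed
      with one two show ?thesis by blast
    qed
    then show "\<bar>?S\<bar> \<le> 2" "\<bar>u\<bar> * \<bar>?S\<bar> \<le> 1 + L" "\<bar>u\<bar> \<le> 1 \<Longrightarrow> 1/4 \<le> \<bar>?S\<bar>" by blast+
  qed
qed

lemma square_le_lorentz:
  fixes a u c :: real
  assumes "\<bar>a\<bar> \<le> c" "\<bar>u\<bar> * \<bar>a\<bar> \<le> c"
  shows "a\<^sup>2 \<le> 2 * c\<^sup>2 / (1 + u\<^sup>2)"
proof -
  have "a\<^sup>2 \<le> c\<^sup>2" "(u * a)\<^sup>2 \<le> c\<^sup>2"
    using assms by (auto intro!: abs_le_square_iff[THEN iffD1] simp: abs_mult)
  then have "a\<^sup>2 * (1 + u\<^sup>2) \<le> 2 * c\<^sup>2" by (simp add: power_mult_distrib algebra_simps)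
  moreover have "0 < 1 + u\<^sup>2" by (simp add: add_pos_nonneg)
  ultimately show ?thesis by (simp add: pos_le_divide_eq)
qed

lemma abs_coeff_sinc_poly_power_4:
  assumes "1 \<le> N"
  shows "\<bar>coeff (sinc_poly m (real N) ^ 4) k\<bar> \<le> (2 * real m + 1) * (real m + 1)\<^sup>2 * real N ^ (4 * m)"
proof -
  let ?S = "sinc_poly m (real N)"
  have S: "\<bar>coeff ?S k\<bar> \<le> real N ^ m" for k using assms by (intro abs_coeff_sinc_poly) auto
  have S2: "\<bar>coeff (?S * ?S) k\<bar> \<le> real (m + 1) * (real N ^ m * real N ^ m)" for k
    by (rule abs_coeff_mult_le[OF degree_sinc_poly S S])
  have "degree (?S * ?S) \<le> 2 * m"
    using degree_mult_le[of ?S ?S] degree_sinc_poly[of m "real N"] by linarith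
  from abs_coeff_mult_le[OF this S2 S2, of k] show ?thesis
    by (simp add: power4_eq_xxxx power2_eq_square mult_ac power_mult power_mult_distrib add.commute)
qed

text \<open>The fourth power makes the kernel \<open>S ^ 4\<close> nonnegative and gives it the
  decay \<open>(1 + (N * v)^2)^(-2)\<close>. One of the two factors survives as the pointwise error,
  the other pays for integrating the tail. Normalising by the total mass \<open>Z\<close>, which is
  at least of order \<open>1 / N\<close>, cancels the \<open>1 / N\<close> of the tail.\<close>

lemma heaviside_poly:
  fixes L :: real
  assumes L: "0 < L"
  obtains C :: real and A :: nat where "0 < C" "1 \<le> A"
    "\<And>N. 1 \<le> N \<Longrightarrow> \<exists>p. degree p \<le> A * N \<and> (\<forall>k. \<bar>coeff p k\<bar> \<le> real (A * N) ^ (A * N)) \<and>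
       (\<forall>v. \<bar>v\<bar> \<le> 2 * L \<longrightarrow> \<bar>poly p v - indicator {0<..} v\<bar> \<le> C / (1 + (real N * v)\<^sup>2))"
proof -
  define a where "a = nat \<lceil>24 * L\<rceil> + 1"
  have a: "24 * L \<le> real a" "1 \<le> a" unfolding a_def by linarith+
  \<comment> \<open>The point \<open>v0 = 1 / (b * N)\<close> below has to satisfy both
    \<open>v0 \<le> 2 * L\<close> and \<open>N * v0 \<le> 1\<close>.\<close>
  define b where "b = max 1 (1 / (2 * L))"
  have b: "1 \<le> b" "1 / b \<le> 2 * L" using L by (auto simp: b_def max_def field_simps)
  \<comment> \<open>\<open>2 + L\<close> dominates the bounds 2 and \<open>1 + L\<close> of
    \<open>sinc_poly_bounds\<close>; \<open>D\<close> is the square of the numerator that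
    \<open>square_le_lorentz\<close> produces from it.\<close>
  define D where "D = 4 * (2 + L) ^ 4"
  have D: "0 < D" using L by (simp add: D_def)
  \<comment> \<open>The 4 bounds the range of the arctangent, \<open>256 * b\<close> comes from
    \<open>1 / Z\<close>, and \<open>D\<close> from the decay of the kernel.\<close>
  define C where "C = 4 * 256 * b * D"
  have C: "0 < C" using D b by (simp add: C_def)
  \<comment> \<open>The first summand absorbs the numerical factor of the coefficients, with 3072 =
    3 * 4 * 256; the rest absorbs the degree \<open>4 * m + 1\<close> and the exponent
    \<open>4 * m + 4\<close> of \<open>N\<close>.\<close>
  define A where "A = nat \<lceil>3072 * b * real a ^ 3\<rceil> + 4 * a + 4"
  have A: "3072 * b * real a ^ 3 \<le> real A" "4 * a + 4 \<le> A" unfolding A_def by linarith+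
  show thesis
  proof (rule that[of C A])
    show "0 < C" by fact
    show "1 \<le> A" using A by linarith
    fix N :: nat assume N: "1 \<le> N"
    define m where "m = a * N"
    have m: "24 * L * real N \<le> real m" "N \<le> m" "1 \<le> m"
      using a N by (auto simp: m_def intro!: mult_right_mono)
    define S where "S = sinc_poly m (real N)"
    define R where "R = poly_integral (S ^ 4)"
    note Sb = sinc_poly_bounds[OF L N m(1,2), folded S_def]
    have dR: "DERIV (poly R) v :> poly S v ^ 4" for v
      using DERIV_poly_integral[of "S ^ 4" v] by (simp add: R_def poly_power)
    have mono: "poly R x \<le> poly R y" if "x \<le> y" for x y
      using that by (rule DERIV_nonneg_imp_nondecreasing) (auto intro!: exI dR)
    have R0: "poly R 0 = 0" by (simp add: R_def)
    have up: "poly S v ^ 4 \<le> D / (1 + (real N * v)\<^sup>2)\<^sup>2" if "\<bar>v\<bar> \<le> 2 * L" for v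
    proof -
      have "(poly S v)\<^sup>2 \<le> 2 * (2 + L)\<^sup>2 / (1 + (real N * v)\<^sup>2)"
        using Sb(1,2)[OF that] L by (intro square_le_lorentz) auto
      then have "((poly S v)\<^sup>2)\<^sup>2 \<le> (2 * (2 + L)\<^sup>2 / (1 + (real N * v)\<^sup>2))\<^sup>2"
        by (intro power_mono) auto
      also have "(2 * (2 + L)\<^sup>2 / (1 + (real N * v)\<^sup>2))\<^sup>2 = D / (1 + (real N * v)\<^sup>2)\<^sup>2"
        by (simp add: D_def power_divide power_mult_distrib flip: power_mult)
      finally show ?thesis by (simp flip: power_mult)
    qed
    define Z where "Z = poly R (2 * L) - poly R (- (2 * L))"
    have Zlow: "1 / (256 * b * real N) \<le> Z"
    proof -
      define v0 where "v0 = 1 / (b * real N)"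
      have v0: "0 < v0" "v0 \<le> 2 * L" "real N * v0 \<le> 1"
      proof -
        show "0 < v0" using b N by (simp add: v0_def)
        have "v0 \<le> 1 / b" using b N by (simp add: v0_def divide_simps)
        then show "v0 \<le> 2 * L" using b by linarith
        show "real N * v0 \<le> 1" using b N by (simp add: v0_def divide_simps)
      qed
      \<comment> \<open>On \<open>[0, v0]\<close> the kernel is at least \<open>(1/4) ^ 4\<close>,
        so \<open>R\<close> grows there at least with slope 1/256.\<close>
      have "(poly R 0 - 0 / 256) \<le> poly R v0 - v0 / 256"
      proof (rule DERIV_nonneg_imp_nondecreasing[where f = "\<lambda>x. poly R x - x / 256"])
        fix x assume x: "0 \<le> x" "x \<le> v0"
        have "real N * x \<le> 1" using x v0(3) N by (meson mult_left_mono of_nat_0_le_iff order_trans)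
        then have "1/4 \<le> \<bar>poly S x\<bar>" using x v0 N by (intro Sb(3)) auto
        then have "(1/4) ^ 4 \<le> \<bar>poly S x\<bar> ^ 4" by (intro power_mono) auto
        then have "1/256 \<le> poly S x ^ 4" by (simp add: power_divide)
        moreover have "((\<lambda>x. poly R x - x / 256) has_real_derivative poly S x ^ 4 - 1 / 256) (at x)"
          by (rule DERIV_diff[OF dR DERIV_cdivide[OF DERIV_ident]])
        ultimately show "\<exists>y. ((\<lambda>x. poly R x - x / 256) has_real_derivative y) (at x) \<and> 0 \<le> y" by force
      qed (use v0 in auto)
      moreover have "poly R v0 \<le> poly R (2 * L)" "poly R (- (2 * L)) \<le> poly R 0"
        using v0 L by (auto intro!: mono)
      ultimately have "v0 / 256 \<le> Z" by (simp add: Z_def R0)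
      then show ?thesis by (simp add: v0_def mult_ac)
    qed
    have Z: "0 < Z" using Zlow b N by (intro less_le_trans[OF _ Zlow]) auto
    have Zinv: "1 / Z \<le> 256 * b * real N"
    proof -
      have "1 / Z \<le> 1 / (1 / (256 * b * real N))"
        using Zlow Z b N by (intro divide_left_mono) auto
      then show ?thesis by simp
    qed
    text \<open>Comparison with a multiple of the arctangent bounds both tails of \<open>S ^ 4\<close>.\<close>
    have tail: "poly R y - poly R x \<le> 4 * D / (real N * (1 + (real N * v)\<^sup>2))"
      if xy: "x \<le> y" "- (2 * L) \<le> x" "y \<le> 2 * L" and v: "\<And>t. x \<le> t \<Longrightarrow> t \<le> y \<Longrightarrow> \<bar>v\<bar> \<le> \<bar>t\<bar>" for x y v
    proof -
      define K where "K = D / (real N * (1 + (real N * v)\<^sup>2))"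
      have K: "0 \<le> K" using D by (simp add: K_def)
      have "K * arctan (real N * x) - poly R x \<le> K * arctan (real N * y) - poly R y"
        using xy(1)
      proof (rule DERIV_nonneg_imp_nondecreasing)
        fix t assume t: "x \<le> t" "t \<le> y"
        have "\<bar>real N * v\<bar> \<le> \<bar>real N * t\<bar>" using v[OF t] by (simp add: abs_mult mult_left_mono)
        then have sq: "(real N * v)\<^sup>2 \<le> (real N * t)\<^sup>2" by (simp add: abs_le_square_iff)
        have "poly S t ^ 4 \<le> D / (1 + (real N * t)\<^sup>2)\<^sup>2" using t xy by (intro up) auto
        \<comment> \<open>One factor is frozen at \<open>v\<close>, where it is smallest on the
          interval; the other is kept as the derivative of the arctangent.\<close>
        also have "\<dots> \<le> D / ((1 + (real N * v)\<^sup>2) * (1 + (real N * t)\<^sup>2))"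
          unfolding power2_eq_square[of "1 + _"] using D sq
          by (intro divide_left_mono mult_right_mono mult_pos_pos add_pos_nonneg) auto
        also have "\<dots> = K * (inverse (1 + (real N * t)\<^sup>2) * real N)"
          using N by (simp add: K_def inverse_eq_divide)
        finally have "0 \<le> K * (inverse (1 + (real N * t)\<^sup>2) * real N) - poly S t ^ 4" by simp
        moreover have "((\<lambda>x. K * arctan (real N * x) - poly R x) has_real_derivative
            K * (inverse (1 + (real N * t)\<^sup>2) * real N) - poly S t ^ 4) (at t)"
        proof (rule DERIV_diff[OF DERIV_cmult dR])
          show "((\<lambda>x. arctan (real N * x)) has_real_derivative inverse (1 + (real N * t)\<^sup>2) * real N) (at t)"
            by (auto intro!: derivative_eq_intros)
        qed
        ultimately show "\<exists>y. ((\<lambda>x. K * arctan (real N * x) - poly R x) has_real_derivative y) (at t) \<and> 0 \<le> y"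
          by blast
      qed
      then have "poly R y - poly R x \<le> K * (arctan (real N * y) - arctan (real N * x))"
        by (simp add: algebra_simps)
      also have "\<dots> \<le> K * 4"
        using arctan_bounded[of "real N * y"] arctan_bounded[of "real N * x"] pi_less_4
        by (intro mult_left_mono K) linarith
      finally show ?thesis by (simp add: K_def mult.commute)
    qed
    \<comment> \<open>The affine normalisation makes \<open>p\<close> rise from 0 at
      \<open>- (2 * L)\<close> to 1 at \<open>2 * L\<close>.\<close>
    define p where "p = smult (1 / Z) (R - [:poly R (- (2 * L)):])"
    have pv: "poly p v = (poly R v - poly R (- (2 * L))) / Z" for v by (simp add: p_def)
    have close: "\<bar>poly p v - indicator {0<..} v\<bar> \<le> C / (1 + (real N * v)\<^sup>2)" if v: "\<bar>v\<bar> \<le> 2 * L" for v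
    proof -
      \<comment> \<open>By monotonicity the error at \<open>v\<close> is the normalised kernel mass
        between \<open>v\<close> and the endpoint on its own side of 0, an interval on which
        \<open>\<bar>t\<bar> \<ge> \<bar>v\<bar>\<close>.\<close>
      have "\<exists>x y. x \<le> y \<and> - (2 * L) \<le> x \<and> y \<le> 2 * L \<and> (\<forall>t. x \<le> t \<longrightarrow> t \<le> y \<longrightarrow> \<bar>v\<bar> \<le> \<bar>t\<bar>) \<and>
         \<bar>poly p v - indicator {0<..} v\<bar> = (poly R y - poly R x) / Z"
      proof (cases "0 < v")
        case True
        have "poly p v - 1 = - ((poly R (2 * L) - poly R v) / Z)"
        proof -
          have "poly p v - 1 = (poly R v - poly R (- (2 * L)) - Z) / Z"
            using Z by (simp add: pv diff_divide_distrib)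
          then show ?thesis by (simp add: Z_def minus_divide_left)
        qed
        then have "\<bar>poly p v - indicator {0<..} v\<bar> = (poly R (2 * L) - poly R v) / Z"
          using True Z mono[of v "2 * L"] v by simp
        with True v show ?thesis by (intro exI[of _ v] exI[of _ "2 * L"]) auto
      next
        case False
        then have "\<bar>poly p v - indicator {0<..} v\<bar> = (poly R v - poly R (- (2 * L))) / Z"
          using Z mono[of "- (2 * L)" v] v by (simp add: pv)
        with False v show ?thesis by (intro exI[of _ "- (2 * L)"] exI[of _ v]) auto
      qed
      then obtain x y where xy: "x \<le> y" "- (2 * L) \<le> x" "y \<le> 2 * L" "\<And>t. x \<le> t \<Longrightarrow> t \<le> y \<Longrightarrow> \<bar>v\<bar> \<le> \<bar>t\<bar>"
        and e: "\<bar>poly p v - indicator {0<..} v\<bar> = (poly R y - poly R x) / Z" by blast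
      have "(poly R y - poly R x) / Z = (poly R y - poly R x) * (1 / Z)" by simp
      also have "\<dots> \<le> (4 * D / (real N * (1 + (real N * v)\<^sup>2))) * (256 * b * real N)"
        using tail[OF xy] Zinv mono[OF xy(1)] Z D by (intro mult_mono) auto
      also have "\<dots> = C / (1 + (real N * v)\<^sup>2)" using N by (simp add: C_def)
      finally show ?thesis using e by simp
    qed
    have deg: "degree p \<le> A * N"
    proof -
      have "degree (S ^ 4) \<le> 4 * m"
        using degree_power_le[of S 4] degree_sinc_poly[of m "real N"] unfolding S_def
        by (meson mult_le_mono2 order_trans mult.commute[THEN ord_eq_le_trans])
      then have "degree R \<le> 4 * m + 1" using degree_poly_integral[of "S ^ 4"] by (simp add: R_def)
      then have "degree p \<le> 4 * m + 1"
        unfolding p_def by (intro order_trans[OF degree_smult_le] degree_diff_le) auto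
      also have "4 * m + 1 \<le> (4 * a + 4) * N" using N by (simp add: m_def algebra_simps)
      also have "\<dots> \<le> A * N" using A by (intro mult_right_mono) auto
      finally show ?thesis .
    qed
    have AN1: "1 \<le> real (A * N) ^ (A * N)"
    proof -
      have "1 \<le> A * N" using N A by (simp add: Suc_le_eq)
      then show ?thesis by (intro one_le_power) linarith
    qed
    have cf: "\<bar>coeff p k\<bar> \<le> real (A * N) ^ (A * N)" for k
    proof (cases k)
      case 0
      \<comment> \<open>The constant coefficient carries the shift and is not a coefficient of the
        antiderivative; it is \<open>p\<close> at 0, a value between 0 and 1.\<close>
      have "coeff p 0 = poly p 0" by (simp add: poly_0_coeff_0)
      also have "\<dots> = - poly R (- (2 * L)) / Z" by (simp add: pv R0)
      also have "\<bar>\<dots>\<bar> \<le> 1"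
      proof -
        have "- poly R (- (2 * L)) \<le> Z" "0 \<le> - poly R (- (2 * L))"
          using mono[of "- (2 * L)" 0] mono[of 0 "2 * L"] R0 L by (simp_all add: Z_def)
        then show ?thesis using Z by (simp add: abs_divide pos_le_divide_eq)
      qed
      finally show ?thesis using AN1 0 by simp
    next
      case (Suc i)
      have R: "\<bar>coeff R k\<bar> \<le> \<bar>coeff (S ^ 4) i\<bar>"
        unfolding R_def Suc coeff_poly_integral_Suc by (simp add: abs_divide divide_le_eq mult_le_cancel_left1)
      have "\<bar>coeff p k\<bar> = \<bar>coeff R k\<bar> * (1 / Z)"
        using Z by (simp add: p_def Suc abs_mult)
      also have "\<dots> \<le> ((2 * real m + 1) * (real m + 1)\<^sup>2 * real N ^ (4 * m)) * (256 * b * real N)"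
        using order_trans[OF R abs_coeff_sinc_poly_power_4[OF N, of m i, folded S_def]] Zinv Z
        by (intro mult_mono) auto
      also have "\<dots> \<le> ((3 * real m) * (2 * real m)\<^sup>2 * real N ^ (4 * m)) * (256 * b * real N)"
        using m b by (intro mult_right_mono mult_mono power_mono) auto
      also have "\<dots> = (3072 * b * real a ^ 3) * (real N ^ (4 * m + 4))"
        by (simp add: m_def power_add eval_nat_numeral del: power_mult)
      also have "\<dots> \<le> real A * real N ^ (A * N)"
      proof (intro mult_mono power_increasing A)
        have "4 * m + 4 \<le> (4 * a + 4) * N" using N by (simp add: m_def algebra_simps)
        also have "\<dots> \<le> A * N" using A by (intro mult_right_mono) auto
        finally show "4 * m + 4 \<le> A * N" .
      qed (use N in auto)
      also have "\<dots> \<le> real A ^ (A * N) * real N ^ (A * N)"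
        using A N by (intro mult_right_mono self_le_power) auto
      finally show ?thesis by (simp add: power_mult_distrib)
    qed
    show "\<exists>p. degree p \<le> A * N \<and> (\<forall>k. \<bar>coeff p k\<bar> \<le> real (A * N) ^ (A * N)) \<and>
       (\<forall>v. \<bar>v\<bar> \<le> 2 * L \<longrightarrow> \<bar>poly p v - indicator {0<..} v\<bar> \<le> C / (1 + (real N * v)\<^sup>2))"
      using deg cf close by blast
  qed
qed

section \<open>Wasserstein distance and characteristic functions\<close>

lemma nn_integral_abs_indicator_atLeast_diff:
  fixes a b L :: real
  assumes "a \<in> {-L..L}" "b \<in> {-L..L}"
  shows "(\<integral>\<^sup>+x\<in>{-L..L}. ennreal \<bar>indicator {a..} x - indicator {b..} x\<bar> \<partial>lborel) = ennreal \<bar>a - b\<bar>"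
proof -
  have "(\<integral>\<^sup>+x\<in>{-L..L}. ennreal \<bar>indicator {a..} x - indicator {b..} x\<bar> \<partial>lborel)
      = (\<integral>\<^sup>+x. indicator {min a b..<max a b} x \<partial>lborel)"
    using assms by (intro nn_integral_cong) (auto simp: indicator_def min_def max_def)
  also have "\<dots> = ennreal \<bar>a - b\<bar>" by (simp add: min_def max_def abs_if)
  finally show ?thesis .
qed

text \<open>Upper bound through the quantile coupling; equality is not needed.\<close>

lemma wasserstein1_le_cdf:
  fixes \<mu> \<nu> :: "real measure"
  assumes "real_distribution \<mu>" "real_distribution \<nu>"
    and supp: "emeasure \<mu> {-L..L} = 1" "emeasure \<nu> {-L..L} = 1"
  shows "wasserstein1 \<mu> \<nu> \<le> (\<integral>\<^sup>+x\<in>{-L..L}. ennreal \<bar>cdf \<mu> x - cdf \<nu> x\<bar> \<partial>lborel)"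
proof -
  \<comment> \<open>\<open>Inf {x. \<omega> \<le> cdf \<rho> x}\<close> is the quantile function,
    written \<open>I\<close> in \<open>cdf_distribution\<close>; the distribution function vanishes
    below \<open>-L\<close> and is 1 at \<open>L\<close>, which confines it.\<close>
  have quantile_support: "cdf_distribution \<rho> \<and> (\<forall>\<omega>\<in>{0<..<1}. Inf {x. \<omega> \<le> cdf \<rho> x} \<in> {-L..L})"
    if "real_distribution \<rho>" and s: "emeasure \<rho> {-L..L} = 1" for \<rho>
  proof -
    interpret real_distribution \<rho> by fact
    interpret R: cdf_distribution \<rho> ..
    have m: "measure \<rho> {-L..L} = 1" using s by (simp add: measure_def)
    have "cdf \<rho> L = 1"
      unfolding cdf_def by (rule antisym[OF prob_le_1]) (subst m[symmetric], rule finite_measure_mono, auto)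
    moreover have "cdf \<rho> x = 0" if "x < -L" for x
    proof -
      have "measure \<rho> {..x} + measure \<rho> {-L..L} = measure \<rho> ({..x} \<union> {-L..L})"
        using that by (intro finite_measure_Union[symmetric]) auto
      then show ?thesis unfolding cdf_def m using prob_le_1[of "{..x} \<union> {-L..L}"] measure_nonneg[of \<rho> "{..x}"] by linarith
    qed
    ultimately have "R.I \<omega> \<in> {-L..L}" if w: "\<omega> \<in> {0<..<1}" for \<omega>
    proof -
      have le: "\<omega> \<le> cdf \<rho> x \<longleftrightarrow> R.I \<omega> \<le> x" for x using w R.pseudoinverse[of \<omega> x] by auto
      have "R.I \<omega> \<le> L" using le[of L] w \<open>cdf \<rho> L = 1\<close> by (metis greaterThanLessThan_iff less_imp_le)
      moreover have "\<not> R.I \<omega> < - L"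
      proof
        assume "R.I \<omega> < - L"
        then have "cdf \<rho> (R.I \<omega>) = 0" by (rule \<open>\<And>x. x < - L \<Longrightarrow> cdf \<rho> x = 0\<close>)
        moreover have "\<omega> \<le> cdf \<rho> (R.I \<omega>)" using le[of "R.I \<omega>"] by blast
        ultimately show False using w by simp
      qed
      ultimately show ?thesis by simp
    qed
    then show ?thesis using R.cdf_distribution_axioms by blast
  qed
  interpret A: cdf_distribution \<mu> using quantile_support assms by blast
  interpret B: cdf_distribution \<nu> using quantile_support assms by blast
  have A_supp: "A.I \<omega> \<in> {-L..L}" if "\<omega> \<in> {0<..<1}" for \<omega>
    using quantile_support[OF assms(1,3)] that by blast
  have B_supp: "B.I \<omega> \<in> {-L..L}" if "\<omega> \<in> {0<..<1}" for \<omega>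
    using quantile_support[OF assms(2,4)] that by blast
  define \<Omega> where "\<Omega> = restrict_space lborel {0<..<1::real}"
  have sets_\<Omega>: "sets \<Omega> = sets (restrict_space borel {0<..<1::real})"
    unfolding \<Omega>_def by (intro sets_restrict_space_cong) simp
  have space_\<Omega>: "space \<Omega> = {0<..<1}" by (simp add: \<Omega>_def space_restrict_space)
  have [measurable]: "A.I \<in> borel_measurable \<Omega>" "B.I \<in> borel_measurable \<Omega>"
    using A.measurable_CI B.measurable_CI by (simp_all cong: measurable_cong_sets add: sets_\<Omega>)
  interpret \<Omega>: sigma_finite_measure \<Omega>
    unfolding \<Omega>_def by (intro sigma_finite_measure_restrict_space sigma_finite_lborel) auto
  interpret P: pair_sigma_finite lborel \<Omega> ..
  define \<gamma> where "\<gamma> = distr \<Omega> (borel \<Otimes>\<^sub>M borel) (\<lambda>\<omega>. (A.I \<omega>, B.I \<omega>))"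
  have "\<gamma> \<in> couplings \<mu> \<nu>"
    using A.distr_I_eq_M B.distr_I_eq_M
    by (auto simp: couplings_def \<gamma>_def distr_distr comp_def \<Omega>_def[symmetric])
  then have "wasserstein1 \<mu> \<nu> \<le> (\<integral>\<^sup>+(s, t). ennreal \<bar>s - t\<bar> \<partial>\<gamma>)"
    unfolding wasserstein1_def by (rule INF_lower)
  also have "\<dots> = (\<integral>\<^sup>+\<omega>. ennreal \<bar>A.I \<omega> - B.I \<omega>\<bar> \<partial>\<Omega>)"
    unfolding \<gamma>_def by (subst nn_integral_distr) auto
  \<comment> \<open>The distance of two quantiles is the length of the set of thresholds
    \<open>x\<close> that separate them; exchanging the integrals then replaces quantiles by
    distribution functions.\<close>
  also have "\<dots> = (\<integral>\<^sup>+\<omega>. (\<integral>\<^sup>+x\<in>{-L..L}. ennreal \<bar>indicator {A.I \<omega>..} x - indicator {B.I \<omega>..} x\<bar> \<partial>lborel) \<partial>\<Omega>)"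
    by (intro nn_integral_cong nn_integral_abs_indicator_atLeast_diff[symmetric] A_supp B_supp)
       (auto simp: space_\<Omega>)
  also have "\<dots> = (\<integral>\<^sup>+x. (\<integral>\<^sup>+\<omega>. ennreal \<bar>indicator {A.I \<omega>..} x - indicator {B.I \<omega>..} x\<bar> * indicator {-L..L} x \<partial>\<Omega>) \<partial>lborel)"
  proof (rule P.Fubini')
    \<comment> \<open>The set \<open>{A.I \<omega>..}\<close> moves with \<open>\<omega>\<close>, so
      membership is written as an inequality between measurable functions.\<close>
    have "(\<lambda>(x, \<omega>). ennreal \<bar>(if A.I \<omega> \<le> x then 1 else 0) - (if B.I \<omega> \<le> x then 1 else 0)\<bar> * indicator {-L..L} x)
        \<in> borel_measurable (lborel \<Otimes>\<^sub>M \<Omega>)" by measurable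
    then show "(\<lambda>(x, \<omega>). ennreal \<bar>indicator {A.I \<omega>..} x - indicator {B.I \<omega>..} x\<bar> * indicator {-L..L} x)
        \<in> borel_measurable (lborel \<Otimes>\<^sub>M \<Omega>)" by (simp add: indicator_def)
  qed
  also have "\<dots> \<le> (\<integral>\<^sup>+x\<in>{-L..L}. ennreal \<bar>cdf \<mu> x - cdf \<nu> x\<bar> \<partial>lborel)"
  proof (rule nn_integral_mono)
    fix x :: real
    \<comment> \<open>\<open>I \<omega> \<le> x\<close> is equivalent to
      \<open>\<omega> \<le> cdf x\<close>, so the two indicators differ exactly for
      \<open>\<omega>\<close> between the two values of the distribution functions.\<close>
    let ?lo = "min (cdf \<mu> x) (cdf \<nu> x)" and ?hi = "max (cdf \<mu> x) (cdf \<nu> x)"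
    have "(\<integral>\<^sup>+\<omega>. ennreal \<bar>indicator {A.I \<omega>..} x - indicator {B.I \<omega>..} x\<bar> \<partial>\<Omega>)
       \<le> (\<integral>\<^sup>+\<omega>\<in>{0<..<1}. indicator {?lo<..?hi} \<omega> \<partial>lborel)"
      unfolding \<Omega>_def
    proof (subst nn_integral_restrict_space, simp, rule nn_integral_mono)
      fix \<omega> :: real
      show "ennreal \<bar>indicator {A.I \<omega>..} x - indicator {B.I \<omega>..} x\<bar> * indicator {0<..<1} \<omega>
        \<le> indicator {?lo<..?hi} \<omega> * indicator {0<..<1} \<omega>"
      proof (cases "\<omega> \<in> {0<..<1}")
        case True
        then have "A.I \<omega> \<le> x \<longleftrightarrow> \<omega> \<le> cdf \<mu> x" "B.I \<omega> \<le> x \<longleftrightarrow> \<omega> \<le> cdf \<nu> x"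
          using A.pseudoinverse[of \<omega> x] B.pseudoinverse[of \<omega> x] by auto
        then show ?thesis by (auto simp: indicator_def)
      qed simp
    qed
    also have "\<dots> \<le> (\<integral>\<^sup>+\<omega>. indicator {?lo<..?hi} \<omega> \<partial>lborel)"
      by (intro nn_integral_mono) (auto simp: indicator_def)
    also have "\<dots> = ennreal \<bar>cdf \<mu> x - cdf \<nu> x\<bar>" by (simp add: min_def max_def abs_if)
    finally show "(\<integral>\<^sup>+\<omega>. ennreal \<bar>indicator {A.I \<omega>..} x - indicator {B.I \<omega>..} x\<bar> * indicator {-L..L} x \<partial>\<Omega>)
      \<le> ennreal \<bar>cdf \<mu> x - cdf \<nu> x\<bar> * indicator {-L..L} x"
      by (cases "x \<in> {-L..L}") auto
  qed
  finally show ?thesis .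
qed

section \<open>Trigonometric polynomials and characteristic functions\<close>

lemma sin_power_eq_iexp_sum:
  "complex_of_real (sin z ^ k) =
     (\<Sum>j\<le>k. of_nat (k choose j) * (-1) ^ (k - j) / (2 * \<i>) ^ k * iexp (of_int (2 * int j - int k) * z))"
proof -
  have "complex_of_real (sin z ^ k) = ((iexp z + - iexp (- z)) / (2 * \<i>)) ^ k"
    by (simp add: sin_exp_eq flip: sin_of_real)
  also have "\<dots> = (iexp z + - iexp (- z)) ^ k / (2 * \<i>) ^ k"
    by (rule power_divide)
  also have "\<dots> = (\<Sum>j\<le>k. of_nat (k choose j) * iexp z ^ j * (- iexp (- z)) ^ (k - j)) / (2 * \<i>) ^ k"
    by (simp only: binomial_ring)
  also have "\<dots> = (\<Sum>j\<le>k. of_nat (k choose j) * (-1) ^ (k - j) / (2 * \<i>) ^ k * iexp (of_int (2 * int j - int k) * z))"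
    unfolding sum_divide_distrib
  proof (intro sum.cong refl)
    fix j assume "j \<in> {..k}"
    then have "iexp z ^ j * iexp (- z) ^ (k - j) = iexp (of_int (2 * int j - int k) * z)"
      unfolding exp_of_nat_mult[symmetric] exp_add[symmetric]
      by (simp add: of_nat_diff algebra_simps)
    moreover have "(- iexp (- z)) ^ (k - j) = (-1) ^ (k - j) * iexp (- z) ^ (k - j)"
      by (rule power_minus)
    ultimately show "of_nat (k choose j) * iexp z ^ j * (- iexp (- z)) ^ (k - j) / (2 * \<i>) ^ k
      = of_nat (k choose j) * (-1) ^ (k - j) / (2 * \<i>) ^ k * iexp (of_int (2 * int j - int k) * z)"
      by (simp add: mult_ac)
  qed
  finally show ?thesis .
qed

lemma integral_sin_power_eq_char:
  assumes "real_distribution \<mu>"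
  shows "complex_of_real (\<integral>\<theta>. sin (s * (\<theta> - y)) ^ k \<partial>\<mu>) =
     (\<Sum>j\<le>k. of_nat (k choose j) * (-1) ^ (k - j) / (2 * \<i>) ^ k * iexp (- (of_int (2 * int j - int k) * s * y))
        * char \<mu> (of_int (2 * int j - int k) * s))"
proof -
  interpret real_distribution \<mu> by fact
  let ?c = "\<lambda>j. of_nat (k choose j) * (-1) ^ (k - j) / (2 * \<i>) ^ k :: complex"
  have [measurable]: "iexp \<in> borel_measurable borel" by (simp add: borel_measurable_continuous_onI)
  have int: "integrable \<mu> (\<lambda>\<theta>. iexp (t * (\<theta> - y)))" for t
    by (rule integrable_iexp) measurable
  have char_shift: "(\<integral>\<theta>. iexp (t * (\<theta> - y)) \<partial>\<mu>) = iexp (- (t * y)) * char \<mu> t" for t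
  proof -
    have "iexp (t * (\<theta> - y)) = iexp (- (t * y)) * iexp (t * \<theta>)" for \<theta>
      by (simp add: exp_add[symmetric] algebra_simps)
    then show ?thesis unfolding char_def by (simp add: mult_ac)
  qed
  have "complex_of_real (\<integral>\<theta>. sin (s * (\<theta> - y)) ^ k \<partial>\<mu>)
      = (\<integral>\<theta>. (\<Sum>j\<le>k. ?c j * iexp (of_int (2 * int j - int k) * s * (\<theta> - y))) \<partial>\<mu>)"
    unfolding integral_complex_of_real[symmetric] sin_power_eq_iexp_sum by (simp add: mult_ac)
  also have "\<dots> = (\<Sum>j\<le>k. ?c j * (\<integral>\<theta>. iexp (of_int (2 * int j - int k) * s * (\<theta> - y)) \<partial>\<mu>))"
  proof -
    have "integrable \<mu> (\<lambda>\<theta>. ?c j * iexp (of_int (2 * int j - int k) * s * (\<theta> - y)))" for j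
      by (intro integrable_mult_right int)
    then show ?thesis
      by (subst Bochner_Integration.integral_sum) (blast, simp only: integral_mult_right_zero)
  qed
  finally show ?thesis unfolding char_shift by (simp add: mult_ac)
qed

text \<open>The Fourier coefficients of the \<open>k\<close>-th power of a sine have absolute values
  \<open>(k choose j) / 2 ^ k\<close>, which sum to 1, and the shift by \<open>y\<close> only
  rotates their phases. Hence the discrepancy is not amplified, whatever \<open>k\<close> and
  \<open>y\<close> are.\<close>

lemma integral_sin_power_diff_le:
  assumes \<mu>: "real_distribution \<mu>" and \<nu>: "real_distribution \<nu>"
    and \<Delta>: "\<And>j :: int. \<bar>j\<bar> \<le> int k \<Longrightarrow> cmod (char \<mu> (of_int j * s) - char \<nu> (of_int j * s)) \<le> \<Delta>"
  shows "\<bar>(\<integral>\<theta>. sin (s * (\<theta> - y)) ^ k \<partial>\<mu>) - (\<integral>\<theta>. sin (s * (\<theta> - y)) ^ k \<partial>\<nu>)\<bar> \<le> \<Delta>"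
proof -
  let ?c = "\<lambda>j. of_nat (k choose j) * (-1) ^ (k - j) / (2 * \<i>) ^ k * iexp (- (of_int (2 * int j - int k) * s * y)) :: complex"
  let ?t = "\<lambda>j. of_int (2 * int j - int k) * s"
  have "\<bar>(\<integral>\<theta>. sin (s * (\<theta> - y)) ^ k \<partial>\<mu>) - (\<integral>\<theta>. sin (s * (\<theta> - y)) ^ k \<partial>\<nu>)\<bar>
     = cmod (complex_of_real (\<integral>\<theta>. sin (s * (\<theta> - y)) ^ k \<partial>\<mu>) - complex_of_real (\<integral>\<theta>. sin (s * (\<theta> - y)) ^ k \<partial>\<nu>))"
    by (simp flip: of_real_diff)
  also have "\<dots> = cmod (\<Sum>j\<le>k. ?c j * (char \<mu> (?t j) - char \<nu> (?t j)))"
    unfolding integral_sin_power_eq_char[OF \<mu>] integral_sin_power_eq_char[OF \<nu>]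
    by (simp add: sum_subtractf[symmetric] right_diff_distrib)
  also have "\<dots> \<le> (\<Sum>j\<le>k. cmod (?c j) * cmod (char \<mu> (?t j) - char \<nu> (?t j)))"
    by (rule order_trans[OF norm_sum]) (simp only: norm_mult order_refl)
  also have "\<dots> \<le> (\<Sum>j\<le>k. real (k choose j) / 2 ^ k * \<Delta>)"
  proof (intro sum_mono mult_mono)
    fix j assume "j \<in> {..k}"
    then show "cmod (char \<mu> (?t j) - char \<nu> (?t j)) \<le> \<Delta>" by (intro \<Delta>) auto
    show "cmod (?c j) \<le> real (k choose j) / 2 ^ k"
      by (simp add: norm_mult norm_divide norm_power)
  qed auto
  also have "\<dots> = \<Delta>"
  proof -
    have "(\<Sum>j\<le>k. real (k choose j)) = 2 ^ k"
      using choose_row_sum[of k] by (simp flip: of_nat_sum)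
    then show ?thesis by (simp flip: sum_distrib_right sum_divide_distrib)
  qed
  finally show ?thesis .
qed

text \<open>With \<open>sin (s * t) / s\<close> in place of \<open>t\<close>, a polynomial becomes a
  trigonometric polynomial whose frequencies are at most \<open>degree p * s\<close>. The whole cost
  is the weight \<open>1 / s ^ k\<close> on the \<open>k\<close>-th coefficient.\<close>

lemma integral_poly_sin_diff_le:
  assumes \<mu>: "real_distribution \<mu>" and \<nu>: "real_distribution \<nu>"
    and \<Delta>: "\<And>j :: int. \<bar>j\<bar> \<le> int (degree p) \<Longrightarrow> cmod (char \<mu> (of_int j * s) - char \<nu> (of_int j * s)) \<le> \<Delta>"
    and s: "0 < s"
  shows "\<bar>(\<integral>\<theta>. poly p (sin (s * (\<theta> - y)) / s) \<partial>\<mu>) - (\<integral>\<theta>. poly p (sin (s * (\<theta> - y)) / s) \<partial>\<nu>)\<bar>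
    \<le> (\<Sum>k\<le>degree p. \<bar>coeff p k\<bar> / s ^ k) * \<Delta>"
proof -
  have expand: "(\<integral>\<theta>. poly p (sin (s * (\<theta> - y)) / s) \<partial>\<rho>) =
     (\<Sum>k\<le>degree p. coeff p k / s ^ k * (\<integral>\<theta>. sin (s * (\<theta> - y)) ^ k \<partial>\<rho>))" if "real_distribution \<rho>" for \<rho>
  proof -
    interpret real_distribution \<rho> by fact
    have "integrable \<rho> (\<lambda>\<theta>. sin (s * (\<theta> - y)) ^ k)" for k
      by (rule integrable_const_bound[where B = 1]) (auto simp: power_abs power_le_one)
    then have "(\<integral>\<theta>. (\<Sum>k\<le>degree p. coeff p k / s ^ k * sin (s * (\<theta> - y)) ^ k) \<partial>\<rho>) =
       (\<Sum>k\<le>degree p. coeff p k / s ^ k * (\<integral>\<theta>. sin (s * (\<theta> - y)) ^ k \<partial>\<rho>))"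
      by (subst Bochner_Integration.integral_sum) auto
    then show ?thesis by (simp add: poly_altdef power_divide)
  qed
  have "\<bar>(\<integral>\<theta>. poly p (sin (s * (\<theta> - y)) / s) \<partial>\<mu>) - (\<integral>\<theta>. poly p (sin (s * (\<theta> - y)) / s) \<partial>\<nu>)\<bar>
     = \<bar>\<Sum>k\<le>degree p. coeff p k / s ^ k * ((\<integral>\<theta>. sin (s * (\<theta> - y)) ^ k \<partial>\<mu>) - (\<integral>\<theta>. sin (s * (\<theta> - y)) ^ k \<partial>\<nu>))\<bar>"
    unfolding expand[OF \<mu>] expand[OF \<nu>] by (simp add: sum_subtractf[symmetric] right_diff_distrib)
  also have "\<dots> \<le> (\<Sum>k\<le>degree p. \<bar>coeff p k\<bar> / s ^ k * \<Delta>)"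
  proof (rule order_trans[OF sum_abs], unfold abs_mult, intro sum_mono mult_mono)
    fix k assume "k \<in> {..degree p}"
    then show "\<bar>(\<integral>\<theta>. sin (s * (\<theta> - y)) ^ k \<partial>\<mu>) - (\<integral>\<theta>. sin (s * (\<theta> - y)) ^ k \<partial>\<nu>)\<bar> \<le> \<Delta>"
      by (intro integral_sin_power_diff_le \<mu> \<nu> \<Delta>) auto
  qed (use s in \<open>auto simp: abs_divide power_abs\<close>)
  finally show ?thesis by (simp add: sum_distrib_right)
qed

section \<open>From characteristic functions to distribution functions\<close>

lemma nn_integral_lorentz_le:
  fixes c a l u :: real
  assumes "0 < c" "l \<le> u" "0 \<le> K"
  shows "(\<integral>\<^sup>+y\<in>{l..u}. ennreal (K / (1 + (c * (a - y))\<^sup>2)) \<partial>lborel) \<le> ennreal (4 * K / c)"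
proof -
  let ?F = "\<lambda>y. K / c * arctan (c * (y - a))"
  have "(\<integral>\<^sup>+y\<in>{l..u}. ennreal (K / (1 + (c * (a - y))\<^sup>2)) \<partial>lborel) = ennreal (?F u - ?F l)"
  proof (rule nn_integral_FTC_Icc[where F = ?F])
    fix y
    have "(c * (a - y))\<^sup>2 = (c * (y - a))\<^sup>2" by (simp add: power_mult_distrib power2_commute)
    then show "(?F has_real_derivative K / (1 + (c * (a - y))\<^sup>2)) (at y)"
      using assms by (auto intro!: derivative_eq_intros simp: divide_simps)
    show "0 \<le> K / (1 + (c * (a - y))\<^sup>2)" for y using assms by (intro divide_nonneg_nonneg add_nonneg_nonneg) auto
  qed (use assms in auto)
  also have "?F u - ?F l = K / c * (arctan (c * (u - a)) - arctan (c * (l - a)))"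
    by (simp add: right_diff_distrib)
  also have "ennreal \<dots> \<le> ennreal (K / c * 4)"
    using arctan_bounded[of "c * (u - a)"] arctan_bounded[of "c * (l - a)"] pi_less_4 assms
    by (intro ennreal_leI mult_left_mono) auto
  finally show ?thesis by (simp add: mult_ac)
qed

text \<open>\<open>1 - cdf \<mu> y\<close> is the integral of the Heaviside function of
  \<open>\<theta> - y\<close>, which is replaced by \<open>poly p (sin (s * t) / s)\<close>. For
  \<open>\<bar>s * t\<bar> \<le> 1\<close> the argument \<open>v = sin (s * t) / s\<close> has the
  sign of \<open>t\<close> and satisfies
  \<open>\<bar>t\<bar> / 2 \<le> \<bar>v\<bar> \<le> \<bar>t\<bar>\<close>: the sign leaves the
  Heaviside function unchanged, and the half turns \<open>c\<close> into \<open>c / 2\<close>. The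
  approximation error remains an integral in \<open>\<theta>\<close>, because it is not small for
  atoms close to \<open>y\<close>; only the integral over \<open>y\<close> is.\<close>

lemma cdf_diff_le_char:
  fixes \<mu> \<nu> :: "real measure"
  assumes \<mu>: "real_distribution \<mu>" and \<nu>: "real_distribution \<nu>"
    and supp: "emeasure \<mu> {-L..L} = 1" "emeasure \<nu> {-L..L} = 1"
    and s: "0 < s" "2 * L * s \<le> 1" and C: "0 \<le> C" and y: "y \<in> {-L..L}" and c: "0 \<le> c"
    and p: "\<And>v. \<bar>v\<bar> \<le> 2 * L \<Longrightarrow> \<bar>poly p v - indicator {0<..} v\<bar> \<le> C / (1 + (c * v)\<^sup>2)"
    and \<Delta>: "\<And>j :: int. \<bar>j\<bar> \<le> int (degree p) \<Longrightarrow> cmod (char \<mu> (of_int j * s) - char \<nu> (of_int j * s)) \<le> \<Delta>"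
  shows "ennreal \<bar>cdf \<mu> y - cdf \<nu> y\<bar> \<le> (\<integral>\<^sup>+\<theta>. ennreal (C / (1 + (c / 2 * (\<theta> - y))\<^sup>2)) \<partial>\<mu>)
     + (\<integral>\<^sup>+\<theta>. ennreal (C / (1 + (c / 2 * (\<theta> - y))\<^sup>2)) \<partial>\<nu>) + ennreal ((\<Sum>k\<le>degree p. \<bar>coeff p k\<bar> / s ^ k) * \<Delta>)"
proof -
  define \<Psi> where "\<Psi> = (\<lambda>t. poly p (sin (s * t) / s))"
  define q where "q = (\<lambda>t. C / (1 + (c / 2 * t)\<^sup>2))"
  have q0: "0 \<le> q t" and qC: "q t \<le> C" for t
    using C by (simp_all add: q_def divide_le_eq add_pos_nonneg mult_le_cancel_left1)
  have \<Psi>m[measurable]: "\<Psi> \<in> borel_measurable borel"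
    unfolding \<Psi>_def by (intro borel_measurable_continuous_onI continuous_intros) (use s in auto)
  have qm[measurable]: "q \<in> borel_measurable borel" unfolding q_def by measurable
  have close: "\<bar>\<Psi> t - indicator {0<..} t\<bar> \<le> q t" if t: "\<bar>t\<bar> \<le> 2 * L" for t
  proof -
    define v where "v = sin (s * t) / s"
    have st: "\<bar>s * t\<bar> \<le> 1"
    proof -
      have "\<bar>s * t\<bar> = s * \<bar>t\<bar>" using s by (simp add: abs_mult)
      also have "\<dots> \<le> s * (2 * L)" using t s by (intro mult_left_mono) auto
      also have "\<dots> \<le> 1" using s by (simp add: mult_ac)
      finally show ?thesis .
    qed
    then have d: "\<bar>sin (s * t) - s * t\<bar> \<le> \<bar>s * t\<bar> / 2" by (rule abs_sin_minus_self_le)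
    have vd: "\<bar>v - t\<bar> \<le> \<bar>t\<bar> / 2"
    proof -
      have "\<bar>v - t\<bar> = \<bar>sin (s * t) - s * t\<bar> / s" 
      proof -
        have "v - t = (sin (s * t) - s * t) / s" using s by (simp add: v_def diff_divide_distrib)
        then show ?thesis using s by (simp add: abs_divide)
      qed
      also have "\<dots> \<le> (\<bar>s * t\<bar> / 2) / s" using d s by (intro divide_right_mono) auto
      also have "\<dots> = \<bar>t\<bar> / 2" using s by (simp add: abs_mult)
      finally show ?thesis .
    qed
    have sgn: "indicator {0<..} v = (indicator {0<..} t :: real)"
      using vd by (auto simp: indicator_def abs_if split: if_splits)
    have vL: "\<bar>v\<bar> \<le> 2 * L"
    proof -
      have "\<bar>v\<bar> \<le> \<bar>s * t\<bar> / s" unfolding v_def abs_divide using abs_sin_x_le_abs_x[of "s * t"] s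
        by (simp add: divide_right_mono)
      then show ?thesis using t s by (simp add: abs_mult)
    qed
    have "\<bar>c / 2 * t\<bar> \<le> \<bar>c * v\<bar>"
    proof -
      have "\<bar>t\<bar> / 2 \<le> \<bar>v\<bar>" using vd by linarith
      from mult_left_mono[OF this c] show ?thesis using c by (simp add: abs_mult)
    qed
    then have "(c / 2 * t)\<^sup>2 \<le> (c * v)\<^sup>2" by (subst abs_le_square_iff[symmetric])
    then have "C / (1 + (c * v)\<^sup>2) \<le> q t"
      unfolding q_def using C by (intro divide_left_mono mult_pos_pos) (auto simp: add_pos_nonneg)
    then show ?thesis using p[OF vL] sgn by (simp add: \<Psi>_def v_def)
  qed
  have part: "\<bar>(1 - cdf \<rho> y) - (\<integral>\<theta>. \<Psi> (\<theta> - y) \<partial>\<rho>)\<bar> \<le> (\<integral>\<theta>. q (\<theta> - y) \<partial>\<rho>) \<and> integrable \<rho> (\<lambda>\<theta>. q (\<theta> - y))"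
    if "real_distribution \<rho>" and s1: "emeasure \<rho> {-L..L} = 1" for \<rho>
  proof -
    interpret real_distribution \<rho> by fact
    have AE: "AE \<theta> in \<rho>. \<theta> \<in> {-L..L}"
      using s1 by (intro prob_eq_1[THEN iffD1]) (auto simp: measure_def)
    have iq: "integrable \<rho> (\<lambda>\<theta>. q (\<theta> - y))"
      by (rule integrable_const_bound[where B = C]) (use q0 qC in auto)
    have ih: "integrable \<rho> (\<lambda>\<theta>. indicator {0<..} (\<theta> - y) :: real)"
      by (rule integrable_const_bound[where B = 1]) auto
    have cl: "AE \<theta> in \<rho>. \<bar>indicator {0<..} (\<theta> - y) - \<Psi> (\<theta> - y)\<bar> \<le> q (\<theta> - y)"
      using AE
    proof eventually_elim
      fix \<theta> assume "\<theta> \<in> {-L..L}"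
      then have "\<bar>\<theta> - y\<bar> \<le> 2 * L" using y by auto
      from close[OF this] show "\<bar>indicator {0<..} (\<theta> - y) - \<Psi> (\<theta> - y)\<bar> \<le> q (\<theta> - y)"
        by (simp add: abs_minus_commute)
    qed
    have i\<Psi>: "integrable \<rho> (\<lambda>\<theta>. \<Psi> (\<theta> - y))"
    proof (rule integrable_const_bound[where B = "1 + C"])
      show "AE \<theta> in \<rho>. norm (\<Psi> (\<theta> - y)) \<le> 1 + C"
        using cl
      proof eventually_elim
        fix \<theta> assume "\<bar>indicator {0<..} (\<theta> - y) - \<Psi> (\<theta> - y)\<bar> \<le> q (\<theta> - y)"
        moreover have "\<bar>indicator {0<..} (\<theta> - y)\<bar> \<le> (1::real)" by (simp add: indicator_def)
        ultimately show "norm (\<Psi> (\<theta> - y)) \<le> 1 + C" using qC[of "\<theta> - y"] unfolding real_norm_def by linarith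
      qed
    qed simp
    have "1 - cdf \<rho> y = measure \<rho> {y<..}"
    proof -
      have "measure \<rho> {y<..} = measure \<rho> (space \<rho> - {..y})" by (rule arg_cong[where f = "measure \<rho>"]) auto
      also have "\<dots> = 1 - measure \<rho> {..y}" by (rule prob_compl) auto
      finally show ?thesis by (simp add: cdf_def)
    qed
    also have "\<dots> = (\<integral>\<theta>. indicator {y<..} \<theta> \<partial>\<rho>)" by simp
    also have "\<dots> = (\<integral>\<theta>. indicator {0<..} (\<theta> - y) \<partial>\<rho>)"
      by (rule Bochner_Integration.integral_cong) (auto simp: indicator_def)
    finally have "(1 - cdf \<rho> y) - (\<integral>\<theta>. \<Psi> (\<theta> - y) \<partial>\<rho>) = (\<integral>\<theta>. indicator {0<..} (\<theta> - y) - \<Psi> (\<theta> - y) \<partial>\<rho>)"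
      using ih i\<Psi> by simp
    also have "\<bar>\<dots>\<bar> \<le> (\<integral>\<theta>. \<bar>indicator {0<..} (\<theta> - y) - \<Psi> (\<theta> - y)\<bar> \<partial>\<rho>)"
      by (rule integral_abs_bound)
    also have "\<dots> \<le> (\<integral>\<theta>. q (\<theta> - y) \<partial>\<rho>)"
      by (rule integral_mono_AE) (use ih i\<Psi> iq cl in auto)
    finally show ?thesis using iq by blast
  qed
  let ?E = "(\<Sum>k\<le>degree p. \<bar>coeff p k\<bar> / s ^ k) * \<Delta>"
  have \<Delta>0: "0 \<le> \<Delta>" using \<Delta>[of 0] norm_ge_zero order_trans by (metis abs_zero of_nat_0_le_iff)
  have E0: "0 \<le> ?E" using \<Delta>0 s by (intro mult_nonneg_nonneg sum_nonneg) auto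
  have "\<bar>(\<integral>\<theta>. \<Psi> (\<theta> - y) \<partial>\<mu>) - (\<integral>\<theta>. \<Psi> (\<theta> - y) \<partial>\<nu>)\<bar> \<le> ?E"
    unfolding \<Psi>_def by (rule integral_poly_sin_diff_le[OF \<mu> \<nu> \<Delta> s(1)])
  then have "\<bar>cdf \<mu> y - cdf \<nu> y\<bar> \<le> (\<integral>\<theta>. q (\<theta> - y) \<partial>\<mu>) + (\<integral>\<theta>. q (\<theta> - y) \<partial>\<nu>) + ?E"
    using part[OF \<mu> supp(1)] part[OF \<nu> supp(2)] by linarith
  then have "ennreal \<bar>cdf \<mu> y - cdf \<nu> y\<bar> \<le> ennreal ((\<integral>\<theta>. q (\<theta> - y) \<partial>\<mu>) + (\<integral>\<theta>. q (\<theta> - y) \<partial>\<nu>) + ?E)"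
    by (rule ennreal_leI)
  also have "\<dots> = (\<integral>\<^sup>+\<theta>. ennreal (q (\<theta> - y)) \<partial>\<mu>) + (\<integral>\<^sup>+\<theta>. ennreal (q (\<theta> - y)) \<partial>\<nu>) + ennreal ?E"
    using part[OF \<mu> supp(1)] part[OF \<nu> supp(2)] q0 E0
    by (simp add: nn_integral_eq_integral ennreal_plus integral_nonneg_AE)
  finally show ?thesis by (simp add: q_def)
qed

text \<open>Integrating over \<open>y\<close> before \<open>\<theta>\<close> bounds the
  approximation error of each measure by \<open>8 * C / c\<close>, wherever its mass sits. The
  discrepancy of the characteristic functions is uniform in \<open>y\<close> and picks up the length
  \<open>2 * L\<close>.\<close>

lemma wasserstein1_le_char:
  fixes \<mu> \<nu> :: "real measure"
  assumes \<mu>: "real_distribution \<mu>" and \<nu>: "real_distribution \<nu>" and L: "0 < L"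
    and supp: "emeasure \<mu> {-L..L} = 1" "emeasure \<nu> {-L..L} = 1"
    and s: "0 < s" "2 * L * s \<le> 1" and C: "0 \<le> C" and c: "0 < c"
    and p: "\<And>v. \<bar>v\<bar> \<le> 2 * L \<Longrightarrow> \<bar>poly p v - indicator {0<..} v\<bar> \<le> C / (1 + (c * v)\<^sup>2)"
    and \<Delta>: "\<And>j :: int. \<bar>j\<bar> \<le> int (degree p) \<Longrightarrow> cmod (char \<mu> (of_int j * s) - char \<nu> (of_int j * s)) \<le> \<Delta>"
  shows "wasserstein1 \<mu> \<nu> \<le> ennreal (16 * C / c + 2 * L * (\<Sum>k\<le>degree p. \<bar>coeff p k\<bar> / s ^ k) * \<Delta>)"
proof -
  let ?E = "(\<Sum>k\<le>degree p. \<bar>coeff p k\<bar> / s ^ k) * \<Delta>"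
  have \<Delta>0: "0 \<le> \<Delta>" using \<Delta>[of 0] norm_ge_zero order_trans by (metis abs_zero of_nat_0_le_iff)
  have E0: "0 \<le> ?E" using \<Delta>0 s by (intro mult_nonneg_nonneg sum_nonneg) auto
  define q where "q = (\<lambda>t. C / (1 + (c / 2 * t)\<^sup>2))"
  have [measurable]: "q \<in> borel_measurable borel" unfolding q_def by measurable
  have tail: "(\<integral>\<^sup>+y\<in>{-L..L}. (\<integral>\<^sup>+\<theta>. ennreal (q (\<theta> - y)) \<partial>\<rho>) \<partial>lborel) \<le> ennreal (8 * C / c)"
    if "real_distribution \<rho>" for \<rho>
  proof -
    interpret real_distribution \<rho> by fact
    interpret P: pair_sigma_finite \<rho> "lborel :: real measure" ..
    have [measurable_cong]: "sets \<rho> = sets borel" by simp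
    have "(\<integral>\<^sup>+y\<in>{-L..L}. (\<integral>\<^sup>+\<theta>. ennreal (q (\<theta> - y)) \<partial>\<rho>) \<partial>lborel)
        = (\<integral>\<^sup>+y. (\<integral>\<^sup>+\<theta>. ennreal (q (\<theta> - y)) * indicator {-L..L} y \<partial>\<rho>) \<partial>lborel)"
      by (simp add: nn_integral_multc)
    also have "\<dots> = (\<integral>\<^sup>+\<theta>. (\<integral>\<^sup>+y\<in>{-L..L}. ennreal (q (\<theta> - y)) \<partial>lborel) \<partial>\<rho>)"
      by (rule P.Fubini') measurable
    also have "\<dots> \<le> (\<integral>\<^sup>+\<theta>. ennreal (4 * C / (c / 2)) \<partial>\<rho>)"
      unfolding q_def using L C c by (intro nn_integral_mono nn_integral_lorentz_le) auto
    also have "\<dots> = ennreal (8 * C / c)"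
      using emeasure_space_1 by (simp add: mult_ac)
    finally show ?thesis .
  qed
  have sm [measurable_cong]: "sets \<mu> = sets borel" "sets \<nu> = sets borel"
    using \<mu> \<nu> by (simp_all add: real_distribution.events_eq_borel)
  interpret A: real_distribution \<mu> by fact
  interpret B: real_distribution \<nu> by fact
  have "wasserstein1 \<mu> \<nu> \<le> (\<integral>\<^sup>+y\<in>{-L..L}. ennreal \<bar>cdf \<mu> y - cdf \<nu> y\<bar> \<partial>lborel)"
    by (rule wasserstein1_le_cdf[OF \<mu> \<nu> supp])
  also have "\<dots> \<le> (\<integral>\<^sup>+y\<in>{-L..L}. ((\<integral>\<^sup>+\<theta>. ennreal (q (\<theta> - y)) \<partial>\<mu>) + (\<integral>\<^sup>+\<theta>. ennreal (q (\<theta> - y)) \<partial>\<nu>) + ennreal ?E) \<partial>lborel)"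
  proof (rule nn_integral_mono)
    fix y
    show "ennreal \<bar>cdf \<mu> y - cdf \<nu> y\<bar> * indicator {-L..L} y
      \<le> ((\<integral>\<^sup>+\<theta>. ennreal (q (\<theta> - y)) \<partial>\<mu>) + (\<integral>\<^sup>+\<theta>. ennreal (q (\<theta> - y)) \<partial>\<nu>) + ennreal ?E) * indicator {-L..L} y"
      unfolding q_def using cdf_diff_le_char[OF \<mu> \<nu> supp s C _ less_imp_le[OF c] p \<Delta>, of y]
      by (cases "y \<in> {-L..L}") auto
  qed
  also have "\<dots> = (\<integral>\<^sup>+y\<in>{-L..L}. (\<integral>\<^sup>+\<theta>. ennreal (q (\<theta> - y)) \<partial>\<mu>) \<partial>lborel)
      + (\<integral>\<^sup>+y\<in>{-L..L}. (\<integral>\<^sup>+\<theta>. ennreal (q (\<theta> - y)) \<partial>\<nu>) \<partial>lborel) + (\<integral>\<^sup>+y\<in>{-L..L}. ennreal ?E \<partial>lborel)"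
    by (simp add: distrib_right nn_integral_add)
  also have "(\<integral>\<^sup>+y\<in>{-L..L}. ennreal ?E \<partial>lborel) = ennreal (2 * L * ?E)"
    using L by (subst nn_integral_cmult_indicator) (simp_all add: ennreal_mult'[symmetric] mult_ac)
  also have "(\<integral>\<^sup>+y\<in>{-L..L}. (\<integral>\<^sup>+\<theta>. ennreal (q (\<theta> - y)) \<partial>\<mu>) \<partial>lborel)
      + (\<integral>\<^sup>+y\<in>{-L..L}. (\<integral>\<^sup>+\<theta>. ennreal (q (\<theta> - y)) \<partial>\<nu>) \<partial>lborel) + ennreal (2 * L * ?E)
      \<le> ennreal (8 * C / c) + ennreal (8 * C / c) + ennreal (2 * L * ?E)"
    by (intro add_mono tail \<mu> \<nu> order_refl)
  also have "\<dots> = ennreal (16 * C / c + 2 * L * ?E)"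
    using C c L E0 by (simp add: ennreal_plus[symmetric] del: ennreal_plus)
  finally show ?thesis by (simp add: mult_ac)
qed

text \<open>\<open>D n\<close> is as large as \<open>D ^ (4 * D) \<le> n powr (1/64)\<close>
  permits: with \<open>D \<le> ln n / (256 * ln (ln n))\<close> the exponent
  \<open>4 * D * ln D\<close> is at most \<open>ln n / 64\<close>. Against the precision
  \<open>n powr (-1/32)\<close> this leaves \<open>n powr (-1/64)\<close>, negligible next to the
  approximation error of order \<open>1 / N\<close>.\<close>

lemma wasserstein1_rate:
  fixes L :: real
  assumes L: "0 < L"
  obtains M :: real and D :: "nat \<Rightarrow> nat" where "0 < M"
    "\<forall>\<^sub>F n in sequentially. 1 \<le> D n \<and> real (D n) \<le> ln (real n) \<and>
       (\<forall>\<mu> \<nu>. real_distribution \<mu> \<longrightarrow> real_distribution \<nu> \<longrightarrow>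
          emeasure \<mu> {-L..L} = 1 \<longrightarrow> emeasure \<nu> {-L..L} = 1 \<longrightarrow>
          (\<forall>j :: int. \<bar>j\<bar> \<le> int (D n) \<longrightarrow>
             cmod (char \<mu> (of_int j / real (D n)) - char \<nu> (of_int j / real (D n))) \<le> real n powr (-1/32)) \<longrightarrow>
          wasserstein1 \<mu> \<nu> < ennreal (M * (ln (ln (real n)) / ln (real n))))"
proof -
  obtain C :: real and A :: nat where C: "0 < C" and A: "1 \<le> A" and kernel:
    "\<And>N. 1 \<le> N \<Longrightarrow> \<exists>p. degree p \<le> A * N \<and> (\<forall>k. \<bar>coeff p k\<bar> \<le> real (A * N) ^ (A * N)) \<and>
       (\<forall>v. \<bar>v\<bar> \<le> 2 * L \<longrightarrow> \<bar>poly p v - indicator {0<..} v\<bar> \<le> C / (1 + (real N * v)\<^sup>2))"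
    using heaviside_poly[OF L] by blast
  \<comment> \<open>\<open>A\<close> controls degree and coefficients, 2 ensures
    \<open>D n \<ge> 2\<close>, and \<open>2 * L\<close> ensures
    \<open>2 * L / D n \<le> 1\<close>.\<close>
  define A' where "A' = max A (max 2 (nat \<lceil>2 * L\<rceil>))"
  have A': "A \<le> A'" "2 \<le> A'" "2 * L \<le> real A'"
    by (auto simp: A'_def le_max_iff_disj) linarith
  \<comment> \<open>256 = 4 * 64, from the exponent \<open>4 * D\<close> and the target power 1/64;
    the factor \<open>A'\<close> passes from \<open>N\<close> to \<open>D\<close>.\<close>
  define B where "B = 256 * real A'"
  have B: "0 < B" using A' by (simp add: B_def)
  define N where "N = (\<lambda>n. nat \<lfloor>ln (real n) / (B * ln (ln (real n)))\<rfloor>)"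
  define D where "D = (\<lambda>n. A' * N n)"
  \<comment> \<open>Rounding down at most halves \<open>N\<close>, which makes 32 out of the 16 of
    \<open>wasserstein1_le_char\<close>. One unit of the summand 2 pays for the characteristic
    functions, the other makes the inequality strict.\<close>
  define M where "M = 32 * C * B + 2"
  have M: "0 < M" using C B by (simp add: M_def add_pos_pos)
  have "\<forall>\<^sub>F n in sequentially. ln (ln (real n)) \<ge> 1 \<and> ln (real n) / (B * ln (ln (real n))) \<ge> 2
      \<and> 2 * L * real n powr (-1/64) \<le> ln (ln (real n)) / ln (real n) \<and> real n > 1"
    using B L by (intro eventually_conj) real_asymp+
  then have "\<forall>\<^sub>F n in sequentially. 1 \<le> D n \<and> real (D n) \<le> ln (real n) \<and>
       (\<forall>\<mu> \<nu>. real_distribution \<mu> \<longrightarrow> real_distribution \<nu> \<longrightarrow>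
          emeasure \<mu> {-L..L} = 1 \<longrightarrow> emeasure \<nu> {-L..L} = 1 \<longrightarrow>
          (\<forall>j :: int. \<bar>j\<bar> \<le> int (D n) \<longrightarrow>
             cmod (char \<mu> (of_int j / real (D n)) - char \<nu> (of_int j / real (D n))) \<le> real n powr (-1/32)) \<longrightarrow>
          wasserstein1 \<mu> \<nu> < ennreal (M * (ln (ln (real n)) / ln (real n))))"
  proof eventually_elim
    fix n :: nat
    assume ev: "ln (ln (real n)) \<ge> 1 \<and> ln (real n) / (B * ln (ln (real n))) \<ge> 2
      \<and> 2 * L * real n powr (-1/64) \<le> ln (ln (real n)) / ln (real n) \<and> real n > 1"
    define l where "l = ln (real n)"
    define ll where "ll = ln l"
    define q where "q = l / (B * ll)"
    have e: "1 \<le> ll" "2 \<le> q" "2 * L * real n powr (-1/64) \<le> ll / l" "1 < real n"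
      using ev by (auto simp: l_def ll_def q_def)
    have l: "0 < l" using e(4) by (simp add: l_def)
    have Nq: "real (N n) \<le> q" "q / 2 \<le> real (N n)" "1 \<le> N n"
      using e(2) unfolding N_def q_def[unfolded ll_def l_def, symmetric] by linarith+
    have Dq: "real (D n) \<le> l / (256 * ll)"
    proof -
      have "real (D n) \<le> real A' * q" using Nq by (simp add: D_def mult_left_mono)
      also have "\<dots> = l / (256 * ll)" using A' by (simp add: q_def B_def)
      finally show ?thesis .
    qed
    also have "\<dots> \<le> l / 1" using e l by (intro divide_left_mono) auto
    finally have Dl: "real (D n) \<le> l" by simp
    have D2: "2 \<le> D n" using mult_le_mono[OF A'(2) Nq(3)] by (simp add: D_def)
    have pow: "real (D n) ^ (4 * D n) \<le> real n powr (1/64)"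
    proof -
      have "real (D n) ^ (4 * D n) = exp (4 * real (D n) * ln (real (D n)))"
        using D2 by (simp add: powr_realpow[symmetric] powr_def)
      also have "4 * real (D n) * ln (real (D n)) \<le> 4 * (l / (256 * ll)) * ll"
        using Dl Dq D2 l e(1) by (intro mult_mono) (auto simp: ll_def)
      also have "4 * (l / (256 * ll)) * ll = (1/64) * l" using e by simp
      also have "exp ((1/64) * l) = real n powr (1/64)" using e by (simp add: powr_def l_def)
      finally show ?thesis by simp
    qed
    show "1 \<le> D n \<and> real (D n) \<le> ln (real n) \<and>
       (\<forall>\<mu> \<nu>. real_distribution \<mu> \<longrightarrow> real_distribution \<nu> \<longrightarrow>
          emeasure \<mu> {-L..L} = 1 \<longrightarrow> emeasure \<nu> {-L..L} = 1 \<longrightarrow>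
          (\<forall>j :: int. \<bar>j\<bar> \<le> int (D n) \<longrightarrow>
             cmod (char \<mu> (of_int j / real (D n)) - char \<nu> (of_int j / real (D n))) \<le> real n powr (-1/32)) \<longrightarrow>
          wasserstein1 \<mu> \<nu> < ennreal (M * (ln (ln (real n)) / ln (real n))))"
    proof (intro conjI allI impI)
      show "1 \<le> D n" using D2 by simp
      show "real (D n) \<le> ln (real n)" using Dl by (simp only: l_def)
      fix \<mu> \<nu> :: "real measure"
      assume \<mu>: "real_distribution \<mu>" and \<nu>: "real_distribution \<nu>"
        and supp: "emeasure \<mu> {-L..L} = 1" "emeasure \<nu> {-L..L} = 1"
        and \<Delta>: "\<forall>j :: int. \<bar>j\<bar> \<le> int (D n) \<longrightarrow>
             cmod (char \<mu> (of_int j / real (D n)) - char \<nu> (of_int j / real (D n))) \<le> real n powr (-1/32)"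
      obtain p where p: "degree p \<le> A * N n" "\<And>k. \<bar>coeff p k\<bar> \<le> real (A * N n) ^ (A * N n)"
        "\<And>v. \<bar>v\<bar> \<le> 2 * L \<Longrightarrow> \<bar>poly p v - indicator {0<..} v\<bar> \<le> C / (1 + (real (N n) * v)\<^sup>2)"
        using kernel[OF Nq(3)] by blast
      have AD: "A * N n \<le> D n" using A' by (simp add: D_def)
      have deg: "degree p \<le> D n" using p(1) AD by linarith
      have cf: "\<bar>coeff p k\<bar> \<le> real (D n) ^ D n" for k
      proof -
        have "real (A * N n) ^ (A * N n) \<le> real (D n) ^ (A * N n)" using AD by (intro power_mono) (simp_all only: of_nat_le_iff of_nat_0_le_iff)
        also have "\<dots> \<le> real (D n) ^ D n" using AD D2 by (intro power_increasing) auto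
        finally show ?thesis using p(2)[of k] by linarith
      qed
      let ?s = "1 / real (D n)"
      have "(\<Sum>k\<le>degree p. \<bar>coeff p k\<bar> / ?s ^ k) \<le> (\<Sum>k\<le>degree p. real (D n) ^ D n * real (D n) ^ D n)"
      proof (rule sum_mono)
        fix k assume "k \<in> {..degree p}"
        then have "k \<le> D n" using deg by simp
        have "\<bar>coeff p k\<bar> / ?s ^ k = \<bar>coeff p k\<bar> * real (D n) ^ k" by (simp add: power_divide)
        also have "\<dots> \<le> real (D n) ^ D n * real (D n) ^ D n"
          using \<open>k \<le> D n\<close> D2 by (intro mult_mono cf power_increasing) auto
        finally show "\<bar>coeff p k\<bar> / ?s ^ k \<le> real (D n) ^ D n * real (D n) ^ D n" .
      qed
      also have "\<dots> = real (degree p + 1) * (real (D n) ^ (2 * D n))"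
        by (simp add: power_add[symmetric] mult_2)
      also have "\<dots> \<le> (real (D n))\<^sup>2 * (real (D n) ^ (2 * D n))"
      proof (rule mult_right_mono)
        \<comment> \<open>The number of coefficients costs two more powers of \<open>D\<close>, and
          \<open>2 + 2 * D \<le> 4 * D\<close> fits into the exponent.\<close>
        have "real (degree p + 1) \<le> real (D n) * 2" using deg D2 by simp
        also have "\<dots> \<le> real (D n) * real (D n)" using D2 by (intro mult_left_mono) auto
        finally show "real (degree p + 1) \<le> (real (D n))\<^sup>2" by (simp add: power2_eq_square)
      qed simp
      also have "\<dots> = real (D n) ^ (2 + 2 * D n)" by (simp only: power_add)
      also have "\<dots> \<le> real (D n) ^ (4 * D n)" using D2 by (intro power_increasing) auto
      also note pow
      finally have sum: "(\<Sum>k\<le>degree p. \<bar>coeff p k\<bar> / ?s ^ k) \<le> real n powr (1/64)" .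
      have "wasserstein1 \<mu> \<nu> \<le> ennreal (16 * C / real (N n) + 2 * L * (\<Sum>k\<le>degree p. \<bar>coeff p k\<bar> / ?s ^ k) * real n powr (-1/32))"
      proof (rule wasserstein1_le_char[OF \<mu> \<nu> L supp _ _ _ _ p(3)])
        show "2 * L * ?s \<le> 1"
        proof -
          have "real A' * 1 \<le> real A' * real (N n)" using Nq(3) by (intro mult_left_mono) auto
          then have "real A' \<le> real (D n)" by (simp add: D_def)
          then show ?thesis using A'(3) D2 by (simp add: divide_le_eq)
        qed
        show "cmod (char \<mu> (real_of_int j * ?s) - char \<nu> (real_of_int j * ?s)) \<le> real n powr (-1/32)"
          if "\<bar>j\<bar> \<le> int (degree p)" for j using \<Delta> that deg by simp
      qed (use D2 C Nq in auto)
      also have "\<dots> < ennreal (M * (ln (ln (real n)) / ln (real n)))"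
      proof (rule ennreal_lessI)
        have pos: "0 < ll / l" using e l by simp
        show "0 < M * (ln (ln (real n)) / ln (real n))"
          using mult_pos_pos[OF M pos] by (simp only: l_def ll_def)
        have "16 * C / real (N n) \<le> 16 * C / (q / 2)"
          using Nq C e(2) by (intro divide_left_mono) auto
        also have "\<dots> = 32 * C * B * (ll / l)" by (simp add: q_def)
        finally have one: "16 * C / real (N n) \<le> 32 * C * B * (ll / l)" .
        have "2 * L * (\<Sum>k\<le>degree p. \<bar>coeff p k\<bar> / ?s ^ k) * real n powr (-1/32)
          \<le> 2 * L * real n powr (1/64) * real n powr (-1/32)"
          using sum L by (intro mult_right_mono mult_left_mono) auto
        also have "\<dots> = 2 * L * real n powr (-1/64)" by (simp add: powr_add[symmetric])
        also have "\<dots> \<le> ll / l" by (rule e(3))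
        finally have two: "2 * L * (\<Sum>k\<le>degree p. \<bar>coeff p k\<bar> / ?s ^ k) * real n powr (-1/32) \<le> ll / l" .
        have "M * (ll / l) = 32 * C * B * (ll / l) + ll / l + ll / l" by (simp add: M_def algebra_simps)
        then show "16 * C / real (N n) + 2 * L * (\<Sum>k\<le>degree p. \<bar>coeff p k\<bar> / ?s ^ k) * real n powr (-1/32)
          < M * (ln (ln (real n)) / ln (real n))" using one two pos unfolding ll_def l_def by linarith
      qed
      finally show "wasserstein1 \<mu> \<nu> < ennreal (M * (ln (ln (real n)) / ln (real n)))" .
    qed
  qed
  with M show thesis by (rule that)
qed

section \<open>Gaussian mixtures and posterior mass\<close>

lemma prob_space_gauss_mixture:
  assumes "prob_space \<nu>" and "sets \<nu> = sets borel"
  shows "prob_space (gauss_mixture \<nu>)"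
proof -
  interpret \<nu>: prob_space \<nu> by fact
  interpret N: prob_space std_normal_distribution using real_dist_normal_dist by (simp add: real_distribution_def)
  interpret P: pair_prob_space \<nu> std_normal_distribution ..
  show ?thesis unfolding gauss_mixture_def convolution_def
    by (rule P.prob_space_distr) (use assms(2) in \<open>simp cong: measurable_cong_sets\<close>)
qed

lemma sets_gauss_mixture [simp, measurable_cong]: "sets (gauss_mixture \<nu>) = sets borel"
  by (simp add: gauss_mixture_def)

lemma space_gauss_mixture [simp]: "space (gauss_mixture \<nu>) = UNIV"
  by (simp add: gauss_mixture_def)

lemma char_gauss_mixture:
  assumes "prob_space \<nu>" and S [measurable_cong, simp]: "sets \<nu> = sets borel"
  shows "char (gauss_mixture \<nu>) t = char \<nu> t * complex_of_real (exp (- (t\<^sup>2) / 2))"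
proof -
  interpret \<nu>: prob_space \<nu> by fact
  interpret N: real_distribution std_normal_distribution by (rule real_dist_normal_dist)
  interpret P: pair_prob_space \<nu> std_normal_distribution ..
  have [measurable]: "iexp \<in> borel_measurable borel" by (simp add: borel_measurable_continuous_onI)
  have "char (gauss_mixture \<nu>) t = (\<integral>z. iexp (t * (fst z + snd z)) \<partial>(\<nu> \<Otimes>\<^sub>M std_normal_distribution))"
    unfolding char_def gauss_mixture_def convolution_def
    by (subst integral_distr) (auto simp: split_beta')
  also have "\<dots> = (\<integral>x. (\<integral>y. iexp (t * (x + y)) \<partial>std_normal_distribution) \<partial>\<nu>)"
    by (subst P.integral_fst'[symmetric]) (auto intro!: P.integrable_iexp)
  also have "\<dots> = (\<integral>x. iexp (t * x) * char std_normal_distribution t \<partial>\<nu>)"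
    unfolding char_def by (simp add: exp_add distrib_left)
  also have "\<dots> = char \<nu> t * char std_normal_distribution t" by (simp add: char_def)
  also have "\<dots> = char \<nu> t * complex_of_real (exp (- (t\<^sup>2) / 2))" by (simp only: char_std_normal_distribution)
  finally show ?thesis .
qed

text \<open>The coordinates of the product measure are independent with law \<open>\<mu>\<close>.
  The values of \<open>g\<close> lie in an interval of length 2, so the usual exponent
  \<open>2 * n * \<epsilon>^2 / 2^2\<close> becomes \<open>n * \<epsilon>^2 / 2\<close>.\<close>

lemma hoeffding_PiM:
  fixes \<mu> :: "real measure" and g :: "real \<Rightarrow> real"
  assumes "prob_space \<mu>" and S [measurable_cong, simp]: "sets \<mu> = sets borel"
    and g [measurable]: "g \<in> borel_measurable borel" and bd: "\<And>x. \<bar>g x\<bar> \<le> 1"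
    and n: "0 < n" and \<epsilon>: "0 \<le> \<epsilon>"
  shows "emeasure (\<Pi>\<^sub>M i\<in>{..<n}. \<mu>) {x \<in> space (\<Pi>\<^sub>M i\<in>{..<n}. \<mu>). \<epsilon> \<le> \<bar>(\<Sum>i<n. g (x i)) / real n - (\<integral>x. g x \<partial>\<mu>)\<bar>}
    \<le> ennreal (2 * exp (- (real n * \<epsilon>\<^sup>2 / 2)))"
proof -
  interpret \<mu>: prob_space \<mu> by fact
  let ?P = "\<Pi>\<^sub>M i\<in>{..<n}. \<mu>"
  interpret P: prob_space ?P by (intro prob_space_PiM assms)
  have comp: "distr ?P \<mu> (\<lambda>\<omega>. \<omega> i) = \<mu>" if "i < n" for i
    using distr_PiM_component[of "{..<n}" "\<lambda>_. \<mu>" i] that \<mu>.prob_space_axioms by simp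
  have dX: "distr ?P borel (\<lambda>\<omega>. g (\<omega> i)) = distr \<mu> borel g" if i: "i < n" for i
  proof -
    have "distr \<mu> borel g = distr (distr ?P \<mu> (\<lambda>\<omega>. \<omega> i)) borel g" by (simp add: comp[OF i])
    also have "\<dots> = distr ?P borel (\<lambda>\<omega>. g (\<omega> i))"
      using i by (subst distr_distr) (auto simp: comp_def)
    finally show ?thesis by simp
  qed
  \<comment> \<open>Independence is expressed through joint laws: the tuple of the coordinates is
    the identity map, whose law is the product of the marginals.\<close>
  have "P.indep_vars (\<lambda>_. \<mu>) (\<lambda>i \<omega>. \<omega> i) {..<n}"
  proof (subst P.indep_vars_iff_distr_eq_PiM')
    have r: "distr ?P ?P (\<lambda>x. \<lambda>i\<in>{..<n}. x i) = distr ?P ?P (\<lambda>x. x)"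
      by (rule distr_cong) (auto simp: space_PiM PiE_def extensional_def restrict_def fun_eq_iff)
    show "distr ?P ?P (\<lambda>x. \<lambda>i\<in>{..<n}. x i) = (\<Pi>\<^sub>M i\<in>{..<n}. distr ?P \<mu> (\<lambda>\<omega>. \<omega> i))"
    proof -
      have "(\<Pi>\<^sub>M i\<in>{..<n}. distr ?P \<mu> (\<lambda>\<omega>. \<omega> i)) = ?P" by (intro PiM_cong) (simp_all add: comp)
      then show ?thesis by (simp only: r distr_id2)
    qed
  qed (use n in auto)
  then have ind: "P.indep_vars (\<lambda>_. borel) (\<lambda>i \<omega>. g (\<omega> i)) {..<n}"
    by (rule P.indep_vars_compose2) simp
  have bd': "-1 \<le> g x" "g x \<le> 1" for x using bd[of x] by linarith+
  have rv: "(\<lambda>\<omega>. g (\<omega> 0)) \<in> borel_measurable ?P"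
    by (rule measurable_compose[OF measurable_component_singleton[of 0]]) (use n in simp_all)
  interpret H: Hoeffding_ineq_iid ?P "{..<n}" "\<lambda>i \<omega>. g (\<omega> i)" "\<lambda>\<omega>. g (\<omega> 0)" "-1" 1 "P.expectation (\<lambda>\<omega>. g (\<omega> 0))"
  proof unfold_locales
    show "distr ?P borel (\<lambda>\<omega>. g (\<omega> i)) = distr ?P borel (\<lambda>\<omega>. g (\<omega> 0))" if "i \<in> {..<n}" for i
      using that n by (simp add: dX)
    show "(\<lambda>\<omega>. g (\<omega> 0)) \<in> borel_measurable ?P"  by (rule rv)
    show "AE x in ?P. g (x 0) \<in> {- 1..1}" by (intro AE_I2) (simp add: bd')
  qed (use ind in auto)
  have "P.expectation (\<lambda>\<omega>. g (\<omega> 0)) = (\<integral>x. x \<partial>distr ?P borel (\<lambda>\<omega>. g (\<omega> 0)))"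
    by (subst integral_distr) (auto simp: rv)
  also have "\<dots> = (\<integral>x. g x \<partial>\<mu>)" using n by (simp add: dX integral_distr)
  finally have E: "P.expectation (\<lambda>\<omega>. g (\<omega> 0)) = (\<integral>x. g x \<partial>\<mu>)" .
  have "P.prob {x \<in> space ?P. \<epsilon> \<le> \<bar>(\<Sum>i<n. g (x i)) / real n - (\<integral>x. g x \<partial>\<mu>)\<bar>}
      \<le> 2 * exp (- (real n * \<epsilon>\<^sup>2 / 2))"
    using H.Hoeffding_ineq_abs_ge'[OF \<epsilon>] n unfolding E by (auto simp: lessThan_empty_iff)
  then show ?thesis by (simp add: P.emeasure_eq_measure)
qed

section \<open>Joint measurability and product densities\<close>

lemma measurable_mixture_density [measurable]:
  "(\<lambda>(\<nu>, x). mixture_density \<nu> x) \<in> borel_measurable (prob_algebra borel \<Otimes>\<^sub>M borel)"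
proof -
  have "(\<lambda>z. \<integral>\<^sup>+\<theta>. ennreal (normal_density \<theta> 1 (snd z)) \<partial>fst z) \<in> borel_measurable (prob_algebra borel \<Otimes>\<^sub>M (borel :: real measure))"
  proof (rule nn_integral_measurable_subprob_algebra2)
    show "(\<lambda>(z, \<theta>). ennreal (normal_density \<theta> 1 (snd z))) \<in> borel_measurable ((prob_algebra borel \<Otimes>\<^sub>M borel) \<Otimes>\<^sub>M borel)"
      unfolding normal_density_def by measurable
    show "fst \<in> prob_algebra borel \<Otimes>\<^sub>M (borel :: real measure) \<rightarrow>\<^sub>M subprob_algebra borel"
      by (rule measurable_prob_algebraD) measurable
  qed
  then show ?thesis by (simp add: mixture_density_def split_beta')
qed

lemma measurable_joint_density [measurable]:
  "(\<lambda>(\<nu>, x). joint_density n \<nu> x) \<in> borel_measurable (prob_algebra borel \<Otimes>\<^sub>M (\<Pi>\<^sub>M i\<in>{..<n}. lborel))"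
proof -
  have "(\<lambda>z. \<Prod>i<n. mixture_density (fst z) (snd z i)) \<in> borel_measurable (prob_algebra borel \<Otimes>\<^sub>M (\<Pi>\<^sub>M i\<in>{..<n}. lborel))"
  proof (rule borel_measurable_prod_ennreal)
    fix i assume "i \<in> {..<n}"
    then have "(\<lambda>z. (fst z, snd z i)) \<in> prob_algebra borel \<Otimes>\<^sub>M (\<Pi>\<^sub>M i\<in>{..<n}. lborel) \<rightarrow>\<^sub>M prob_algebra borel \<Otimes>\<^sub>M (borel :: real measure)"
      by measurable
    from measurable_compose[OF this measurable_mixture_density]
    show "(\<lambda>z. mixture_density (fst z) (snd z i)) \<in> borel_measurable (prob_algebra borel \<Otimes>\<^sub>M (\<Pi>\<^sub>M i\<in>{..<n}. lborel))"
      by simp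
  qed
  then show ?thesis by (simp add: joint_density_def split_beta')
qed

lemma measurable_mixture_density_snd [measurable]:
  assumes "\<nu> \<in> space (prob_algebra borel)"
  shows "mixture_density \<nu> \<in> borel_measurable borel"
  using measurable_Pair2[OF measurable_mixture_density assms] by simp

text \<open>Writing every sampling law as a density with respect to one product Lebesgue measure
  makes the integrals over data and prior exchangeable.\<close>

lemma PiM_gauss_mixture_eq_density:
  assumes \<nu>: "\<nu> \<in> space (prob_algebra borel)"
  shows "(\<Pi>\<^sub>M i\<in>{..<n}. gauss_mixture \<nu>) = density (\<Pi>\<^sub>M i\<in>{..<n}. lborel) (joint_density n \<nu>)"
proof -
  have p: "prob_space \<nu>" and s: "sets \<nu> = sets borel" using \<nu> by (auto simp: space_prob_algebra)
  interpret G: prob_space "gauss_mixture \<nu>" by (rule prob_space_gauss_mixture[OF p s])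
  interpret PG: product_sigma_finite "\<lambda>_. gauss_mixture \<nu>" ..
  interpret PL: product_sigma_finite "\<lambda>_ :: nat. lborel :: real measure" ..
  have d: "gauss_mixture \<nu> = density lborel (mixture_density \<nu>)"
    using p s by (intro gauss_mixture_density prob_space.finite_measure)
  have jm [measurable]: "joint_density n \<nu> \<in> borel_measurable (\<Pi>\<^sub>M i\<in>{..<n}. lborel)"
    using measurable_Pair2[OF measurable_joint_density \<nu>] by simp
  have mm [measurable]: "mixture_density \<nu> \<in> borel_measurable borel" using \<nu> by (rule measurable_mixture_density_snd)
  show ?thesis
  proof (rule PG.PiM_eqI[symmetric])
    show "sets (density (\<Pi>\<^sub>M i\<in>{..<n}. lborel) (joint_density n \<nu>)) = sets (\<Pi>\<^sub>M i\<in>{..<n}. gauss_mixture \<nu>)"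
      by (auto intro!: sets_PiM_cong)
    fix A :: "nat \<Rightarrow> real set" assume "\<And>i. i \<in> {..<n} \<Longrightarrow> A i \<in> sets (gauss_mixture \<nu>)"
    then have A [measurable]: "\<And>i. i \<in> {..<n} \<Longrightarrow> A i \<in> sets borel" by simp
    have "emeasure (density (\<Pi>\<^sub>M i\<in>{..<n}. lborel) (joint_density n \<nu>)) (Pi\<^sub>E {..<n} A)
       = (\<integral>\<^sup>+x. joint_density n \<nu> x * indicator (Pi\<^sub>E {..<n} A) x \<partial>(\<Pi>\<^sub>M i\<in>{..<n}. lborel))"
      using A by (intro emeasure_density jm sets_PiM_I_finite) auto
    also have "\<dots> = (\<integral>\<^sup>+x. (\<Prod>i<n. mixture_density \<nu> (x i) * indicator (A i) (x i)) \<partial>(\<Pi>\<^sub>M i\<in>{..<n}. lborel))"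
    proof (rule nn_integral_cong)
      fix x assume "x \<in> space (\<Pi>\<^sub>M i\<in>{..<n}. lborel :: real measure)"
      then have "indicator (Pi\<^sub>E {..<n} A) x = (\<Prod>i<n. indicator (A i) (x i) :: ennreal)"
        by (auto simp: indicator_def space_PiM PiE_iff prod_zero_iff)
      then show "joint_density n \<nu> x * indicator (Pi\<^sub>E {..<n} A) x = (\<Prod>i<n. mixture_density \<nu> (x i) * indicator (A i) (x i))"
        by (simp add: joint_density_def prod.distrib)
    qed
    also have "\<dots> = (\<Prod>i<n. \<integral>\<^sup>+x. mixture_density \<nu> x * indicator (A i) x \<partial>lborel)"
      using A by (intro PL.product_nn_integral_prod) auto
    also have "\<dots> = (\<Prod>i<n. emeasure (gauss_mixture \<nu>) (A i))"
      using A by (intro prod.cong refl) (simp add: d emeasure_density)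
    finally show "emeasure (density (\<Pi>\<^sub>M i\<in>{..<n}. lborel) (joint_density n \<nu>)) (Pi\<^sub>E {..<n} A)
       = (\<Prod>i<n. emeasure (gauss_mixture \<nu>) (A i))" .
  qed simp
qed

text \<open>In the application \<open>a\<close> is the true density, \<open>b\<close> a competing
  one and \<open>D\<close> the evidence. Since \<open>D\<close> may be 0 or infinite,
  \<open>D * inverse D\<close> is only bounded by 1 rather than cancelled.\<close>

lemma ennreal_mult_divide_le:
  fixes a b d D :: ennreal
  assumes "d * a \<le> D" "d \<noteq> 0" "d \<noteq> top"
  shows "a * (b / D) \<le> b / d"
proof -
  have "a = inverse d * (d * a)"
    using assms(2,3) ennreal_divide_self[of d]
    by (simp add: mult.assoc[symmetric] divide_ennreal_def mult.commute[of "inverse d"] less_top)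
  also have "\<dots> \<le> inverse d * D" by (intro mult_left_mono assms) simp
  finally have "a * (b / D) \<le> (inverse d * D) * (b * inverse D)"
    by (simp add: divide_ennreal_def mult_right_mono)
  also have "\<dots> = (b * inverse d) * (D * inverse D)" by (simp add: mult_ac)
  also have "\<dots> \<le> (b * inverse d) * 1"
  proof (rule mult_left_mono)
    show "D * inverse D \<le> 1"
      using ennreal_divide_self[of D]
      by (cases "D = 0 \<or> D = top") (auto simp: divide_ennreal_def less_top)
  qed simp
  finally show ?thesis by (simp add: divide_ennreal_def)
qed

section \<open>Posterior mass and tests\<close>

lemma joint_density_measurable_snd:
  "\<nu> \<in> space (prob_algebra borel) \<Longrightarrow> joint_density n \<nu> \<in> borel_measurable (\<Pi>\<^sub>M i\<in>{..<n}. lborel)"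
  using measurable_Pair2[OF measurable_joint_density] by simp

lemma joint_density_measurable_fst:
  "x \<in> space (\<Pi>\<^sub>M i\<in>{..<n}. lborel :: real measure) \<Longrightarrow> (\<lambda>\<nu>. joint_density n \<nu> x) \<in> borel_measurable (prob_algebra borel)"
  using measurable_Pair1[OF measurable_joint_density] by simp

lemma emeasure_posterior:
  assumes sP: "sets P = sets (prob_algebra borel)" and B: "B \<in> sets P"
    and x: "x \<in> space (\<Pi>\<^sub>M i\<in>{..<n}. lborel :: real measure)"
  shows "emeasure (posterior P n x) B = (\<integral>\<^sup>+\<nu>. joint_density n \<nu> x / (\<integral>\<^sup>+\<mu>. joint_density n \<mu> x \<partial>P) * indicator B \<nu> \<partial>P)"
proof -
  have "(\<lambda>\<nu>. joint_density n \<nu> x) \<in> borel_measurable P"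
    using joint_density_measurable_fst[OF x] by (simp cong: measurable_cong_sets add: sP)
  then show ?thesis using B unfolding posterior_def by (intro emeasure_density) auto
qed

text \<open>The posterior has a density with respect to the prior. This disposes of mixing measures
  that charge the complement of \<open>[-L, L]\<close>.\<close>

lemma emeasure_posterior_null_set:
  assumes "sets P = sets (prob_algebra borel)" and B: "B \<in> null_sets P"
    and "x \<in> space (\<Pi>\<^sub>M i\<in>{..<n}. lborel :: real measure)"
  shows "emeasure (posterior P n x) B = 0"
  using emeasure_posterior[OF assms(1) null_setsD2[OF B] assms(3)] nn_integral_null_set[OF B] by simp

lemma measurable_joint_density_prior:
  assumes sP: "sets P = sets (prob_algebra borel)"
  shows "(\<lambda>(\<nu>, x). joint_density n \<nu> x) \<in> borel_measurable (P \<Otimes>\<^sub>M (\<Pi>\<^sub>M i\<in>{..<n}. lborel))"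
  using measurable_joint_density by (simp cong: measurable_cong_sets sets_pair_measure_cong add: sP)

lemma measurable_emeasure_posterior:
  assumes P: "prob_space P" and sP: "sets P = sets (prob_algebra borel)" and B [measurable]: "B \<in> sets P"
  shows "(\<lambda>x. emeasure (posterior P n x) B) \<in> borel_measurable (\<Pi>\<^sub>M i\<in>{..<n}. lborel)"
proof -
  interpret P: prob_space P by fact
  note measurable_joint_density_prior[OF sP, measurable]
  have "(\<lambda>x. \<integral>\<^sup>+\<nu>. joint_density n \<nu> x / (\<integral>\<^sup>+\<mu>. joint_density n \<mu> x \<partial>P) * indicator B \<nu> \<partial>P)
      \<in> borel_measurable (\<Pi>\<^sub>M i\<in>{..<n}. lborel)" by measurable
  then show ?thesis
    by (subst measurable_cong[OF emeasure_posterior[OF sP B]])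
qed

text \<open>\<open>S\<close> is the event on which the evidence is large, \<open>T\<close> the
  acceptance region of a test of \<open>\<nu>'\<close> against \<open>B\<close>. Outside
  \<open>S\<close> or \<open>T\<close> the posterior mass is bounded by 1. On both, the evidence
  bound cancels the true density, so the posterior numerator is integrated under its own law, and
  exchanging prior and data leaves the probability of \<open>T\<close> under each
  \<open>\<nu>\<close> in \<open>B\<close>.\<close>

lemma posterior_mass_le:
  fixes P :: "real measure measure" and \<nu>' :: "real measure" and d :: real and e :: ennreal
  assumes P: "prob_space P" and sP: "sets P = sets (prob_algebra borel)"
    and \<nu>': "\<nu>' \<in> space (prob_algebra borel)"
    and B: "B \<in> sets P"
    and S: "S \<in> sets (\<Pi>\<^sub>M i\<in>{..<n}. lborel)" and T: "T \<in> sets (\<Pi>\<^sub>M i\<in>{..<n}. lborel)"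
    and d: "0 < d"
    and evidence: "\<And>x. x \<in> S \<Longrightarrow> ennreal d * joint_density n \<nu>' x \<le> (\<integral>\<^sup>+\<mu>. joint_density n \<mu> x \<partial>P)"
    and err: "\<And>\<nu>. \<nu> \<in> B \<Longrightarrow> emeasure (\<Pi>\<^sub>M i\<in>{..<n}. gauss_mixture \<nu>) T \<le> e"
  shows "(\<integral>\<^sup>+x. emeasure (posterior P n x) B \<partial>(\<Pi>\<^sub>M i\<in>{..<n}. gauss_mixture \<nu>'))
     \<le> emeasure (\<Pi>\<^sub>M i\<in>{..<n}. gauss_mixture \<nu>') (space (\<Pi>\<^sub>M i\<in>{..<n}. lborel) - S)
      + emeasure (\<Pi>\<^sub>M i\<in>{..<n}. gauss_mixture \<nu>') (space (\<Pi>\<^sub>M i\<in>{..<n}. lborel) - T) + e / ennreal d"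
proof -
  interpret P: prob_space P by fact
  let ?R = "\<Pi>\<^sub>M i\<in>{..<n}. lborel :: real measure"
  let ?J = "joint_density n"
  interpret PL: finite_product_sigma_finite "\<lambda>_ :: nat. lborel :: real measure" "{..<n}"
    by unfold_locales auto
  interpret PR: pair_sigma_finite P ?R ..
  note sP [measurable_cong] and B [measurable] and S [measurable] and T [measurable]
  have spP: "space P = space (prob_algebra borel)" by (rule sets_eq_imp_space_eq[OF sP])
  have J [measurable]: "(\<lambda>(\<nu>, x). ?J \<nu> x) \<in> borel_measurable (P \<Otimes>\<^sub>M ?R)"
    by (rule measurable_joint_density_prior[OF sP])
  have J' [measurable]: "?J \<nu>' \<in> borel_measurable ?R" by (rule joint_density_measurable_snd[OF \<nu>'])
  have Jx: "(\<lambda>\<nu>. ?J \<nu> x) \<in> borel_measurable P" if "x \<in> space ?R" for x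
    using joint_density_measurable_fst[OF that] by (simp cong: measurable_cong_sets add: sP)
  define E where "E = (\<lambda>x. \<integral>\<^sup>+\<mu>. ?J \<mu> x \<partial>P)"
  have [measurable]: "E \<in> borel_measurable ?R" unfolding E_def by measurable
  define h where "h = (\<lambda>x. \<integral>\<^sup>+\<nu>. ?J \<nu> x / E x * indicator B \<nu> \<partial>P)"
  have [measurable]: "h \<in> borel_measurable ?R" unfolding h_def by measurable
  have post: "emeasure (posterior P n x) B = h x" if x: "x \<in> space ?R" for x
    unfolding h_def E_def by (rule emeasure_posterior[OF sP B x])
  have h1: "h x \<le> 1" if x: "x \<in> space ?R" for x
  proof -
    note Jx[OF x, measurable]
    have "h x \<le> (\<integral>\<^sup>+\<nu>. ?J \<nu> x / E x \<partial>P)"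
      unfolding h_def by (intro nn_integral_mono) (auto simp: indicator_def)
    also have "\<dots> = E x / E x" unfolding E_def by (rule nn_integral_divide) measurable
    also have "\<dots> \<le> 1" by (cases "E x = 0 \<or> E x = top") (auto simp: ennreal_divide_self less_top)
    finally show ?thesis .
  qed
  have hd: "?J \<nu>' x * h x \<le> (\<integral>\<^sup>+\<nu>. ?J \<nu> x * indicator B \<nu> \<partial>P) / ennreal d" if x: "x \<in> space ?R" "x \<in> S" for x
  proof -
    note Jx[OF x(1), measurable]
    have "?J \<nu>' x * h x = (\<integral>\<^sup>+\<nu>. ?J \<nu>' x * (?J \<nu> x / E x * indicator B \<nu>) \<partial>P)"
      unfolding h_def by (rule nn_integral_cmult[symmetric]) measurable
    also have "\<dots> \<le> (\<integral>\<^sup>+\<nu>. ?J \<nu> x * indicator B \<nu> / ennreal d \<partial>P)"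
    proof (rule nn_integral_mono)
      fix \<nu>
      have "?J \<nu>' x * (?J \<nu> x / E x) \<le> ?J \<nu> x / ennreal d"
        using evidence[OF x(2)] d unfolding E_def by (intro ennreal_mult_divide_le) auto
      then show "?J \<nu>' x * (?J \<nu> x / E x * indicator B \<nu>) \<le> ?J \<nu> x * indicator B \<nu> / ennreal d"
        by (auto simp: indicator_def)
    qed
    also have "\<dots> = (\<integral>\<^sup>+\<nu>. ?J \<nu> x * indicator B \<nu> \<partial>P) / ennreal d"
      by (rule nn_integral_divide) measurable
    finally show ?thesis .
  qed
  let ?D = "density ?R (?J \<nu>')"
  have PD: "(\<Pi>\<^sub>M i\<in>{..<n}. gauss_mixture \<nu>) = density ?R (?J \<nu>)" if "\<nu> \<in> space (prob_algebra borel)" for \<nu>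
    by (rule PiM_gauss_mixture_eq_density[OF that])
  have "(\<integral>\<^sup>+x. emeasure (posterior P n x) B \<partial>?D) = (\<integral>\<^sup>+x. h x \<partial>?D)"
    by (intro nn_integral_cong) (simp add: post)
  also have "\<dots> = (\<integral>\<^sup>+x. ?J \<nu>' x * h x \<partial>?R)" by (rule nn_integral_density) measurable
  also have "\<dots> \<le> (\<integral>\<^sup>+x. (?J \<nu>' x * indicator (space ?R - S) x + ?J \<nu>' x * indicator (space ?R - T) x)
       + (\<integral>\<^sup>+\<nu>. ?J \<nu> x * indicator B \<nu> \<partial>P) / ennreal d * indicator T x \<partial>?R)"
  proof (rule nn_integral_mono)
    fix x assume x: "x \<in> space ?R"
    have le: "?J \<nu>' x * h x \<le> ?J \<nu>' x" using mult_left_mono[OF h1[OF x], of "?J \<nu>' x"] by simp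
    show "?J \<nu>' x * h x \<le> (?J \<nu>' x * indicator (space ?R - S) x + ?J \<nu>' x * indicator (space ?R - T) x)
       + (\<integral>\<^sup>+\<nu>. ?J \<nu> x * indicator B \<nu> \<partial>P) / ennreal d * indicator T x"
    proof (cases "x \<in> S \<and> x \<in> T")
      case True then show ?thesis using hd[OF x] by (simp add: indicator_def)
    next
      case False
      then consider "x \<notin> S" | "x \<notin> T" by blast
      then show ?thesis
      proof cases
        case 1
        then have ind: "indicator (space ?R - S) x = (1 :: ennreal)" using x by simp
        show ?thesis unfolding ind mult_1_right
          by (rule order_trans[OF le]) (intro add_increasing2 zero_le order_refl)
      next
        case 2
        then have ind: "indicator (space ?R - T) x = (1 :: ennreal)" using x by simp
        show ?thesis unfolding ind mult_1_right
          by (rule order_trans[OF le], rule add_increasing2[OF zero_le], rule add_increasing[OF zero_le order_refl])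
      qed
    qed
  qed
  also have "\<dots> = (\<integral>\<^sup>+x. ?J \<nu>' x * indicator (space ?R - S) x \<partial>?R) + (\<integral>\<^sup>+x. ?J \<nu>' x * indicator (space ?R - T) x \<partial>?R)
       + (\<integral>\<^sup>+x. (\<integral>\<^sup>+\<nu>. ?J \<nu> x * indicator B \<nu> \<partial>P) / ennreal d * indicator T x \<partial>?R)"
    by (simp add: nn_integral_add)
  also have "(\<integral>\<^sup>+x. ?J \<nu>' x * indicator (space ?R - S) x \<partial>?R) = emeasure ?D (space ?R - S)"
    by (rule emeasure_density[symmetric]) measurable
  also have "(\<integral>\<^sup>+x. ?J \<nu>' x * indicator (space ?R - T) x \<partial>?R) = emeasure ?D (space ?R - T)"
    by (rule emeasure_density[symmetric]) measurable
  also have "(\<integral>\<^sup>+x. (\<integral>\<^sup>+\<nu>. ?J \<nu> x * indicator B \<nu> \<partial>P) / ennreal d * indicator T x \<partial>?R)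
     = (\<integral>\<^sup>+x. (\<integral>\<^sup>+\<nu>. ?J \<nu> x * indicator B \<nu> * indicator T x / ennreal d \<partial>P) \<partial>?R)"
  proof (rule nn_integral_cong)
    fix x assume x: "x \<in> space ?R"
    note Jx[OF x, measurable]
    show "(\<integral>\<^sup>+\<nu>. ?J \<nu> x * indicator B \<nu> \<partial>P) / ennreal d * indicator T x
      = (\<integral>\<^sup>+\<nu>. ?J \<nu> x * indicator B \<nu> * indicator T x / ennreal d \<partial>P)"
      by (cases "x \<in> T") (simp_all add: nn_integral_divide)
  qed
  \<comment> \<open>After the exchange the inner integral is the probability of \<open>T\<close>
    under the law with mixing measure \<open>\<nu>\<close>, which \<open>err\<close> bounds.\<close>
  also have "\<dots> = (\<integral>\<^sup>+\<nu>. (\<integral>\<^sup>+x. ?J \<nu> x * indicator B \<nu> * indicator T x / ennreal d \<partial>?R) \<partial>P)"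
    by (rule PR.Fubini') measurable
  also have "\<dots> \<le> (\<integral>\<^sup>+\<nu>. e / ennreal d \<partial>P)"
  proof (rule nn_integral_mono)
    fix \<nu> assume "\<nu> \<in> space P"
    then have \<nu>: "\<nu> \<in> space (prob_algebra borel)" by (simp add: spP)
    note joint_density_measurable_snd[OF \<nu>, of n, measurable]
    have "(\<integral>\<^sup>+x. ?J \<nu> x * indicator B \<nu> * indicator T x / ennreal d \<partial>?R)
        = indicator B \<nu> * (\<integral>\<^sup>+x. ?J \<nu> x * indicator T x \<partial>?R) / ennreal d"
      by (simp add: nn_integral_divide nn_integral_cmult[symmetric] mult_ac)
    also have "(\<integral>\<^sup>+x. ?J \<nu> x * indicator T x \<partial>?R) = emeasure (\<Pi>\<^sub>M i\<in>{..<n}. gauss_mixture \<nu>) T"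
      unfolding PD[OF \<nu>] by (rule emeasure_density[symmetric]) measurable
    also have "indicator B \<nu> * \<dots> / ennreal d \<le> e / ennreal d"
      using err[of \<nu>] by (intro divide_right_mono_ennreal) (auto simp: indicator_def)
    finally show "(\<integral>\<^sup>+x. ?J \<nu> x * indicator B \<nu> * indicator T x / ennreal d \<partial>?R) \<le> e / ennreal d" .
  qed
  also have "\<dots> = e / ennreal d" by (simp add: P.emeasure_space_1)
  finally show ?thesis unfolding PD[OF \<nu>'] by (simp add: add_mono)
qed

section \<open>Likelihood ratios from masses of cells\<close>

lemma normal_density_ratio_le:
  fixes \<theta> \<theta>' x :: real
  assumes "\<theta> \<in> {-L..L}" "\<theta>' \<in> {-L..L}" "\<bar>\<theta> - \<theta>'\<bar> \<le> \<epsilon>"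
  shows "exp (- (\<epsilon> * (\<bar>x\<bar> + L))) * normal_density \<theta>' 1 x \<le> normal_density \<theta> 1 x"
proof -
  have "\<bar>(\<theta> + \<theta>') / 2\<bar> \<le> L" using assms by (simp add: abs_le_iff)
  then have "\<bar>x - (\<theta> + \<theta>') / 2\<bar> \<le> \<bar>x\<bar> + L" by linarith
  then have "\<bar>(\<theta> - \<theta>') * (x - (\<theta> + \<theta>') / 2)\<bar> \<le> \<epsilon> * (\<bar>x\<bar> + L)"
    unfolding abs_mult using assms by (intro mult_mono) auto
  \<comment> \<open>The difference of the two exponents factors through the midpoint of
    \<open>\<theta>\<close> and \<open>\<theta>'\<close>, hence is linear in \<open>x\<close>; this
    is why the first moment of the data suffices later.\<close>
  moreover have "(x - \<theta>)\<^sup>2 / 2 = (x - \<theta>')\<^sup>2 / 2 - (\<theta> - \<theta>') * (x - (\<theta> + \<theta>') / 2)"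
    by (simp add: power2_eq_square field_simps)
  ultimately have "- (\<epsilon> * (\<bar>x\<bar> + L)) + - (x - \<theta>')\<^sup>2 / 2 \<le> - (x - \<theta>)\<^sup>2 / 2"
    by linarith
  then have "exp (- (\<epsilon> * (\<bar>x\<bar> + L))) * exp (- (x - \<theta>')\<^sup>2 / 2) \<le> exp (- (x - \<theta>)\<^sup>2 / 2)"
    by (simp only: exp_add[symmetric] exp_le_cancel_iff)
  then have "1 / sqrt (2 * pi) * (exp (- (\<epsilon> * (\<bar>x\<bar> + L))) * exp (- (x - \<theta>')\<^sup>2 / 2))
     \<le> 1 / sqrt (2 * pi) * exp (- (x - \<theta>)\<^sup>2 / 2)"
    by (intro mult_left_mono) auto
  then show ?thesis by (simp add: normal_density_def mult_ac)
qed

text \<open>Within a cell the normal density varies by at most the exponential factor. Each cell is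
  thus represented by the supremum \<open>s i\<close>, which bounds the density from above for
  \<open>\<nu>'\<close> and, after that factor, from below for \<open>\<nu>\<close>. Only cell
  masses remain to be compared, and mass of \<open>\<nu>\<close> outside the cells can only
  help.\<close>

lemma mixture_density_ratio_le:
  fixes \<nu> \<nu>' :: "real measure" and I :: "nat \<Rightarrow> real set"
  assumes sets [measurable_cong]: "sets \<nu> = sets borel" "sets \<nu>' = sets borel"
    and supp: "AE \<theta> in \<nu>'. \<theta> \<in> (\<Union>i<m. I i)"
    and I [measurable]: "\<And>i. I i \<in> sets borel" and disj: "disjoint_family_on I {..<m}"
    and sub: "\<And>i. i < m \<Longrightarrow> I i \<subseteq> {-L..L}"
    and diam: "\<And>i \<theta> \<theta>'. i < m \<Longrightarrow> \<theta> \<in> I i \<Longrightarrow> \<theta>' \<in> I i \<Longrightarrow> \<bar>\<theta> - \<theta>'\<bar> \<le> \<epsilon>"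
    and mass: "\<And>i. i < m \<Longrightarrow> c * emeasure \<nu>' (I i) \<le> emeasure \<nu> (I i)"
  shows "c * ennreal (exp (- (\<epsilon> * (\<bar>x\<bar> + L)))) * mixture_density \<nu>' x \<le> mixture_density \<nu> x"
proof -
  let ?\<phi> = "\<lambda>\<theta>. ennreal (normal_density \<theta> 1 x)" and ?a = "ennreal (exp (- (\<epsilon> * (\<bar>x\<bar> + L))))"
  define s where "s = (\<lambda>i. SUP \<theta>\<in>I i. ?\<phi> \<theta>)"
  have [measurable]: "?\<phi> \<in> borel_measurable borel" unfolding normal_density_def by measurable
  have upper: "?\<phi> \<theta> \<le> s i" if "\<theta> \<in> I i" for i \<theta> unfolding s_def by (rule SUP_upper[OF that])
  have lower: "?a * s i \<le> ?\<phi> \<theta>" if "i < m" "\<theta> \<in> I i" for i \<theta>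
    unfolding s_def SUP_mult_left_ennreal
  proof (rule SUP_least)
    fix \<theta>' assume "\<theta>' \<in> I i"
    then have "exp (- (\<epsilon> * (\<bar>x\<bar> + L))) * normal_density \<theta>' 1 x \<le> normal_density \<theta> 1 x"
      using that sub diam by (intro normal_density_ratio_le) blast+
    then show "?a * ?\<phi> \<theta>' \<le> ?\<phi> \<theta>" by (simp add: ennreal_mult'[symmetric] ennreal_leI)
  qed
  have single: "(\<Sum>i<m. f i * indicator (I i) \<theta>) = f j" if "j < m" "\<theta> \<in> I j" for f :: "nat \<Rightarrow> ennreal" and j \<theta>
  proof -
    have "(\<Sum>i<m. f i * indicator (I i) \<theta>) = (\<Sum>i\<in>{j}. f i * indicator (I i) \<theta>)"
      using that disj by (intro sum.mono_neutral_right) (auto simp: disjoint_family_on_def indicator_def)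
    then show ?thesis using that by simp
  qed
  have "mixture_density \<nu>' x \<le> (\<integral>\<^sup>+\<theta>. (\<Sum>i<m. s i * indicator (I i) \<theta>) \<partial>\<nu>')"
    unfolding mixture_density_def
  proof (rule nn_integral_mono_AE, use supp in eventually_elim)
    fix \<theta> assume "\<theta> \<in> (\<Union>i<m. I i)"
    then obtain j where "j < m" "\<theta> \<in> I j" by blast
    then show "?\<phi> \<theta> \<le> (\<Sum>i<m. s i * indicator (I i) \<theta>)" using upper single by simp
  qed
  also have "\<dots> = (\<Sum>i<m. s i * emeasure \<nu>' (I i))"
    by (subst nn_integral_sum) (simp_all add: nn_integral_cmult_indicator sets)
  finally have "c * ?a * mixture_density \<nu>' x \<le> c * ?a * (\<Sum>i<m. s i * emeasure \<nu>' (I i))"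
    by (rule mult_left_mono) simp
  also have "\<dots> = (\<Sum>i<m. ?a * s i * (c * emeasure \<nu>' (I i)))"
    by (simp add: sum_distrib_left mult_ac)
  also have "\<dots> \<le> (\<Sum>i<m. ?a * s i * emeasure \<nu> (I i))"
    using mass by (intro sum_mono mult_left_mono) auto
  also have "\<dots> = (\<integral>\<^sup>+\<theta>. (\<Sum>i<m. ?a * s i * indicator (I i) \<theta>) \<partial>\<nu>)"
    by (subst nn_integral_sum) (simp_all add: nn_integral_cmult_indicator sets)
  also have "\<dots> \<le> mixture_density \<nu> x"
    unfolding mixture_density_def
  proof (rule nn_integral_mono)
    fix \<theta>
    show "(\<Sum>i<m. ?a * s i * indicator (I i) \<theta>) \<le> ?\<phi> \<theta>"
    proof (cases "\<exists>j<m. \<theta> \<in> I j")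
      case True then show ?thesis using lower single by auto
    next
      case False
      then have "(\<Sum>i<m. ?a * s i * indicator (I i) \<theta>) = 0" by (intro sum.neutral) (auto simp: indicator_def)
      then show ?thesis by simp
    qed
  qed
  finally show ?thesis .
qed

lemma joint_density_ratio_le:
  fixes \<nu> \<nu>' :: "real measure" and I :: "nat \<Rightarrow> real set" and c :: real
  assumes "sets \<nu> = sets borel" "sets \<nu>' = sets borel"
    and "AE \<theta> in \<nu>'. \<theta> \<in> (\<Union>i<m. I i)"
    and "\<And>i. I i \<in> sets borel" "disjoint_family_on I {..<m}"
    and "\<And>i. i < m \<Longrightarrow> I i \<subseteq> {-L..L}"
    and "\<And>i \<theta> \<theta>'. i < m \<Longrightarrow> \<theta> \<in> I i \<Longrightarrow> \<theta>' \<in> I i \<Longrightarrow> \<bar>\<theta> - \<theta>'\<bar> \<le> \<epsilon>"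
    and "\<And>i. i < m \<Longrightarrow> ennreal c * emeasure \<nu>' (I i) \<le> emeasure \<nu> (I i)"
    and c: "0 \<le> c"
  shows "ennreal (c ^ n * exp (- (\<epsilon> * (\<Sum>i<n. \<bar>x i\<bar> + L)))) * joint_density n \<nu>' x \<le> joint_density n \<nu> x"
proof -
  have "ennreal (c ^ n * exp (- (\<epsilon> * (\<Sum>i<n. \<bar>x i\<bar> + L)))) * joint_density n \<nu>' x
     = (\<Prod>i<n. ennreal c * ennreal (exp (- (\<epsilon> * (\<bar>x i\<bar> + L)))) * mixture_density \<nu>' (x i))"
  proof -
    have "c ^ n * exp (- (\<epsilon> * (\<Sum>i<n. \<bar>x i\<bar> + L))) = (\<Prod>i<n. c * exp (- (\<epsilon> * (\<bar>x i\<bar> + L))))"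
      by (simp only: prod.distrib prod_constant card_lessThan exp_sum[OF finite_lessThan, symmetric]
          sum_negf sum_distrib_left)
    then show ?thesis
      using c by (simp add: joint_density_def prod_ennreal[symmetric] ennreal_mult prod.distrib[symmetric])
  qed
  also have "\<dots> \<le> joint_density n \<nu> x"
    unfolding joint_density_def
    by (intro prod_mono_ennreal mixture_density_ratio_le[OF assms(1-8)])
  finally show ?thesis .
qed

section \<open>First moments of the data\<close>

lemma gauss_mixture_abs_moment_le:
  assumes "prob_space \<nu>" and S [measurable_cong, simp]: "sets \<nu> = sets borel"
    and supp: "AE \<theta> in \<nu>. \<theta> \<in> {-L..L}"
  shows "(\<integral>\<^sup>+x. ennreal \<bar>x\<bar> \<partial>gauss_mixture \<nu>) \<le> ennreal (L + 2)"
proof -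
  interpret \<nu>: prob_space \<nu> by fact
  interpret N: real_distribution std_normal_distribution by (rule real_dist_normal_dist)
  interpret P: pair_prob_space \<nu> std_normal_distribution ..
  have L: "0 \<le> L"
  proof (rule ccontr)
    assume "\<not> 0 \<le> L"
    then have "{-L..L} = {}" by auto
    with supp have "AE \<theta> in \<nu>. False" by (simp only: empty_iff)
    then show False by (simp add: \<nu>.AE_False)
  qed
  have mom: "(\<integral>\<^sup>+z. ennreal (1 + z\<^sup>2) \<partial>std_normal_distribution) = 2"
  proof -
    have "(\<integral>z. z\<^sup>2 \<partial>std_normal_distribution) = 1"
      using std_normal_distribution_even_moments[of 1] by (simp add: fact_numeral)
    moreover have "integrable std_normal_distribution (\<lambda>z. z\<^sup>2)" by (rule integrable_std_normal_distribution_moment)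
    ultimately have "(\<integral>\<^sup>+z. ennreal (1 + z\<^sup>2) \<partial>std_normal_distribution) = ennreal 2"
      by (subst nn_integral_eq_integral) (auto simp: N.prob_space[unfolded N.space_eq_univ])
    then show ?thesis by simp
  qed
  have "(\<integral>\<^sup>+x. ennreal \<bar>x\<bar> \<partial>gauss_mixture \<nu>) = (\<integral>\<^sup>+z. ennreal \<bar>fst z + snd z\<bar> \<partial>(\<nu> \<Otimes>\<^sub>M std_normal_distribution))"
    unfolding gauss_mixture_def convolution_def by (subst nn_integral_distr) (auto simp: split_beta')
  also have "\<dots> = (\<integral>\<^sup>+x. (\<integral>\<^sup>+y. ennreal \<bar>x + y\<bar> \<partial>std_normal_distribution) \<partial>\<nu>)"
    by (subst N.nn_integral_fst[symmetric]) auto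
  also have "\<dots> \<le> (\<integral>\<^sup>+x. ennreal (L + 2) \<partial>\<nu>)"
  proof (rule nn_integral_mono_AE, use supp in eventually_elim)
    fix x assume x: "x \<in> {-L..L}"
    have "(\<integral>\<^sup>+y. ennreal \<bar>x + y\<bar> \<partial>std_normal_distribution) \<le> (\<integral>\<^sup>+y. ennreal L + ennreal (1 + y\<^sup>2) \<partial>std_normal_distribution)"
    proof (rule nn_integral_mono)
      fix y :: real
      \<comment> \<open>Domination by \<open>1 + y^2\<close>, whose Gaussian mean is 2, replaces the
        absolute moment by the variance and produces the 2 in \<open>L + 2\<close>.\<close>
      have "\<bar>y\<bar> \<le> 1 + y\<^sup>2"
      proof (cases "\<bar>y\<bar> \<le> 1")
        case False
        then have "\<bar>y\<bar> * 1 \<le> \<bar>y\<bar> * \<bar>y\<bar>" by (intro mult_left_mono) auto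
        then show ?thesis by (simp add: power2_eq_square abs_mult[symmetric])
      qed (simp add: add_increasing2)
      then have "\<bar>x + y\<bar> \<le> L + (1 + y\<^sup>2)" using x by auto
      then show "ennreal \<bar>x + y\<bar> \<le> ennreal L + ennreal (1 + y\<^sup>2)"
        using L by (simp add: ennreal_plus[symmetric] ennreal_leI del: ennreal_plus)
    qed
    also have "\<dots> = ennreal L + 2"
      using mom by (simp add: nn_integral_add N.emeasure_space_1[simplified])
    also have "\<dots> = ennreal (L + 2)" using L by (simp add: ennreal_plus)
    finally show "(\<integral>\<^sup>+y. ennreal \<bar>x + y\<bar> \<partial>std_normal_distribution) \<le> ennreal (L + 2)" .
  qed
  also have "\<dots> = ennreal (L + 2)" by (simp add: \<nu>.emeasure_space_1)
  finally show ?thesis .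
qed

text \<open>Markov's inequality is enough: the threshold used later is \<open>n powr (9/8)\<close>,
  which exceeds the mean by a power of \<open>n\<close>.\<close>

lemma gauss_mixture_sum_tail:
  assumes \<nu>: "prob_space \<nu>" "sets \<nu> = sets borel" "AE \<theta> in \<nu>. \<theta> \<in> {-L..L}"
    and L: "0 \<le> L" and K: "0 < K"
  shows "emeasure (\<Pi>\<^sub>M i\<in>{..<n}. gauss_mixture \<nu>)
      {x \<in> space (\<Pi>\<^sub>M i\<in>{..<n}. lborel). K < (\<Sum>i<n. \<bar>x i\<bar> + L)} \<le> ennreal (real n * (2 * L + 2) / K)"
proof -
  let ?G = "gauss_mixture \<nu>" and ?P = "\<Pi>\<^sub>M i\<in>{..<n}. gauss_mixture \<nu>"
  interpret G: prob_space ?G by (rule prob_space_gauss_mixture[OF \<nu>(1,2)])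
  have sp: "space ?P = space (\<Pi>\<^sub>M i\<in>{..<n}. lborel :: real measure)" by (simp add: space_PiM)
  have m: "(\<lambda>x. \<bar>x i\<bar> + L) \<in> borel_measurable ?P" if "i \<in> {..<n}" for i
    using that by measurable
  have m': "(\<lambda>x. ennreal (\<Sum>i<n. \<bar>x i\<bar> + L)) \<in> borel_measurable ?P"
    by (intro measurable_compose[OF _ measurable_ennreal] borel_measurable_sum m)
  have comp: "(\<integral>\<^sup>+x. ennreal (\<bar>x i\<bar> + L) \<partial>?P) \<le> ennreal (2 * L + 2)" if i: "i < n" for i
  proof -
    have "(\<integral>\<^sup>+x. ennreal (\<bar>x i\<bar> + L) \<partial>?P) = (\<integral>\<^sup>+y. ennreal (\<bar>y\<bar> + L) \<partial>distr ?P ?G (\<lambda>\<omega>. \<omega> i))"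
      using i by (subst nn_integral_distr) auto
    also have "distr ?P ?G (\<lambda>\<omega>. \<omega> i) = ?G"
      using i G.prob_space_axioms by (intro distr_PiM_component) auto
    also have "(\<integral>\<^sup>+y. ennreal (\<bar>y\<bar> + L) \<partial>?G) = (\<integral>\<^sup>+y. ennreal \<bar>y\<bar> \<partial>?G) + ennreal L"
      using L G.emeasure_space_1 by (simp add: ennreal_plus nn_integral_add)
    also have "\<dots> \<le> ennreal (L + 2) + ennreal L"
      by (intro add_mono gauss_mixture_abs_moment_le \<nu> order_refl)
    also have "\<dots> = ennreal (2 * L + 2)" using L by (simp add: ennreal_plus[symmetric] del: ennreal_plus)
    finally show ?thesis .
  qed
  have "emeasure ?P {x \<in> space (\<Pi>\<^sub>M i\<in>{..<n}. lborel). K < (\<Sum>i<n. \<bar>x i\<bar> + L)}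
      \<le> emeasure ?P {x \<in> space ?P. 1 \<le> ennreal (1 / K) * ennreal (\<Sum>i<n. \<bar>x i\<bar> + L)}"
  proof (rule emeasure_mono)
    show "{x \<in> space (\<Pi>\<^sub>M i\<in>{..<n}. lborel). K < (\<Sum>i<n. \<bar>x i\<bar> + L)}
      \<subseteq> {x \<in> space ?P. 1 \<le> ennreal (1 / K) * ennreal (\<Sum>i<n. \<bar>x i\<bar> + L)}"
      unfolding sp using K by (auto simp: ennreal_mult'[symmetric] ennreal_1[symmetric] simp del: ennreal_1 intro!: ennreal_leI)
    show "{x \<in> space ?P. 1 \<le> ennreal (1 / K) * ennreal (\<Sum>i<n. \<bar>x i\<bar> + L)} \<in> sets ?P"
      using m' by measurable
  qed
  also have "\<dots> \<le> ennreal (1 / K) * (\<integral>\<^sup>+x. ennreal (\<Sum>i<n. \<bar>x i\<bar> + L) * indicator (space ?P) x \<partial>?P)"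
    using m' by (intro nn_integral_Markov_inequality) auto
  also have "(\<integral>\<^sup>+x. ennreal (\<Sum>i<n. \<bar>x i\<bar> + L) * indicator (space ?P) x \<partial>?P)
      = (\<Sum>i<n. \<integral>\<^sup>+x. ennreal (\<bar>x i\<bar> + L) \<partial>?P)"
    using L m by (subst nn_integral_sum[symmetric]) (auto intro!: nn_integral_cong simp: sum_ennreal simp del: ennreal_plus)
  also have "ennreal (1 / K) * \<dots> \<le> ennreal (1 / K) * (\<Sum>i<n. ennreal (2 * L + 2))"
    by (intro mult_left_mono sum_mono comp) auto
  also have "\<dots> = ennreal (real n * (2 * L + 2) / K)"
    using L K by (simp add: ennreal_mult'[symmetric] ennreal_of_nat_eq_real_of_nat mult_ac del: ennreal_plus)
  finally show ?thesis .
qed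

section \<open>Prior mass of the Dirichlet process\<close>

lemma interval_partition:
  fixes L :: real
  assumes L: "0 < L" and m: "0 < (m :: nat)"
  obtains I :: "nat \<Rightarrow> real set" where "\<And>i. I i \<in> sets borel" "disjoint_family_on I {..<m}"
    "(\<Union>i<m. I i) = {-L..L}" "\<And>i \<theta> \<theta>'. i < m \<Longrightarrow> \<theta> \<in> I i \<Longrightarrow> \<theta>' \<in> I i \<Longrightarrow> \<bar>\<theta> - \<theta>'\<bar> \<le> 2 * L / real m"
    "\<And>i. i < m \<Longrightarrow> ennreal (1 / real m) \<le> emeasure (uniform_measure lborel {-L..L}) (I i)"
proof -
  define s where "s = (\<lambda>\<theta>. (\<theta> + L) * real m / (2 * L))"
  \<comment> \<open>The cells are level sets of the rounded-up affine coordinate. Truncated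
    subtraction sends the left endpoint \<open>-L\<close>, where \<open>s\<close> is 0, into cell
    0.\<close>
  define I where "I = (\<lambda>i. {\<theta> \<in> {-L..L}. nat \<lceil>s \<theta>\<rceil> - 1 = i})"
  have s0: "0 \<le> s \<theta>" "s \<theta> \<le> real m" if "\<theta> \<in> {-L..L}" for \<theta>
  proof -
    show "0 \<le> s \<theta>" using that L by (simp add: s_def)
    have "(\<theta> + L) * real m \<le> (2 * L) * real m" using that by (intro mult_right_mono) auto
    then show "s \<theta> \<le> real m" using L by (simp add: s_def divide_le_eq mult_ac)
  qed
  have I [measurable]: "I i \<in> sets borel" for i
    unfolding I_def s_def by measurable
  have cell: "real i \<le> s \<theta> \<and> s \<theta> \<le> real i + 1" if "\<theta> \<in> I i" for i \<theta>
  proof -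
    have "\<theta> \<in> {-L..L}" and e: "nat \<lceil>s \<theta>\<rceil> - 1 = i" using that by (auto simp: I_def)
    with s0[of \<theta>] show ?thesis by linarith
  qed
  show thesis
  proof (rule that[of I])
    show "I i \<in> sets borel" for i by (rule I)
    show "disjoint_family_on I {..<m}" by (auto simp: disjoint_family_on_def I_def)
    have "nat \<lceil>s \<theta>\<rceil> - 1 < m" if "\<theta> \<in> {-L..L}" for \<theta>
      using s0[OF that] m by linarith
    then show "(\<Union>i<m. I i) = {-L..L}" by (auto simp: I_def)
    show "\<bar>\<theta> - \<theta>'\<bar> \<le> 2 * L / real m" if "i < m" "\<theta> \<in> I i" "\<theta>' \<in> I i" for i \<theta> \<theta>'
    proof -
      have "\<bar>s \<theta> - s \<theta>'\<bar> \<le> 1" using cell[OF that(2)] cell[OF that(3)] by linarith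
      moreover have "s \<theta> - s \<theta>' = (\<theta> - \<theta>') * (real m / (2 * L))"
        using L by (simp add: s_def field_simps)
      ultimately have "\<bar>\<theta> - \<theta>'\<bar> * (real m / (2 * L)) \<le> 1" using L by (simp add: abs_mult)
      then show ?thesis using L m by (simp add: field_simps)
    qed
    show "ennreal (1 / real m) \<le> emeasure (uniform_measure lborel {-L..L}) (I i)" if i: "i < m" for i
    proof -
      let ?a = "-L + 2 * L * real i / real m" and ?b = "-L + 2 * L * real (i + 1) / real m"
      have sub: "{?a<..?b} \<subseteq> {-L..L} \<inter> I i"
      proof
        fix \<theta> assume t: "\<theta> \<in> {?a<..?b}"
        have "0 \<le> 2 * L * real i / real m" using L by simp
        moreover have "2 * L * real (i + 1) / real m \<le> 2 * L * real m / real m"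
          using i L by (intro divide_right_mono mult_left_mono) auto
        ultimately have "\<theta> \<in> {-L..L}" using t m by auto
        moreover have "real i < s \<theta>" "s \<theta> \<le> real i + 1"
          using t m L by (auto simp: s_def field_simps)
        then have "\<lceil>s \<theta>\<rceil> = int i + 1" by (intro ceiling_unique) auto
        ultimately show "\<theta> \<in> {-L..L} \<inter> I i" by (simp add: I_def)
      qed
      have "ennreal (1 / real m) = emeasure lborel {?a<..?b} / emeasure lborel {-L..L}"
      proof -
        have le: "?a \<le> ?b" using L by (intro add_left_mono divide_right_mono) auto
        have "?b - ?a = 2 * L / real m" using m by (simp add: field_simps)
        then show ?thesis using L le by (simp add: divide_ennreal)
      qed
      also have "\<dots> \<le> emeasure lborel ({-L..L} \<inter> I i) / emeasure lborel {-L..L}"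
        by (intro divide_right_mono_ennreal emeasure_mono sub) simp
      also have "\<dots> = emeasure (uniform_measure lborel {-L..L}) (I i)"
        by (rule emeasure_uniform_measure[symmetric]) auto
      finally show ?thesis .
    qed
  qed
qed

text \<open>The density of Beta(1, \<open>\<kappa>\<close>) is
  \<open>\<kappa> * (1 - x) powr (\<kappa> - 1)\<close>, with an exponent of either sign. Since
  \<open>1 - x\<close> lies in \<open>[\<delta>, 1]\<close> and \<open>\<kappa> - 1 \<le> K\<close>,
  the power is at least \<open>\<delta> powr K\<close>; the interval length adds one more
  \<open>\<delta>\<close>.\<close>

lemma emeasure_beta_1_ge:
  fixes \<kappa> K \<delta> a :: real
  assumes \<kappa>: "0 < \<kappa>" "\<kappa> \<le> K" and \<delta>: "0 < \<delta>" "\<delta> \<le> a" "a \<le> 1 - \<delta>"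
  shows "ennreal (\<kappa> * \<delta> powr (1 + K)) \<le> emeasure (density lborel (beta_density 1 \<kappa>)) {a - \<delta><..a}"
proof -
  have Beta: "Beta 1 \<kappa> = 1 / \<kappa>"
  proof -
    have "Gamma (1 + \<kappa>) = \<kappa> * Gamma \<kappa>"
      using Gamma_plus1[of \<kappa>] \<kappa> by (simp add: add.commute nonpos_Ints_def)
    moreover have "Gamma \<kappa> \<noteq> 0" using Gamma_real_pos[OF \<kappa>(1)] by linarith
    ultimately show ?thesis using \<kappa> by (simp add: Beta_def)
  qed
  have [measurable]: "beta_density 1 \<kappa> \<in> borel_measurable borel" unfolding beta_density_def by measurable
  have low: "\<kappa> * \<delta> powr K \<le> beta_density 1 \<kappa> x" if "x \<in> {a - \<delta><..a}" for x
  proof -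
    have x: "0 < x" "x < 1" "\<delta> \<le> 1 - x" using that \<delta> by auto
    have "\<delta> powr K \<le> (1 - x) powr K" using x \<delta> \<kappa> by (intro powr_mono2) auto
    also have "\<dots> \<le> (1 - x) powr (\<kappa> - 1)" using x \<kappa> by (intro powr_mono') auto
    finally show ?thesis using x \<kappa> by (simp add: beta_density_def Beta mult.commute)
  qed
  have "\<kappa> * \<delta> powr (1 + K) = (\<kappa> * \<delta> powr K) * \<delta>" using \<delta> by (simp add: powr_add mult_ac)
  then have "ennreal (\<kappa> * \<delta> powr (1 + K)) = (\<integral>\<^sup>+x. ennreal (\<kappa> * \<delta> powr K) * indicator {a - \<delta><..a} x \<partial>lborel)"
    using \<kappa> \<delta> by (simp add: nn_integral_cmult_indicator ennreal_mult'[symmetric])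
  also have "\<dots> \<le> (\<integral>\<^sup>+x. ennreal (beta_density 1 \<kappa> x) * indicator {a - \<delta><..a} x \<partial>lborel)"
    using low by (intro nn_integral_mono) (auto simp: indicator_def ennreal_leI)
  also have "\<dots> = emeasure (density lborel (beta_density 1 \<kappa>)) {a - \<delta><..a}"
    by (rule emeasure_density[symmetric]) auto
  finally show ?thesis .
qed

section \<open>Stick weights\<close>

lemma sum_stick_weight: "(\<Sum>j<n. stick_weight E j) = 1 - (\<Prod>h<n. 1 - E h)"
  by (induction n) (simp_all add: stick_weight_def algebra_simps)

text \<open>The expected length left after \<open>n\<close> sticks is \<open>r ^ n\<close> with
  \<open>r < 1\<close>. The expectations are summable, so the remaining lengths are almost surely
  summable and tend to 0, and the weights sum to 1. Thus the \<open>else\<close> branch of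
  \<open>stick_breaking\<close> has probability zero.\<close>

lemma AE_stick_weight:
  fixes \<kappa> :: real
  assumes \<kappa>: "0 < \<kappa>"
  shows "AE E in (\<Pi>\<^sub>M j\<in>(UNIV :: nat set). density lborel (beta_density 1 \<kappa>)).
    (\<forall>j. 0 \<le> stick_weight E j) \<and> stick_weight E sums 1"
proof -
  let ?B = "density lborel (beta_density 1 \<kappa>)" and ?P = "\<Pi>\<^sub>M j\<in>(UNIV :: nat set). density lborel (beta_density 1 \<kappa>)"
  interpret B: prob_space ?B using \<kappa> by (intro prob_space_beta_density) auto
  interpret PB: product_prob_space "\<lambda>_. ?B" "UNIV :: nat set" ..
  have [measurable]: "beta_density 1 \<kappa> \<in> borel_measurable borel" unfolding beta_density_def by measurable
  have AE01: "AE x in ?B. 0 \<le> x \<and> x \<le> 1"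
    by (subst AE_density) (auto simp: beta_density_def)
  have AE: "AE E in ?P. \<forall>j. 0 \<le> E j \<and> E j \<le> 1"
    unfolding AE_all_countable
    by (intro allI AE_PiM_component[where P = "\<lambda>x. 0 \<le> x \<and> x \<le> 1"] AE01 B.prob_space_axioms) auto
  define q where "q = (\<integral>\<^sup>+x. ennreal (1 - x) \<partial>?B)"
  have q1: "q < 1"
  proof -
    \<comment> \<open>Any interval of positive mass above 1/2 would do: there
      \<open>1 - x + 1/2 \<le> 1\<close>, which pushes the mean of \<open>1 - x\<close> strictly
      below 1. The left endpoint is spelled in the form of
      \<open>emeasure_beta_1_ge\<close>.\<close>
    let ?A = "{3/4 - 1/4<..3/4::real}"
    have "ennreal (\<kappa> * (1/4) powr (1 + \<kappa>)) \<le> emeasure ?B ?A"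
      using \<kappa> by (intro emeasure_beta_1_ge) auto
    moreover have "0 < ennreal (\<kappa> * (1/4) powr (1 + \<kappa>))" using \<kappa> by simp
    ultimately have A: "0 < emeasure ?B ?A" by (rule less_le_trans[rotated])
    have "q + ennreal (1/2) * emeasure ?B ?A = (\<integral>\<^sup>+x. ennreal (1 - x) + ennreal (1/2) * indicator ?A x \<partial>?B)"
      unfolding q_def by (subst nn_integral_add) (simp_all add: nn_integral_cmult_indicator)
    also have "\<dots> \<le> (\<integral>\<^sup>+x. 1 \<partial>?B)"
    proof (rule nn_integral_mono_AE, use AE01 in eventually_elim)
      fix x :: real assume x: "0 \<le> x \<and> x \<le> 1"
      have "ennreal (1 - x) + ennreal (1/2) * indicator ?A x = ennreal ((1 - x) + 1/2 * indicator ?A x)"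
        using x by (simp add: indicator_def ennreal_plus)
      also have "\<dots> \<le> ennreal 1" using x by (intro ennreal_leI) (auto simp: indicator_def)
      finally show "ennreal (1 - x) + ennreal (1/2) * indicator ?A x \<le> 1" by simp
    qed
    also have "\<dots> = 1" using B.emeasure_space_1 by simp
    finally have le: "q + ennreal (1/2) * emeasure ?B ?A \<le> 1" .
    show "q < 1"
    proof (rule ccontr)
      let ?h = "ennreal (1/2) * emeasure ?B ?A"
      assume "\<not> q < 1"
      then have "1 + ?h \<le> q + ?h" by (intro add_right_mono) (simp only: not_less)
      also have "\<dots> \<le> 1 + 0" using le by (simp only: add_0_right)
      finally have "?h \<le> 0" by (subst (asm) ennreal_add_left_cancel_le) auto
      moreover have "0 < ?h" 
        by (intro ennreal_zero_less_mult_iff[THEN iffD2] conjI A ennreal_less_zero_iff[THEN iffD2]) simp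
      ultimately show False using leD by blast
    qed
  qed
  define r where "r = enn2real q"
  have "q < top" using q1 by (rule less_trans) simp
  then have r: "q = ennreal r" "0 \<le> r" by (simp_all only: r_def ennreal_enn2real enn2real_nonneg)
  have "ennreal r < ennreal 1" using q1 unfolding r(1) by (simp only: ennreal_1)
  then have r1: "r < 1" by (simp only: ennreal_less_iff[OF r(2)])
  \<comment> \<open>The product rule concerns finite products, so the infinite sequence is first
    projected to its initial \<open>n\<close> coordinates.\<close>
  have int: "(\<integral>\<^sup>+E. (\<Prod>h<n. ennreal (1 - E h)) \<partial>?P) = ennreal (r ^ n)" for n
  proof -
    have m1: "(\<lambda>E. restrict E {..<n}) \<in> ?P \<rightarrow>\<^sub>M (\<Pi>\<^sub>M j\<in>{..<n}. ?B)"
      by (rule measurable_restrict_subset) simp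
    have m2: "(\<lambda>E. \<Prod>h<n. ennreal (1 - E h)) \<in> borel_measurable (\<Pi>\<^sub>M j\<in>{..<n}. ?B)"
      by (intro borel_measurable_prod_ennreal) measurable
    have "(\<integral>\<^sup>+E. (\<Prod>h<n. ennreal (1 - E h)) \<partial>?P) = (\<integral>\<^sup>+E. (\<Prod>h<n. ennreal (1 - restrict E {..<n} h)) \<partial>?P)"
      by (intro nn_integral_cong prod.cong) auto
    also have "\<dots> = (\<integral>\<^sup>+E. (\<Prod>h<n. ennreal (1 - E h)) \<partial>distr ?P (\<Pi>\<^sub>M j\<in>{..<n}. ?B) (\<lambda>E. restrict E {..<n}))"
      by (subst nn_integral_distr[OF m1]) (simp_all only: measurable_distr_eq1 m2)
    also have "distr ?P (\<Pi>\<^sub>M j\<in>{..<n}. ?B) (\<lambda>E. restrict E {..<n}) = (\<Pi>\<^sub>M j\<in>{..<n}. ?B)"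
      by (rule PB.distr_PiM_restrict_finite) auto
    also have "(\<integral>\<^sup>+E. (\<Prod>h<n. ennreal (1 - E h)) \<partial>(\<Pi>\<^sub>M j\<in>{..<n}. ?B)) = (\<Prod>h<n. q)"
      unfolding q_def by (rule PB.product_nn_integral_prod) auto
    finally show ?thesis using r by (simp add: ennreal_power)
  qed
  have "(\<integral>\<^sup>+E. (\<Sum>n. \<Prod>h<n. ennreal (1 - E h)) \<partial>?P) = (\<Sum>n. ennreal (r ^ n))"
    by (subst nn_integral_suminf) (auto simp: int)
  also have "\<dots> = ennreal (\<Sum>n. r ^ n)" using r r1 by (intro suminf_ennreal2 summable_geometric) auto
  finally have fin: "(\<integral>\<^sup>+E. (\<Sum>n. \<Prod>h<n. ennreal (1 - E h)) \<partial>?P) \<noteq> \<infinity>" by simp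
  have "AE E in ?P. (\<Sum>n. \<Prod>h<n. ennreal (1 - E h)) \<noteq> \<infinity>"
    by (rule nn_integral_PInf_AE[OF _ fin]) measurable
  with AE show ?thesis
  proof eventually_elim
    fix E :: "nat \<Rightarrow> real"
    assume E: "\<forall>j. 0 \<le> E j \<and> E j \<le> 1" and f: "(\<Sum>n. \<Prod>h<n. ennreal (1 - E h)) \<noteq> \<infinity>"
    have "(\<Sum>n. ennreal (\<Prod>h<n. 1 - E h)) \<noteq> top" using f E by (simp add: prod_ennreal)
    then have "summable (\<lambda>n. \<Prod>h<n. 1 - E h)"
      using E by (intro summable_suminf_not_top) (auto intro!: prod_nonneg)
    then have "(\<lambda>n. \<Prod>h<n. 1 - E h) \<longlonglongrightarrow> 0" by (rule summable_LIMSEQ_zero)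
    then have "(\<lambda>n. 1 - (\<Prod>h<n. 1 - E h)) \<longlonglongrightarrow> 1 - 0" by (intro tendsto_diff tendsto_const)
    then have "stick_weight E sums 1" by (simp add: sums_def sum_stick_weight)
    moreover have "\<forall>j. 0 \<le> stick_weight E j"
      using E by (auto simp: stick_weight_def intro!: mult_nonneg_nonneg prod_nonneg)
    ultimately show "(\<forall>j. 0 \<le> stick_weight E j) \<and> stick_weight E sums 1" by blast
  qed
qed

text \<open>The intervals are one-sided: \<open>E h \<le> a h\<close> only lengthens the remaining stick, so undershooting by
  \<open>\<delta>\<close> at stick \<open>j\<close> costs the weight \<open>j\<close> at most \<open>\<delta>\<close>. The targets are \<open>(1 - (m + 1) \<delta>) p i + \<delta>\<close>.\<close>

lemma stick_weight_ge:
  fixes p :: "nat \<Rightarrow> real"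
  assumes p: "\<And>i. i < m \<Longrightarrow> 0 \<le> p i" "(\<Sum>i<m. p i) \<le> 1"
    and \<delta>: "0 < \<delta>" "real (m + 1) * \<delta> \<le> 1"
  obtains a :: "nat \<Rightarrow> real" where "\<And>j. j < m \<Longrightarrow> \<delta> \<le> a j" "\<And>j. j < m \<Longrightarrow> a j \<le> 1 - \<delta>"
    "\<And>E j. (\<And>h. h < m \<Longrightarrow> E h \<in> {a h - \<delta><..a h}) \<Longrightarrow> j < m \<Longrightarrow> (1 - real (m + 1) * \<delta>) * p j \<le> stick_weight E j"
proof -
  define \<eta> where "\<eta> = real (m + 1) * \<delta>"
  define p' where "p' = (\<lambda>i. (1 - \<eta>) * p i + \<delta>)"
  \<comment> \<open>\<open>T j\<close> is the stick that remains when the targets before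
    \<open>j\<close> are met exactly. Of the reserve \<open>(m + 1) * \<delta>\<close>, the part
    \<open>m * \<delta>\<close> lifts every target to at least \<open>\<delta>\<close>, and the last
    \<open>\<delta>\<close> keeps \<open>T m \<ge> \<delta>\<close>; together they give
    \<open>\<delta> \<le> a j \<le> 1 - \<delta>\<close>.\<close>
  define T where "T = (\<lambda>j. 1 - (\<Sum>h<j. p' h))"
  define a where "a = (\<lambda>j. p' j / T j)"
  have p'\<delta>: "\<delta> \<le> p' i" if "i < m" for i
    using that p \<delta> by (simp add: p'_def \<eta>_def)
  have T_le: "T j \<le> 1" if "j \<le> m" for j
  proof -
    have "0 \<le> (\<Sum>h<j. p' h)" using that \<delta> by (intro sum_nonneg) (meson lessThan_iff less_le_trans less_imp_le order_trans p'\<delta>)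
    then show ?thesis by (simp add: T_def)
  qed
  have T_ge: "\<delta> \<le> T j" if "j \<le> m" for j
  proof -
    have "(\<Sum>h<j. p' h) \<le> (\<Sum>h<m. p' h)"
      using that \<delta> p'\<delta> by (intro sum_mono2) (auto intro: order_trans[OF less_imp_le])
    also have "\<dots> = (1 - \<eta>) * (\<Sum>h<m. p h) + real m * \<delta>"
      by (simp add: p'_def sum.distrib sum_distrib_left)
    also have "\<dots> \<le> (1 - \<eta>) * 1 + real m * \<delta>"
      using p \<delta> by (intro add_right_mono mult_left_mono) (auto simp: \<eta>_def)
    also have "\<dots> = 1 - \<delta>" by (simp add: \<eta>_def algebra_simps)
    finally show ?thesis by (simp add: T_def)
  qed
  have Tpos: "0 < T j" if "j \<le> m" for j using T_ge[OF that] \<delta> by linarith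
  have \<delta>T: "\<delta> * T j \<le> \<delta>" if "j \<le> m" for j
    using mult_left_mono[OF T_le[OF that] less_imp_le[OF \<delta>(1)]] by linarith
  have a\<delta>: "\<delta> \<le> a j" if j: "j < m" for j
  proof -
    have "\<delta> * T j \<le> p' j" using \<delta>T[of j] p'\<delta>[OF j] j by linarith
    then show "\<delta> \<le> a j" using Tpos[of j] j by (simp add: a_def pos_le_divide_eq)
  qed
  have T_Suc: "1 - a j = T (Suc j) / T j" if "j < m" for j
    using Tpos[of j] that by (simp add: a_def T_def field_simps)
  have prod_T: "(\<Prod>h<j. 1 - a h) = T j" if "j \<le> m" for j
    using that
  proof (induction j)
    case (Suc j)
    then show ?case using Tpos[of j] by (simp add: T_Suc)
  qed (simp add: T_def)
  show thesis
  proof (rule that[of a])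
    fix j assume j: "j < m"
    show "\<delta> \<le> a j" by (rule a\<delta>[OF j])
    have "\<delta> * T j \<le> T (Suc j)" using \<delta>T[of j] T_ge[of "Suc j"] j by linarith
    then have "\<delta> \<le> T (Suc j) / T j" using Tpos[of j] j by (simp add: pos_le_divide_eq)
    then show "a j \<le> 1 - \<delta>" using T_Suc[OF j] by simp
  next
    fix E :: "nat \<Rightarrow> real" and j
    assume E: "\<And>h. h < m \<Longrightarrow> E h \<in> {a h - \<delta><..a h}" and j: "j < m"
    have a1: "a h \<le> 1" if "h < m" for h
    proof -
      have "0 < T (Suc h) / T h" using Tpos that by (intro divide_pos_pos) auto
      then show ?thesis using T_Suc[OF that] by linarith
    qed
    have "(1 - \<eta>) * p j = a j * T j - \<delta>" using Tpos[of j] j by (simp add: a_def p'_def)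
    also have "\<dots> \<le> a j * T j - \<delta> * T j" using \<delta>T[of j] j by linarith
    also have "\<dots> = (a j - \<delta>) * (\<Prod>h<j. 1 - a h)" using j by (simp add: prod_T algebra_simps)
    also have "\<dots> \<le> E j * (\<Prod>h<j. 1 - E h)"
    proof (rule mult_mono)
      show "a j - \<delta> \<le> E j" using E[OF j] by simp
      then show "0 \<le> E j" using a\<delta>[OF j] by linarith
      show "(\<Prod>h<j. 1 - a h) \<le> (\<Prod>h<j. 1 - E h)"
      proof (rule prod_mono, intro conjI)
        fix h assume "h \<in> {..<j}"
        then have "h < m" using j by simp
        then show "0 \<le> 1 - a h" "1 - a h \<le> 1 - E h" using a1[of h] E[of h] by auto
      qed
      show "0 \<le> (\<Prod>h<j. 1 - a h)" using j Tpos[of j] by (simp add: prod_T)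
    qed
    finally show "(1 - real (m + 1) * \<delta>) * p j \<le> stick_weight E j"
      by (simp add: stick_weight_def \<eta>_def)
  qed
qed

text \<open>Prior statements are moved to the product space of sticks and atoms, where independence
  is available; the third part removes the \<open>else\<close> branch of
  \<open>stick_breaking\<close>.\<close>

lemma emeasure_dirichlet_process:
  fixes H :: "real measure"
  assumes \<kappa>: "0 < \<kappa>" and H: "prob_space H" "sets H = sets borel" and A: "A \<in> sets (prob_algebra borel)"
  defines "\<Omega> \<equiv> (\<Pi>\<^sub>M j\<in>(UNIV :: nat set). density lborel (beta_density 1 \<kappa>)) \<Otimes>\<^sub>M (\<Pi>\<^sub>M j\<in>(UNIV :: nat set). H)"
  shows "emeasure (dirichlet_process \<kappa> H) A = emeasure \<Omega> {z \<in> space \<Omega>. stick_breaking (fst z) (snd z) \<in> A}"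
    and "{z \<in> space \<Omega>. stick_breaking (fst z) (snd z) \<in> A} \<in> sets \<Omega>"
    and "AE z in \<Omega>. stick_breaking (fst z) (snd z) = atomic_measure (stick_weight (fst z)) (snd z)
           \<and> (\<forall>j. 0 \<le> stick_weight (fst z) j) \<and> stick_weight (fst z) sums 1"
proof -
  let ?B = "density lborel (beta_density 1 \<kappa>)"
  let ?PB = "\<Pi>\<^sub>M j\<in>(UNIV :: nat set). ?B" and ?PH = "\<Pi>\<^sub>M j\<in>(UNIV :: nat set). H"
  interpret B: prob_space ?B using \<kappa> by (intro prob_space_beta_density) auto
  interpret H: prob_space H by fact
  interpret PB: product_prob_space "\<lambda>_. ?B" "UNIV :: nat set" ..
  interpret PH: product_prob_space "\<lambda>_. H" "UNIV :: nat set" ..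
  interpret P: pair_prob_space ?PB ?PH ..
  have "sets \<Omega> = sets ((\<Pi>\<^sub>M j\<in>(UNIV :: nat set). borel) \<Otimes>\<^sub>M (\<Pi>\<^sub>M j\<in>(UNIV :: nat set). borel))"
    unfolding \<Omega>_def using H by (intro sets_pair_measure_cong sets_PiM_cong) auto
  from measurable_cong_sets[OF this refl] measurable_stick_breaking
  have m: "(\<lambda>(E, \<theta>). stick_breaking E \<theta>) \<in> \<Omega> \<rightarrow>\<^sub>M prob_algebra borel" by blast
  have eq: "(\<lambda>(E, \<theta>). stick_breaking E \<theta>) -` A \<inter> space \<Omega> = {z \<in> space \<Omega>. stick_breaking (fst z) (snd z) \<in> A}"
    by auto
  show "emeasure (dirichlet_process \<kappa> H) A = emeasure \<Omega> {z \<in> space \<Omega>. stick_breaking (fst z) (snd z) \<in> A}"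
    unfolding dirichlet_process_def \<Omega>_def[symmetric] using emeasure_distr[OF m A] by (simp add: eq)
  show "{z \<in> space \<Omega>. stick_breaking (fst z) (snd z) \<in> A} \<in> sets \<Omega>"
    using measurable_sets[OF m A] by (simp add: eq)
  have fstm: "distr \<Omega> ?PB fst = ?PB" unfolding \<Omega>_def by (rule PH.distr_pair_fst)
  have "AE z in \<Omega>. (\<forall>j. 0 \<le> stick_weight (fst z) j) \<and> stick_weight (fst z) sums 1"
    by (rule AE_distrD[where M' = ?PB]) (unfold fstm, simp add: \<Omega>_def, rule AE_stick_weight[OF \<kappa>])
  then show "AE z in \<Omega>. stick_breaking (fst z) (snd z) = atomic_measure (stick_weight (fst z)) (snd z)
           \<and> (\<forall>j. 0 \<le> stick_weight (fst z) j) \<and> stick_weight (fst z) sums 1"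
    by eventually_elim (simp add: stick_breaking_def)
qed

lemma AE_dirichlet_process_atoms:
  fixes H :: "real measure"
  assumes \<kappa>: "0 < \<kappa>" and H: "prob_space H" "sets H = sets borel" and S: "S \<in> sets borel" "AE x in H. x \<in> S"
  shows "AE z in (\<Pi>\<^sub>M j\<in>(UNIV :: nat set). density lborel (beta_density 1 \<kappa>)) \<Otimes>\<^sub>M (\<Pi>\<^sub>M j\<in>(UNIV :: nat set). H).
    \<forall>j. snd z j \<in> S"
proof -
  let ?B = "density lborel (beta_density 1 \<kappa>)"
  let ?PB = "\<Pi>\<^sub>M j\<in>(UNIV :: nat set). ?B" and ?PH = "\<Pi>\<^sub>M j\<in>(UNIV :: nat set). H"
  interpret B: prob_space ?B using \<kappa> by (intro prob_space_beta_density) auto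
  interpret H: prob_space H by fact
  interpret PB: product_prob_space "\<lambda>_. ?B" "UNIV :: nat set" ..
  interpret PH: product_prob_space "\<lambda>_. H" "UNIV :: nat set" ..
  interpret P: pair_prob_space ?PB ?PH ..
  have [measurable]: "S \<in> sets H" using S H by simp
  have "AE \<theta> in ?PH. \<forall>j. \<theta> j \<in> S"
    unfolding AE_all_countable
    by (intro allI AE_PiM_component[where P = "\<lambda>x. x \<in> S"] S H.prob_space_axioms) auto
  then show ?thesis
    by (intro P.AE_pair_measure) auto
qed

lemma prob_algebra_Collect_sets [measurable]:
  fixes A :: "real set" and c :: ennreal
  assumes "A \<in> sets borel"
  shows "{\<nu> \<in> space (prob_algebra borel). c \<le> emeasure \<nu> A} \<in> sets (prob_algebra borel)"
    and "{\<nu> \<in> space (prob_algebra borel). emeasure \<nu> A \<noteq> c} \<in> sets (prob_algebra borel)"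
proof -
  have "(\<lambda>\<nu>. emeasure \<nu> A) \<in> borel_measurable (prob_algebra borel)"
    by (rule measurable_emeasure_kernel[OF measurable_prob_algebraD, where N = borel]) (use assms in auto)
  note this [measurable]
  show "{\<nu> \<in> space (prob_algebra borel). c \<le> emeasure \<nu> A} \<in> sets (prob_algebra borel)"
    "{\<nu> \<in> space (prob_algebra borel). emeasure \<nu> A \<noteq> c} \<in> sets (prob_algebra borel)"
    by measurable
qed

lemma dirichlet_process_support:
  fixes H :: "real measure"
  assumes \<kappa>: "0 < \<kappa>" and H: "prob_space H" "sets H = sets borel" and S: "S \<in> sets borel" "AE x in H. x \<in> S"
  shows "emeasure (dirichlet_process \<kappa> H) {\<nu> \<in> space (prob_algebra borel). emeasure \<nu> S \<noteq> 1} = 0"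
proof -
  note D = emeasure_dirichlet_process[OF \<kappa> H prob_algebra_Collect_sets(2)[OF S(1), of 1]]
  let ?\<Omega> = "(\<Pi>\<^sub>M j\<in>(UNIV :: nat set). density lborel (beta_density 1 \<kappa>)) \<Otimes>\<^sub>M (\<Pi>\<^sub>M j\<in>(UNIV :: nat set). H)"
  have "AE z in ?\<Omega>. z \<notin> {z \<in> space ?\<Omega>. stick_breaking (fst z) (snd z) \<in> {\<nu> \<in> space (prob_algebra borel). emeasure \<nu> S \<noteq> 1}}"
    using D(3) AE_dirichlet_process_atoms[OF \<kappa> H S]
  proof eventually_elim
    fix z
    assume "stick_breaking (fst z) (snd z) = atomic_measure (stick_weight (fst z)) (snd z)
           \<and> (\<forall>j. 0 \<le> stick_weight (fst z) j) \<and> stick_weight (fst z) sums 1" and s: "\<forall>j. snd z j \<in> S"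
    then have eq: "stick_breaking (fst z) (snd z) = atomic_measure (stick_weight (fst z)) (snd z)"
      and w: "\<forall>j. 0 \<le> stick_weight (fst z) j" "stick_weight (fst z) sums 1" by auto
    have "emeasure (stick_breaking (fst z) (snd z)) S = (\<Sum>j. ennreal (stick_weight (fst z) j))"
      using s by (simp add: eq emeasure_atomic_measure[OF S(1)])
    also have "\<dots> = ennreal 1" using w by (simp add: suminf_ennreal2 sums_iff)
    finally show "z \<notin> {z \<in> space ?\<Omega>. stick_breaking (fst z) (snd z) \<in> {\<nu> \<in> space (prob_algebra borel). emeasure \<nu> S \<noteq> 1}}"
      by simp
  qed
  then show ?thesis
    unfolding D(1) using D(2) by (subst (asm) AE_iff_null_sets[symmetric]) (auto simp: null_sets_def)
qed

text \<open>Stick \<open>i\<close> is assigned to cell \<open>i\<close>. If the first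
  \<open>m\<close> breaks fall into the intervals of \<open>stick_weight_ge\<close> (event
  \<open>X\<close>) and atom \<open>i\<close> falls into \<open>I i\<close> (event
  \<open>Y\<close>), then the single weight \<open>i\<close> already gives cell \<open>i\<close> its
  required mass, and further atoms only add to it. Each break contributes a factor at least
  \<open>\<kappa> * \<delta> powr (1 + K)\<close>, each atom a factor at least \<open>h\<close>, all
  independent.\<close>

lemma dirichlet_process_mass_ge:
  fixes H :: "real measure" and I :: "nat \<Rightarrow> real set" and p :: "nat \<Rightarrow> real"
  assumes \<kappa>: "0 < \<kappa>" "\<kappa> \<le> K" and H: "prob_space H" "sets H = sets borel"
    and I [measurable]: "\<And>i. I i \<in> sets borel" and h: "0 \<le> h" "\<And>i. i < m \<Longrightarrow> ennreal h \<le> emeasure H (I i)"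
    and p: "\<And>i. i < m \<Longrightarrow> 0 \<le> p i" "(\<Sum>i<m. p i) \<le> 1"
    and \<delta>: "0 < \<delta>" "real (m + 1) * \<delta> \<le> 1"
  defines "G \<equiv> {\<nu> \<in> space (prob_algebra borel). \<forall>i<m. ennreal ((1 - real (m + 1) * \<delta>) * p i) \<le> emeasure \<nu> (I i)}"
  shows "G \<in> sets (prob_algebra borel)"
    and "ennreal ((\<kappa> * \<delta> powr (1 + K) * h) ^ m) \<le> emeasure (dirichlet_process \<kappa> H) G"
proof -
  let ?B = "density lborel (beta_density 1 \<kappa>)"
  let ?PB = "\<Pi>\<^sub>M j\<in>(UNIV :: nat set). ?B" and ?PH = "\<Pi>\<^sub>M j\<in>(UNIV :: nat set). H"
  let ?\<Omega> = "?PB \<Otimes>\<^sub>M ?PH"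
  interpret B: prob_space ?B using \<kappa> by (intro prob_space_beta_density) auto
  interpret H: prob_space H by fact
  interpret PB: product_prob_space "\<lambda>_. ?B" "UNIV :: nat set" ..
  interpret PH: product_prob_space "\<lambda>_. H" "UNIV :: nat set" ..
  have "G = (\<Inter>i\<in>{..<m}. {\<nu> \<in> space (prob_algebra borel). ennreal ((1 - real (m + 1) * \<delta>) * p i) \<le> emeasure \<nu> (I i)}) \<inter> space (prob_algebra borel)"
    by (auto simp: G_def)
  also have "\<dots> \<in> sets (prob_algebra borel)"
    by (cases "m = 0") (auto intro!: sets.Int sets.finite_INT prob_algebra_Collect_sets I)
  finally show G: "G \<in> sets (prob_algebra borel)" .
  note D = emeasure_dirichlet_process[OF \<kappa>(1) H G]
  obtain a :: "nat \<Rightarrow> real" where a: "\<And>j. j < m \<Longrightarrow> \<delta> \<le> a j" "\<And>j. j < m \<Longrightarrow> a j \<le> 1 - \<delta>"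
    "\<And>E j. (\<And>h. h < m \<Longrightarrow> E h \<in> {a h - \<delta><..a h}) \<Longrightarrow> j < m \<Longrightarrow> (1 - real (m + 1) * \<delta>) * p j \<le> stick_weight E j"
    using stick_weight_ge[OF p \<delta>] by blast
  define X where "X = prod_emb UNIV (\<lambda>_. ?B) {..<m} (\<Pi>\<^sub>E j\<in>{..<m}. {a j - \<delta><..a j})"
  define Y where "Y = prod_emb UNIV (\<lambda>_. H) {..<m} (\<Pi>\<^sub>E j\<in>{..<m}. I j)"
  have XY [measurable]: "X \<in> sets ?PB" "Y \<in> sets ?PH"
    unfolding X_def Y_def using I H by (auto intro!: sets_PiM_I)
  have mX: "emeasure ?PB X = (\<Prod>j<m. emeasure ?B {a j - \<delta><..a j})"
    unfolding X_def by (rule PB.emeasure_PiM_emb) auto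
  have mY: "emeasure ?PH Y = (\<Prod>j<m. emeasure H (I j))"
    unfolding Y_def using I H by (intro PH.emeasure_PiM_emb) auto
  have "ennreal ((\<kappa> * \<delta> powr (1 + K) * h) ^ m) = (\<Prod>j<m. ennreal (\<kappa> * \<delta> powr (1 + K))) * (\<Prod>j<m. ennreal h)"
    using \<kappa> h by (simp add: ennreal_mult'[symmetric] ennreal_power power_mult_distrib[symmetric])
  also have "\<dots> \<le> emeasure ?PB X * emeasure ?PH Y"
    unfolding mX mY using a \<kappa> \<delta> h by (intro mult_mono prod_mono_ennreal emeasure_beta_1_ge) auto
  also have "\<dots> = emeasure ?\<Omega> (X \<times> Y)"
    by (rule PH.P.emeasure_pair_measure_Times[symmetric]) (use XY in auto)
  also have "\<dots> \<le> emeasure ?\<Omega> {z \<in> space ?\<Omega>. stick_breaking (fst z) (snd z) \<in> G}"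
  proof (rule emeasure_mono_AE)
    show "AE z in ?\<Omega>. z \<in> X \<times> Y \<longrightarrow> z \<in> {z \<in> space ?\<Omega>. stick_breaking (fst z) (snd z) \<in> G}"
      using D(3) AE_space
    proof eventually_elim
      fix z
      assume "stick_breaking (fst z) (snd z) = atomic_measure (stick_weight (fst z)) (snd z)
           \<and> (\<forall>j. 0 \<le> stick_weight (fst z) j) \<and> stick_weight (fst z) sums 1" and z: "z \<in> space ?\<Omega>"
      then have eq: "stick_breaking (fst z) (snd z) = atomic_measure (stick_weight (fst z)) (snd z)"
        and w: "\<forall>j. 0 \<le> stick_weight (fst z) j" "stick_weight (fst z) sums 1" by auto
      show "z \<in> X \<times> Y \<longrightarrow> z \<in> {z \<in> space ?\<Omega>. stick_breaking (fst z) (snd z) \<in> G}"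
      proof
        assume "z \<in> X \<times> Y"
        then have E: "\<And>j. j < m \<Longrightarrow> fst z j \<in> {a j - \<delta><..a j}" and \<theta>: "\<And>j. j < m \<Longrightarrow> snd z j \<in> I j"
          by (auto simp: X_def Y_def prod_emb_def PiE_iff)
        have "ennreal ((1 - real (m + 1) * \<delta>) * p i) \<le> emeasure (atomic_measure (stick_weight (fst z)) (snd z)) (I i)" if i: "i < m" for i
        proof -
          define f where "f = (\<lambda>j. ennreal (stick_weight (fst z) j) * indicator (I i) (snd z j))"
          have "ennreal ((1 - real (m + 1) * \<delta>) * p i) \<le> f i"
            using a(3)[of "fst z" i, OF E i] \<theta>[OF i] by (simp add: f_def ennreal_leI)
          also have "\<dots> \<le> (\<Sum>j. f j)" using sum_le_suminf[of f "{i}"] by simp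
          also have "(\<Sum>j. f j) = (\<Sum>j. ennreal (stick_weight (fst z) j) * indicator (I i) (snd z j))"
            by (simp only: f_def)
          also have "\<dots> = emeasure (atomic_measure (stick_weight (fst z)) (snd z)) (I i)"
            by (rule emeasure_atomic_measure[symmetric]) (rule I)
          finally show ?thesis .
        qed
        moreover have "atomic_measure (stick_weight (fst z)) (snd z) \<in> space (prob_algebra borel)"
          using w by (simp add: space_prob_algebra prob_space_atomic_measure)
        ultimately show "z \<in> {z \<in> space ?\<Omega>. stick_breaking (fst z) (snd z) \<in> G}"
          using z by (simp add: eq G_def)
      qed
    qed
  qed (rule D(2))
  finally show "ennreal ((\<kappa> * \<delta> powr (1 + K) * h) ^ m) \<le> emeasure (dirichlet_process \<kappa> H) G"
    by (simp add: D(1))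
qed

section \<open>Posterior contraction\<close>

text \<open>Real and imaginary part of \<open>iexp\<close>, indexed by a Boolean so that one real
  bounded test handles both.\<close>

definition trig :: "bool \<Rightarrow> real \<Rightarrow> real" where
  "trig b = (if b then cos else sin)"

lemma measurable_trig [measurable]: "trig b \<in> borel_measurable borel"
  by (simp add: trig_def)

lemma abs_trig_le_1: "\<bar>trig b x\<bar> \<le> 1"
  by (simp add: trig_def)

lemma char_eq_trig:
  assumes "prob_space \<nu>" and S [measurable_cong, simp]: "sets \<nu> = sets borel"
  shows "char \<nu> t = Complex (\<integral>x. trig True (t * x) \<partial>\<nu>) (\<integral>x. trig False (t * x) \<partial>\<nu>)"
proof -
  interpret \<nu>: prob_space \<nu> by fact
  have int: "integrable \<nu> (\<lambda>x. iexp (t * x))" by (rule \<nu>.integrable_iexp) measurable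
  have "Re (char \<nu> t) = (\<integral>x. Re (iexp (t * x)) \<partial>\<nu>)" "Im (char \<nu> t) = (\<integral>x. Im (iexp (t * x)) \<partial>\<nu>)"
    unfolding char_def by (simp_all only: integral_Re[OF int] integral_Im[OF int])
  then show ?thesis by (simp add: complex_eq_iff trig_def Re_exp Im_exp)
qed

lemma integral_trig_gauss_mixture:
  assumes "prob_space \<nu>" "sets \<nu> = sets borel"
  shows "(\<integral>x. trig b (t * x) \<partial>gauss_mixture \<nu>) = exp (- (t\<^sup>2) / 2) * (\<integral>x. trig b (t * x) \<partial>\<nu>)"
  using char_gauss_mixture[OF assms, of t]
  unfolding char_eq_trig[OF assms] char_eq_trig[OF prob_space_gauss_mixture[OF assms] sets_gauss_mixture]
  by (cases b) (simp_all add: complex_eq_iff mult.commute)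

text \<open>The test accepts when the empirical mean of \<open>g\<close> is within
  \<open>\<Theta> / 8\<close> of its mean under \<open>\<nu>'\<close>. Gaussian smoothing multiplies
  the separation \<open>\<Theta> / 2\<close> by \<open>exp (- t^2 / 2) \<ge> 1/2\<close>, so the
  means of the data under \<open>\<nu>\<close> and \<open>\<nu>'\<close> are
  \<open>\<Theta> / 4\<close> apart. Acceptance then forces a deviation of
  \<open>\<Theta> / 8\<close> under \<open>\<nu>\<close>, and Hoeffding's inequality bounds both
  kinds of error by the same \<open>2 * E\<close>.\<close>

lemma posterior_trig_le:
  fixes P :: "real measure measure" and \<nu>' :: "real measure" and d \<Theta> t :: real and b :: bool and n :: nat
  assumes P: "prob_space P" and sP: "sets P = sets (prob_algebra borel)"
    and \<nu>': "\<nu>' \<in> space (prob_algebra borel)" and S: "S \<in> sets (\<Pi>\<^sub>M i\<in>{..<n}. lborel)"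
    and d: "0 < d" and n: "0 < n" and \<Theta>: "0 \<le> \<Theta>" and t: "\<bar>t\<bar> \<le> 1"
    and evidence: "\<And>x. x \<in> S \<Longrightarrow> ennreal d * joint_density n \<nu>' x \<le> (\<integral>\<^sup>+\<mu>. joint_density n \<mu> x \<partial>P)"
  defines "B \<equiv> {\<nu> \<in> space (prob_algebra borel). \<Theta> / 2 < \<bar>(\<integral>x. trig b (t * x) \<partial>\<nu>) - (\<integral>x. trig b (t * x) \<partial>\<nu>')\<bar>}"
    and "E \<equiv> exp (- (real n * (\<Theta> / 8)\<^sup>2 / 2))"
  shows "B \<in> sets (prob_algebra borel)"
    and "(\<integral>\<^sup>+x. emeasure (posterior P n x) B \<partial>(\<Pi>\<^sub>M i\<in>{..<n}. gauss_mixture \<nu>'))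
     \<le> emeasure (\<Pi>\<^sub>M i\<in>{..<n}. gauss_mixture \<nu>') (space (\<Pi>\<^sub>M i\<in>{..<n}. lborel) - S)
      + ennreal (2 * E) + ennreal (2 * E) / ennreal d"
proof -
  let ?R = "\<Pi>\<^sub>M i\<in>{..<n}. lborel :: real measure"
  define g where "g = (\<lambda>x. trig b (t * x))"
  have g [measurable]: "g \<in> borel_measurable borel" unfolding g_def by measurable
  have g1: "\<bar>g x\<bar> \<le> 1" for x by (simp add: g_def abs_trig_le_1)
  have "(\<lambda>\<nu>. \<integral>x. g x \<partial>\<nu>) \<in> borel_measurable (prob_algebra borel)"
  proof -
    have "(\<lambda>\<nu>. \<nu>) \<in> prob_algebra borel \<rightarrow>\<^sub>M subprob_algebra (borel :: real measure)"
      by (rule measurable_prob_algebraD) simp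
    then show ?thesis by (rule measurable_compose[OF _ integral_measurable_subprob_algebra[OF g]])
  qed
  note this [measurable]
  show B: "B \<in> sets (prob_algebra borel)" unfolding B_def g_def[symmetric] by measurable
  have sp: "space (\<Pi>\<^sub>M i\<in>{..<n}. gauss_mixture \<nu>) = space ?R" for \<nu> by (simp add: space_PiM)
  let ?m = "\<lambda>\<nu>. \<integral>x. g x \<partial>gauss_mixture \<nu>"
  let ?err = "\<lambda>\<nu>. {x \<in> space ?R. \<Theta> / 8 \<le> \<bar>(\<Sum>i<n. g (x i)) / real n - ?m \<nu>\<bar>}"
  have hoeff: "emeasure (\<Pi>\<^sub>M i\<in>{..<n}. gauss_mixture \<nu>) (?err \<nu>) \<le> ennreal (2 * E)"
    if "\<nu> \<in> space (prob_algebra borel)" for \<nu>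
    using hoeffding_PiM[OF prob_space_gauss_mixture sets_gauss_mixture g g1 n, of \<nu> "\<Theta> / 8"] that \<Theta>
    unfolding sp E_def by (auto simp: space_prob_algebra)
  have errm: "?err \<nu> \<in> sets ?R" for \<nu>
  proof -
    have "(\<lambda>x. \<Sum>i<n. g (x i)) \<in> borel_measurable ?R"
      by (intro borel_measurable_sum measurable_compose[OF _ g]) measurable
    note this [measurable]
    show ?thesis by measurable
  qed
  define T where "T = space ?R - ?err \<nu>'"
  have T: "T \<in> sets ?R" unfolding T_def using errm by auto
  have "(\<integral>\<^sup>+x. emeasure (posterior P n x) B \<partial>(\<Pi>\<^sub>M i\<in>{..<n}. gauss_mixture \<nu>'))
     \<le> emeasure (\<Pi>\<^sub>M i\<in>{..<n}. gauss_mixture \<nu>') (space ?R - S)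
      + emeasure (\<Pi>\<^sub>M i\<in>{..<n}. gauss_mixture \<nu>') (space ?R - T) + ennreal (2 * E) / ennreal d"
  proof (rule posterior_mass_le[OF P sP \<nu>' _ S T d evidence])
    show "B \<in> sets P" using B by (simp add: sP)
    fix \<nu> assume \<nu>: "\<nu> \<in> B"
    then have \<nu>p: "\<nu> \<in> space (prob_algebra borel)" by (simp add: B_def)
    have far: "\<Theta> / 4 \<le> \<bar>?m \<nu> - ?m \<nu>'\<bar>"
    proof -
      have "t\<^sup>2 \<le> 1" using t by (simp add: abs_square_le_1)
      then have e: "1/2 \<le> exp (- (t\<^sup>2) / 2)" using exp_ge_add_one_self[of "- (t\<^sup>2) / 2"] by linarith
      have "?m \<nu> - ?m \<nu>' = exp (- (t\<^sup>2) / 2) * ((\<integral>x. g x \<partial>\<nu>) - (\<integral>x. g x \<partial>\<nu>'))"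
        using \<nu>p \<nu>' unfolding g_def
        by (simp add: space_prob_algebra integral_trig_gauss_mixture right_diff_distrib)
      then have "\<bar>?m \<nu> - ?m \<nu>'\<bar> = exp (- (t\<^sup>2) / 2) * \<bar>(\<integral>x. g x \<partial>\<nu>) - (\<integral>x. g x \<partial>\<nu>')\<bar>"
        by (simp add: abs_mult)
      moreover have "(1/2) * (\<Theta> / 2) \<le> exp (- (t\<^sup>2) / 2) * \<bar>(\<integral>x. g x \<partial>\<nu>) - (\<integral>x. g x \<partial>\<nu>')\<bar>"
        using e \<nu> \<Theta> by (intro mult_mono) (auto simp: B_def g_def)
      ultimately show ?thesis by simp
    qed
    have "T \<subseteq> ?err \<nu>"
    proof
      fix x assume x: "x \<in> T"
      then have "\<bar>(\<Sum>i<n. g (x i)) / real n - ?m \<nu>'\<bar> < \<Theta> / 8" "x \<in> space ?R" by (auto simp: T_def not_le)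
      then show "x \<in> ?err \<nu>" using far by (auto intro: order_trans) (smt (verit) far field_sum_of_halves)
    qed
    then have "emeasure (\<Pi>\<^sub>M i\<in>{..<n}. gauss_mixture \<nu>) T \<le> emeasure (\<Pi>\<^sub>M i\<in>{..<n}. gauss_mixture \<nu>) (?err \<nu>)"
    proof (rule emeasure_mono)
      have "sets (\<Pi>\<^sub>M i\<in>{..<n}. gauss_mixture \<nu>) = sets ?R" by (rule sets_PiM_cong) auto
      then show "?err \<nu> \<in> sets (\<Pi>\<^sub>M i\<in>{..<n}. gauss_mixture \<nu>)" using errm by blast
    qed
    also have "\<dots> \<le> ennreal (2 * E)" by (rule hoeff[OF \<nu>p])
    finally show "emeasure (\<Pi>\<^sub>M i\<in>{..<n}. gauss_mixture \<nu>) T \<le> ennreal (2 * E)" .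
  qed
  also have "space ?R - T = ?err \<nu>'" by (auto simp: T_def)
  also have "emeasure (\<Pi>\<^sub>M i\<in>{..<n}. gauss_mixture \<nu>') (space ?R - S)
      + emeasure (\<Pi>\<^sub>M i\<in>{..<n}. gauss_mixture \<nu>') (?err \<nu>') + ennreal (2 * E) / ennreal d
     \<le> emeasure (\<Pi>\<^sub>M i\<in>{..<n}. gauss_mixture \<nu>') (space ?R - S) + ennreal (2 * E) + ennreal (2 * E) / ennreal d"
    by (intro add_mono hoeff[OF \<nu>'] order_refl)
  finally show "(\<integral>\<^sup>+x. emeasure (posterior P n x) B \<partial>(\<Pi>\<^sub>M i\<in>{..<n}. gauss_mixture \<nu>'))
     \<le> emeasure (\<Pi>\<^sub>M i\<in>{..<n}. gauss_mixture \<nu>') (space ?R - S)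
      + ennreal (2 * E) + ennreal (2 * E) / ennreal d" .
qed

section \<open>Lower bound on the evidence\<close>

lemma prob_space_uniform_interval:
  fixes L :: real
  assumes "0 < L" shows "prob_space (uniform_measure lborel {-L..L})"
  using assms by (intro prob_space_uniform_measure) auto

lemma AE_support:
  assumes "\<nu> \<in> space (prob_algebra borel)" "emeasure \<nu> A = 1" "A \<in> sets borel"
  shows "AE x in \<nu>. x \<in> A"
proof -
  interpret prob_space \<nu> using assms(1) by (simp add: space_prob_algebra)
  have [simp]: "sets \<nu> = sets borel" using assms(1) by (simp add: space_prob_algebra)
  show ?thesis using assms(2,3) by (intro prob_eq_1[THEN iffD1]) (auto simp: measure_def)
qed

text \<open>The prior integral is restricted to the measures \<open>G\<close> whose cell masses
  nearly match those of \<open>\<nu>'\<close>; on \<open>G\<close> the likelihood ratio is bounded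
  below by a constant as soon as \<open>x\<close> satisfies the moment bound. The constant is the
  prior mass of \<open>G\<close> times that ratio.\<close>

lemma evidence_ge:
  fixes L K \<kappa> Q :: real
  assumes L: "0 < L" and \<kappa>: "0 < \<kappa>" "\<kappa> \<le> K" and m: "0 < m"
    and \<nu>': "\<nu>' \<in> space (prob_algebra borel)" "emeasure \<nu>' {-L..L} = 1"
    and x: "(\<Sum>i<n. \<bar>x i\<bar> + L) \<le> Q"
  shows "ennreal ((\<kappa> * (1 / (real (m + 1))\<^sup>2) powr (1 + K) * (1 / real m)) ^ m
       * ((1 - 1 / real (m + 1)) ^ n * exp (- (2 * L / real m * Q)))) * joint_density n \<nu>' x
     \<le> (\<integral>\<^sup>+\<mu>. joint_density n \<mu> x \<partial>dirichlet_process \<kappa> (uniform_measure lborel {-L..L}))"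
proof -
  let ?H = "uniform_measure lborel {-L..L}"
  \<comment> \<open>This \<open>\<delta>\<close> makes the relative loss
    \<open>(m + 1) * \<delta>\<close> equal to \<open>1 / (m + 1)\<close>, while being only
    polynomially small in \<open>m\<close>.\<close>
  let ?\<delta> = "1 / (real (m + 1))\<^sup>2" and ?c = "1 - 1 / real (m + 1)"
  have sm: "real (m + 1) * ?\<delta> = 1 / real (m + 1)" by (simp add: power2_eq_square)
  have c0: "0 \<le> ?c" by simp
  interpret N: prob_space \<nu>' using \<nu>' by (simp add: space_prob_algebra)
  have s': "sets \<nu>' = sets borel" using \<nu>' by (simp add: space_prob_algebra)
  obtain I :: "nat \<Rightarrow> real set" where I: "\<And>i. I i \<in> sets borel" "disjoint_family_on I {..<m}"
    "(\<Union>i<m. I i) = {-L..L}" "\<And>i \<theta> \<theta>'. i < m \<Longrightarrow> \<theta> \<in> I i \<Longrightarrow> \<theta>' \<in> I i \<Longrightarrow> \<bar>\<theta> - \<theta>'\<bar> \<le> 2 * L / real m"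
    "\<And>i. i < m \<Longrightarrow> ennreal (1 / real m) \<le> emeasure ?H (I i)"
    using interval_partition[OF L m] by blast
  define p where "p = (\<lambda>i. measure \<nu>' (I i))"
  have p: "0 \<le> p i" "(\<Sum>i<m. p i) \<le> 1" for i
  proof -
    have "(\<Sum>i<m. p i) = measure \<nu>' (\<Union>i<m. I i)"
      unfolding p_def using I s' by (intro N.finite_measure_finite_Union[symmetric]) auto
    then show "(\<Sum>i<m. p i) \<le> 1" by simp
  qed (simp add: p_def)
  define G where "G = {\<nu> \<in> space (prob_algebra borel). \<forall>i<m. ennreal ((1 - real (m + 1) * ?\<delta>) * p i) \<le> emeasure \<nu> (I i)}"
  have h0: "0 \<le> 1 / real m" and \<delta>0: "0 < ?\<delta>" and \<delta>1: "real (m + 1) * ?\<delta> \<le> 1" and sH: "sets ?H = sets borel"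
    unfolding sm by (simp_all add: add_pos_nonneg)
  have mass: "G \<in> sets (prob_algebra borel)"
    "ennreal ((\<kappa> * ?\<delta> powr (1 + K) * (1 / real m)) ^ m) \<le> emeasure (dirichlet_process \<kappa> ?H) G"
    unfolding G_def
    by (rule dirichlet_process_mass_ge[OF \<kappa> prob_space_uniform_interval[OF L] sH I(1) h0 I(5) p \<delta>0 \<delta>1]; assumption)+
  let ?r = "?c ^ n * exp (- (2 * L / real m * Q))"
  have ratio: "ennreal ?r * joint_density n \<nu>' x \<le> joint_density n \<nu> x" if \<nu>: "\<nu> \<in> G" for \<nu>
  proof -
    have "?r \<le> ?c ^ n * exp (- (2 * L / real m * (\<Sum>i<n. \<bar>x i\<bar> + L)))"
      using x L c0 by (intro mult_left_mono) (auto intro!: mult_left_mono divide_right_mono)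
    then have "ennreal ?r * joint_density n \<nu>' x
        \<le> ennreal (?c ^ n * exp (- (2 * L / real m * (\<Sum>i<n. \<bar>x i\<bar> + L)))) * joint_density n \<nu>' x"
      by (intro mult_right_mono ennreal_leI) auto
    also have "\<dots> \<le> joint_density n \<nu> x"
    proof (rule joint_density_ratio_le[where I = I and m = m])
      show "sets \<nu> = sets borel" using \<nu> by (simp add: G_def space_prob_algebra)
      show "AE \<theta> in \<nu>'. \<theta> \<in> (\<Union>i<m. I i)" unfolding I(3) by (rule AE_support[OF \<nu>']) simp
      show "I i \<subseteq> {-L..L}" if "i < m" for i using I(3) that by blast
      show "ennreal ?c * emeasure \<nu>' (I i) \<le> emeasure \<nu> (I i)" if "i < m" for i
      proof -
        have "ennreal ?c * emeasure \<nu>' (I i) = ennreal ((1 - real (m + 1) * ?\<delta>) * p i)"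
          unfolding sm using c0 by (simp add: N.emeasure_eq_measure p_def ennreal_mult')
        also have "\<dots> \<le> emeasure \<nu> (I i)" using \<nu> that by (simp add: G_def)
        finally show ?thesis .
      qed
    qed (use I s' c0 in auto)
    finally show ?thesis .
  qed
  have "ennreal ((\<kappa> * ?\<delta> powr (1 + K) * (1 / real m)) ^ m * ?r) * joint_density n \<nu>' x
      = (ennreal ?r * joint_density n \<nu>' x) * ennreal ((\<kappa> * ?\<delta> powr (1 + K) * (1 / real m)) ^ m)"
    using c0 by (subst ennreal_mult'') (auto simp: mult_ac)
  also have "\<dots> \<le> (ennreal ?r * joint_density n \<nu>' x) * emeasure (dirichlet_process \<kappa> ?H) G"
    using mass(2) by (rule mult_left_mono) simp
  also have "\<dots> = (\<integral>\<^sup>+\<mu>. (ennreal ?r * joint_density n \<nu>' x) * indicator G \<mu> \<partial>dirichlet_process \<kappa> ?H)"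
    using mass(1) by (intro nn_integral_cmult_indicator[symmetric]) (simp add: dirichlet_process_def)
  also have "\<dots> \<le> (\<integral>\<^sup>+\<mu>. joint_density n \<mu> x \<partial>dirichlet_process \<kappa> ?H)"
    using ratio by (intro nn_integral_mono) (auto simp: indicator_def)
  finally show ?thesis .
qed

lemma finite_mixing_support:
  assumes \<nu>: "\<nu> \<in> finite_mixing L"
  shows "\<nu> \<in> space (prob_algebra borel)" "emeasure \<nu> {-L..L} = 1"
proof -
  have p: "prob_space \<nu>" by (rule prob_space_finite_mixing[OF \<nu>])
  obtain k w \<theta> where eq: "\<nu> = atomic_measure (\<lambda>j. if j < k then w j else 0) \<theta>"
    and w: "\<forall>j<k. 0 \<le> w j" "(\<Sum>j<k. w j) = 1" and \<theta>: "\<forall>j<k. \<theta> j \<in> {-L..L}"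
    using \<nu> by (auto simp: finite_mixing_def)
  show "\<nu> \<in> space (prob_algebra borel)" using p by (simp add: space_prob_algebra eq)
  have "emeasure \<nu> {-L..L} = (\<Sum>j. ennreal (if j < k then w j else 0) * indicator {-L..L} (\<theta> j))"
    unfolding eq by (rule emeasure_atomic_measure) simp
  also have "\<dots> = (\<Sum>j<k. ennreal (if j < k then w j else 0) * indicator {-L..L} (\<theta> j))"
    by (rule suminf_finite) auto
  also have "\<dots> = (\<Sum>j<k. ennreal (w j))"
    using \<theta> by (intro sum.cong refl) simp
  also have "\<dots> = 1" using w by (subst sum_ennreal) auto
  finally show "emeasure \<nu> {-L..L} = 1" .
qed

text \<open>With \<open>m\<close> of order \<open>n powr (1/4)\<close>, the three terms of the
  exponent are the prior mass (\<open>m\<close> factors of at least \<open>exp (- A)\<close>), the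
  loss of cell mass (\<open>n / m\<close> gives 3/4), and the cell diameter times the moment bound
  (9/8 - 1/4 = 7/8). In \<open>A\<close>, the coefficient \<open>3 + 2 * C2\<close> is
  \<open>2 * (1 + C2)\<close> from the power of \<open>\<delta>\<close> plus 1 from the cell
  probability, using \<open>m + 1 \<le> n\<close>; the rest bounds
  \<open>- ln \<kappa>\<close>.\<close>

lemma evidence_constant_ge:
  fixes L C1 C2 c0 b0 \<kappa> :: real and m n :: nat
  assumes L: "0 < L" and C: "0 < C1" "0 < C2" and \<kappa>: "C1 * exp (- c0 * ln (real n) powr b0) \<le> \<kappa>"
    and n: "1 \<le> n" and m: "real n powr (1/4) \<le> real m" "real m \<le> 2 * real n powr (1/4)" "m + 1 \<le> n" "1 \<le> m"
  defines "A \<equiv> (3 + 2 * C2) * ln (real n) - ln C1 + c0 * ln (real n) powr b0"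
  assumes A: "0 \<le> A"
  shows "exp (- (2 * real n powr (1/4) * A + real n powr (3/4) + 2 * L * real n powr (7/8)))
    \<le> (\<kappa> * (1 / (real (m + 1))\<^sup>2) powr (1 + C2) * (1 / real m)) ^ m
       * ((1 - 1 / real (m + 1)) ^ n * exp (- (2 * L / real m * real n powr (9/8))))"
proof -
  have \<kappa>0: "0 < \<kappa>" using C by (intro less_le_trans[OF _ \<kappa>]) simp
  have u: "0 < real n powr (1/4)" using n by simp
  have mpos: "0 < real m" using m by simp
  let ?X = "\<kappa> * (1 / (real (m + 1))\<^sup>2) powr (1 + C2) * (1 / real m)"
  have X: "exp (- A) \<le> ?X"
  proof -
    have "ln ?X = ln \<kappa> - 2 * (1 + C2) * ln (real (m + 1)) - ln (real m)"
      using \<kappa>0 m by (simp add: ln_mult ln_powr ln_div ln_realpow)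
    moreover have "ln (C1 * exp (- c0 * ln (real n) powr b0)) \<le> ln \<kappa>"
      using \<kappa> \<kappa>0 C by (subst ln_le_cancel_iff) auto
    then have "ln C1 - c0 * ln (real n) powr b0 \<le> ln \<kappa>" using C by (simp add: ln_mult)
    moreover have "2 * (1 + C2) * ln (real (m + 1)) \<le> 2 * (1 + C2) * ln (real n)"
    proof (rule mult_left_mono)
      show "ln (real (m + 1)) \<le> ln (real n)" using m n by (subst ln_le_cancel_iff) (simp_all only: of_nat_le_iff of_nat_0_less_iff)
    qed (use C in simp)
    moreover have "ln (real m) \<le> ln (real n)" using m n by (subst ln_le_cancel_iff) auto
    ultimately have "- A \<le> ln ?X" by (simp add: A_def algebra_simps)
    then have "exp (- A) \<le> exp (ln ?X)" by (simp only: exp_le_cancel_iff)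
    also have "exp (ln ?X) = ?X" using \<kappa>0 m by (intro exp_ln) simp
    finally show ?thesis .
  qed
  have "exp (- (2 * real n powr (1/4) * A)) \<le> exp (- (real m * A))"
    using mult_right_mono[OF m(2) A] by simp
  also have "\<dots> = exp (- A) ^ m" by (simp add: exp_of_nat_mult[symmetric])
  also have "\<dots> \<le> ?X ^ m" using X by (intro power_mono) auto
  finally have 1: "exp (- (2 * real n powr (1/4) * A)) \<le> ?X ^ m" .
  have 2: "exp (- (real n powr (3/4))) \<le> (1 - 1 / real (m + 1)) ^ n"
  proof -
    have "real n / real m \<le> real n / real n powr (1/4)" using m by (intro divide_left_mono mult_pos_pos mpos u) auto
    also have "\<dots> = real n powr 1 / real n powr (1/4)" using n by simp
    also have "\<dots> = real n powr (3/4)" by (simp only: powr_diff[symmetric]) simp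
    finally have "exp (- (real n powr (3/4))) \<le> exp (- (real n * (1 / real m)))" by simp
    also have "\<dots> = exp (- (1 / real m)) ^ n" by (simp only: exp_of_nat_mult[symmetric] mult_minus_right)
    also have "\<dots> \<le> (1 - 1 / real (m + 1)) ^ n"
    proof (rule power_mono)
      \<comment> \<open>Inverting \<open>1 + 1 / m \<le> exp (1 / m)\<close> gives exactly
        \<open>m / (m + 1)\<close>, the per-observation factor.\<close>
      have "1 + 1 / real m \<le> exp (1 / real m)" by (rule exp_ge_add_one_self)
      then have "inverse (exp (1 / real m)) \<le> inverse (1 + 1 / real m)"
        by (intro le_imp_inverse_le) (use mpos in \<open>simp_all add: add_pos_pos\<close>)
      also have "inverse (1 + 1 / real m) = 1 - 1 / real (m + 1)" using m by (simp add: field_simps)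
      finally show "exp (- (1 / real m)) \<le> 1 - 1 / real (m + 1)" by (simp only: exp_minus)
    qed simp
    finally show ?thesis .
  qed
  have 3: "exp (- (2 * L * real n powr (7/8))) \<le> exp (- (2 * L / real m * real n powr (9/8)))"
  proof -
    have "2 * L / real m * real n powr (9/8) = 2 * L * (real n powr (9/8) / real m)" by simp
    also have "\<dots> \<le> 2 * L * (real n powr (9/8) / real n powr (1/4))"
      using m L by (intro mult_left_mono divide_left_mono mult_pos_pos mpos u) auto
    also have "\<dots> = 2 * L * real n powr (7/8)" by (simp add: powr_diff[symmetric])
    finally show ?thesis by simp
  qed
  have "exp (- (2 * real n powr (1/4) * A + real n powr (3/4) + 2 * L * real n powr (7/8)))
     = exp (- (2 * real n powr (1/4) * A)) * (exp (- (real n powr (3/4))) * exp (- (2 * L * real n powr (7/8))))"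
    by (simp add: exp_add[symmetric])
  also have "\<dots> \<le> ?X ^ m * ((1 - 1 / real (m + 1)) ^ n * exp (- (2 * L / real m * real n powr (9/8))))"
    using \<kappa>0 by (intro mult_mono 1 2 3 mult_nonneg_nonneg zero_le_power) auto
  finally show ?thesis .
qed

text \<open>A set \<open>A\<close> that is not measurable has \<open>emeasure\<close> 0, so measurable supersets suffice throughout.\<close>

lemma posterior_char_ball_le:
  fixes P :: "real measure measure" and \<nu>' :: "real measure" and d \<Theta> L Q :: real and D n :: nat
  assumes P: "prob_space P" and sP: "sets P = sets (prob_algebra borel)"
    and supp: "emeasure P {\<nu> \<in> space (prob_algebra borel). emeasure \<nu> {-L..L} \<noteq> 1} = 0"
    and \<nu>': "\<nu>' \<in> space (prob_algebra borel)" "emeasure \<nu>' {-L..L} = 1"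
    and L: "0 < L" and d: "0 < d" and n: "0 < n" and \<Theta>: "0 \<le> \<Theta>" and D: "1 \<le> D" and Q: "0 < Q"
    and evidence: "\<And>x. (\<Sum>i<n. \<bar>x i\<bar> + L) \<le> Q \<Longrightarrow> ennreal d * joint_density n \<nu>' x \<le> (\<integral>\<^sup>+\<mu>. joint_density n \<mu> x \<partial>P)"
    and A: "A \<subseteq> space (prob_algebra borel)"
      "\<And>\<nu>. \<nu> \<in> A \<Longrightarrow> emeasure \<nu> {-L..L} = 1 \<Longrightarrow>
         \<exists>j :: int. \<bar>j\<bar> \<le> int D \<and> \<Theta> < cmod (char \<nu> (of_int j / real D) - char \<nu>' (of_int j / real D))"
  shows "(\<integral>\<^sup>+x. emeasure (posterior P n x) A \<partial>(\<Pi>\<^sub>M i\<in>{..<n}. gauss_mixture \<nu>'))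
     \<le> ennreal (4 * real D + 2) * (ennreal (real n * (2 * L + 2) / Q) + ennreal (2 * exp (- (real n * (\<Theta> / 8)\<^sup>2 / 2)))
         + ennreal (2 * exp (- (real n * (\<Theta> / 8)\<^sup>2 / 2))) / ennreal d)"
proof -
  let ?R = "\<Pi>\<^sub>M i\<in>{..<n}. lborel :: real measure" and ?P' = "\<Pi>\<^sub>M i\<in>{..<n}. gauss_mixture \<nu>'"
  define N where "N = {\<nu> \<in> space (prob_algebra borel). emeasure \<nu> {-L..L} \<noteq> 1}"
  have N: "N \<in> sets P" "N \<in> null_sets P"
    using prob_algebra_Collect_sets(2)[of "{-L..L}" 1] supp by (auto simp: N_def sP null_sets_def)
  define B where "B = (\<lambda>(j :: int, b). {\<nu> \<in> space (prob_algebra borel).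
     \<Theta> / 2 < \<bar>(\<integral>x. trig b (of_int j / real D * x) \<partial>\<nu>) - (\<integral>x. trig b (of_int j / real D * x) \<partial>\<nu>')\<bar>})"
  \<comment> \<open>There are \<open>2 * D + 1\<close> frequencies, each tested with cosine and
    sine, hence \<open>4 * D + 2\<close> tests.\<close>
  define F where "F = {- int D..int D} \<times> (UNIV :: bool set)"
  have F: "finite F" "card F = 4 * D + 2" by (simp_all add: F_def card_cartesian_product)
  define S where "S = {x \<in> space ?R. (\<Sum>i<n. \<bar>x i\<bar> + L) \<le> Q}"
  have S: "S \<in> sets ?R"
  proof -
    have "(\<lambda>x. \<Sum>i<n. \<bar>x i\<bar> + L) \<in> borel_measurable ?R"
      by (intro borel_measurable_sum) measurable
    note this [measurable]
    show ?thesis unfolding S_def by measurable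
  qed
  have p': "prob_space \<nu>'" "sets \<nu>' = sets borel" using \<nu>'(1) by (auto simp: space_prob_algebra)
  have sR: "sets ?P' = sets ?R" by (rule sets_PiM_cong) auto
  have spR: "space ?P' = space ?R" by (rule sets_eq_imp_space_eq[OF sR])
  have Sc: "emeasure ?P' (space ?R - S) \<le> ennreal (real n * (2 * L + 2) / Q)"
  proof -
    have "space ?R - S = {x \<in> space ?R. Q < (\<Sum>i<n. \<bar>x i\<bar> + L)}" by (auto simp: S_def)
    then show ?thesis
      using gauss_mixture_sum_tail[OF p' AE_support[OF \<nu>'] _ Q, of n] L by simp
  qed
  have Bs: "B z \<in> sets P" and Bz: "(\<integral>\<^sup>+x. emeasure (posterior P n x) (B z) \<partial>?P')
      \<le> ennreal (real n * (2 * L + 2) / Q) + ennreal (2 * exp (- (real n * (\<Theta> / 8)\<^sup>2 / 2)))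
         + ennreal (2 * exp (- (real n * (\<Theta> / 8)\<^sup>2 / 2))) / ennreal d" if z: "z \<in> F" for z
  proof -
    obtain j b where zj: "z = (j, b)" "\<bar>j\<bar> \<le> int D" using z by (auto simp: F_def)
    then have "\<bar>of_int j / real D :: real\<bar> \<le> 1" using D by (simp add: divide_le_eq)
    note T = posterior_trig_le[OF P sP \<nu>'(1) S d n \<Theta> this, of b]
    have ev: "ennreal d * joint_density n \<nu>' x \<le> (\<integral>\<^sup>+\<mu>. joint_density n \<mu> x \<partial>P)" if "x \<in> S" for x
      using that by (intro evidence) (simp add: S_def)
    show "B z \<in> sets P" using T(1)[OF ev] by (simp add: B_def zj sP)
    show "(\<integral>\<^sup>+x. emeasure (posterior P n x) (B z) \<partial>?P')
      \<le> ennreal (real n * (2 * L + 2) / Q) + ennreal (2 * exp (- (real n * (\<Theta> / 8)\<^sup>2 / 2)))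
         + ennreal (2 * exp (- (real n * (\<Theta> / 8)\<^sup>2 / 2))) / ennreal d"
      using order_trans[OF T(2)[OF ev] add_mono[OF add_mono[OF Sc order_refl] order_refl]] by (simp add: B_def zj)
  qed
  have cover: "A \<subseteq> N \<union> (\<Union>z\<in>F. B z)"
  proof
    fix \<nu> assume \<nu>: "\<nu> \<in> A"
    then have \<nu>p: "\<nu> \<in> space (prob_algebra borel)" using A by blast
    show "\<nu> \<in> N \<union> (\<Union>z\<in>F. B z)"
    proof (cases "emeasure \<nu> {-L..L} = 1")
      case False then show ?thesis using \<nu>p by (simp add: N_def)
    next
      case True
      then obtain j :: int where j: "\<bar>j\<bar> \<le> int D"
        "\<Theta> < cmod (char \<nu> (of_int j / real D) - char \<nu>' (of_int j / real D))"
        using A(2)[OF \<nu>] by blast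
      let ?t = "of_int j / real D :: real"
      let ?\<Delta> = "\<lambda>b. (\<integral>x. trig b (?t * x) \<partial>\<nu>) - (\<integral>x. trig b (?t * x) \<partial>\<nu>')"
      have "char \<nu> ?t - char \<nu>' ?t = Complex (?\<Delta> True) (?\<Delta> False)"
        using \<nu>p p' by (simp add: char_eq_trig space_prob_algebra complex_eq_iff)
      \<comment> \<open>A complex modulus is at most the sum of the absolute real and imaginary
        parts, so one of the two exceeds \<open>\<Theta> / 2\<close>.\<close>
      then have "\<Theta> < \<bar>?\<Delta> True\<bar> + \<bar>?\<Delta> False\<bar>"
        using j(2) cmod_le[of "Complex (?\<Delta> True) (?\<Delta> False)"] by (simp only: complex.sel)
      then obtain b where "\<Theta> / 2 < \<bar>?\<Delta> b\<bar>" by (metis add_mono field_sum_of_halves not_le)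
      then have "\<nu> \<in> B (j, b)" using \<nu>p by (simp add: B_def)
      moreover have "(j, b) \<in> F" using j by (auto simp: F_def)
      ultimately show ?thesis by blast
    qed
  qed
  have post_sets: "sets (posterior P n x) = sets P" for x by (simp add: posterior_def)
  have "(\<integral>\<^sup>+x. emeasure (posterior P n x) A \<partial>?P') \<le> (\<integral>\<^sup>+x. (\<Sum>z\<in>F. emeasure (posterior P n x) (B z)) \<partial>?P')"
  proof (rule nn_integral_mono)
    fix x assume "x \<in> space ?P'"
    then have x: "x \<in> space ?R" by (simp add: spR)
    have "emeasure (posterior P n x) A \<le> emeasure (posterior P n x) (N \<union> (\<Union>z\<in>F. B z))"
      using cover N Bs F by (intro emeasure_mono) (auto simp: post_sets)
    also have "\<dots> \<le> emeasure (posterior P n x) N + emeasure (posterior P n x) (\<Union>z\<in>F. B z)"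
      using N Bs F by (intro emeasure_subadditive) (auto simp: post_sets)
    also have "emeasure (posterior P n x) N = 0" by (rule emeasure_posterior_null_set[OF sP N(2) x])
    also have "emeasure (posterior P n x) (\<Union>z\<in>F. B z) \<le> (\<Sum>z\<in>F. emeasure (posterior P n x) (B z))"
      using Bs F by (intro emeasure_subadditive_finite) (auto simp: post_sets)
    finally show "emeasure (posterior P n x) A \<le> (\<Sum>z\<in>F. emeasure (posterior P n x) (B z))" by simp
  qed
  also have "\<dots> = (\<Sum>z\<in>F. \<integral>\<^sup>+x. emeasure (posterior P n x) (B z) \<partial>?P')"
    using measurable_emeasure_posterior[OF P sP Bs]
    by (intro nn_integral_sum) (simp cong: measurable_cong_sets add: sR)
  also have "\<dots> \<le> (\<Sum>z\<in>F. ennreal (real n * (2 * L + 2) / Q) + ennreal (2 * exp (- (real n * (\<Theta> / 8)\<^sup>2 / 2)))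
         + ennreal (2 * exp (- (real n * (\<Theta> / 8)\<^sup>2 / 2))) / ennreal d)"
    by (rule sum_mono) (rule Bz)
  also have "\<dots> = ennreal (4 * real D + 2) * (ennreal (real n * (2 * L + 2) / Q) + ennreal (2 * exp (- (real n * (\<Theta> / 8)\<^sup>2 / 2)))
         + ennreal (2 * exp (- (real n * (\<Theta> / 8)\<^sup>2 / 2))) / ennreal d)"
  proof -
    have "of_nat (card F) = ennreal (4 * real D + 2)"
      by (simp add: F ennreal_of_nat_eq_real_of_nat[symmetric] del: of_nat_add of_nat_mult) (simp add: ennreal_of_nat_eq_real_of_nat)
    then show ?thesis by (simp only: sum_constant)
  qed
  finally show ?thesis .
qed

theorem theorem3p2:
  fixes L b0 c0 C1 C2 :: real and \<kappa> :: "nat \<Rightarrow> real"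
  assumes "L > 0" and "b0 > 0" and "c0 > 0" and "C1 > 0" and "C2 > 0"
    and "\<forall>n\<ge>1. \<kappa> n > 0"
    and "\<forall>n\<ge>1. C1 * exp (- c0 * (ln (real n)) powr b0) \<le> \<kappa> n \<and> \<kappa> n \<le> C2"
  shows "\<exists>M>0.
    ((\<lambda>n. SUP \<nu>'\<in>finite_mixing L.
        \<integral>\<^sup>+x. emeasure (posterior (dirichlet_process (\<kappa> n) (uniform_measure lborel {-L..L})) n x)
               {\<nu> \<in> space (prob_algebra borel).
                  wasserstein1 \<nu> \<nu>' \<ge> ennreal (M * (ln (ln (real n)) / ln (real n)))}
          \<partial>(\<Pi>\<^sub>M i\<in>{..<n}. gauss_mixture \<nu>'))
      \<longlongrightarrow> 0) sequentially"
proof -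
  let ?H = "uniform_measure lborel {-L..L}"
  \<comment> \<open>\<open>M\<close> comes from the deterministic comparison alone, so it depends on
    \<open>L\<close> but on neither \<open>n\<close> nor \<open>\<nu>'\<close>.\<close>
  obtain M :: real and D :: "nat \<Rightarrow> nat" where M: "0 < M" and rate:
    "\<forall>\<^sub>F n in sequentially. 1 \<le> D n \<and> real (D n) \<le> ln (real n) \<and>
       (\<forall>\<mu> \<nu>. real_distribution \<mu> \<longrightarrow> real_distribution \<nu> \<longrightarrow>
          emeasure \<mu> {-L..L} = 1 \<longrightarrow> emeasure \<nu> {-L..L} = 1 \<longrightarrow>
          (\<forall>j :: int. \<bar>j\<bar> \<le> int (D n) \<longrightarrow>
             cmod (char \<mu> (of_int j / real (D n)) - char \<nu> (of_int j / real (D n))) \<le> real n powr (-1/32)) \<longrightarrow>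
          wasserstein1 \<mu> \<nu> < ennreal (M * (ln (ln (real n)) / ln (real n))))"
    using wasserstein1_rate[OF \<open>L > 0\<close>] by blast
  define A where "A = (\<lambda>n :: nat. (3 + 2 * C2) * ln (real n) - ln C1 + c0 * ln (real n) powr b0)"
  define R where "R = (\<lambda>n :: nat. 2 * real n powr (1/4) * A n + real n powr (3/4) + 2 * L * real n powr (7/8))"
  \<comment> \<open>Number of tests times three terms: the moment tail
    \<open>n / n powr (9/8)\<close>, the false rejections, and the missed detections divided by the
    evidence constant. The last vanishes because \<open>n powr (15/16)\<close> dominates every term
    of \<open>R n\<close>, including \<open>n powr (1/4)\<close> times a power of the
    logarithm.\<close>
  define bound where "bound = (\<lambda>n :: nat. (4 * ln (real n) + 2) * ((2 * L + 2) * real n powr (-1/8)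
     + 2 * exp (- (real n powr (15/16) / 128)) + 2 * exp (R n - real n powr (15/16) / 128)))"
  let ?f = "\<lambda>n. SUP \<nu>'\<in>finite_mixing L.
        \<integral>\<^sup>+x. emeasure (posterior (dirichlet_process (\<kappa> n) ?H) n x)
               {\<nu> \<in> space (prob_algebra borel).
                  wasserstein1 \<nu> \<nu>' \<ge> ennreal (M * (ln (ln (real n)) / ln (real n)))}
          \<partial>(\<Pi>\<^sub>M i\<in>{..<n}. gauss_mixture \<nu>')"
  have lim: "bound \<longlonglongrightarrow> 0"
    unfolding bound_def R_def A_def using assms(1-5) by real_asymp
  have "\<forall>\<^sub>F n in sequentially. 0 \<le> A n \<and> real n powr (1/4) + 2 \<le> real n \<and> 1 \<le> real n powr (1/4) \<and> 1 \<le> n"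
  proof (intro eventually_conj)
    have "\<forall>\<^sub>F n in sequentially. ln C1 \<le> 3 * ln (real n) \<and> 1 \<le> n"
      by (intro eventually_conj eventually_ge_at_top) real_asymp
    then show "\<forall>\<^sub>F n in sequentially. 0 \<le> A n"
    proof eventually_elim
      fix n :: nat assume n: "ln C1 \<le> 3 * ln (real n) \<and> 1 \<le> n"
      then have "0 \<le> 2 * C2 * ln (real n)" "0 \<le> c0 * ln (real n) powr b0" using assms(1-5) by simp_all
      moreover have "A n = 2 * C2 * ln (real n) + (3 * ln (real n) - ln C1) + c0 * ln (real n) powr b0"
        by (simp add: A_def algebra_simps)
      ultimately show "0 \<le> A n" using n by linarith
    qed
    show "\<forall>\<^sub>F n in sequentially. real n powr (1/4) + 2 \<le> real n" by real_asymp
    show "\<forall>\<^sub>F n in sequentially. 1 \<le> real n powr (1/4)" by real_asymp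
  qed (rule eventually_ge_at_top)
  with rate have upper: "\<forall>\<^sub>F n in sequentially. ?f n \<le> ennreal (bound n)"
  proof eventually_elim
    fix n :: nat
    assume r: "1 \<le> D n \<and> real (D n) \<le> ln (real n) \<and>
       (\<forall>\<mu> \<nu>. real_distribution \<mu> \<longrightarrow> real_distribution \<nu> \<longrightarrow>
          emeasure \<mu> {-L..L} = 1 \<longrightarrow> emeasure \<nu> {-L..L} = 1 \<longrightarrow>
          (\<forall>j :: int. \<bar>j\<bar> \<le> int (D n) \<longrightarrow>
             cmod (char \<mu> (of_int j / real (D n)) - char \<nu> (of_int j / real (D n))) \<le> real n powr (-1/32)) \<longrightarrow>
          wasserstein1 \<mu> \<nu> < ennreal (M * (ln (ln (real n)) / ln (real n))))"
      and e: "0 \<le> A n \<and> real n powr (1/4) + 2 \<le> real n \<and> 1 \<le> real n powr (1/4) \<and> 1 \<le> n"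
    \<comment> \<open>Rounding up at most doubles \<open>n powr (1/4)\<close>, as that is at least
      1; the eventual slack 2 yields \<open>m + 1 \<le> n\<close>.\<close>
    define m where "m = nat \<lceil>real n powr (1/4)\<rceil>"
    have m: "real n powr (1/4) \<le> real m" "real m \<le> 2 * real n powr (1/4)" "m + 1 \<le> n" "1 \<le> m"
      using e unfolding m_def by linarith+
    define d where "d = (\<kappa> n * (1 / (real (m + 1))\<^sup>2) powr (1 + C2) * (1 / real m)) ^ m
       * ((1 - 1 / real (m + 1)) ^ n * exp (- (2 * L / real m * real n powr (9/8))))"
    have \<kappa>: "0 < \<kappa> n" "\<kappa> n \<le> C2" "C1 * exp (- c0 * ln (real n) powr b0) \<le> \<kappa> n"
      using assms(6,7) e by auto
    have dR: "exp (- R n) \<le> d"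
      unfolding d_def R_def A_def using e m \<kappa> assms(1-5) by (intro evidence_constant_ge) (auto simp: A_def)
    then have d: "0 < d" by (rule less_le_trans[OF exp_gt_zero])
    let ?P = "dirichlet_process (\<kappa> n) ?H"
    have H: "prob_space ?H" "sets ?H = sets borel" by (simp_all add: prob_space_uniform_interval assms(1))
    have P: "prob_space ?P" by (rule prob_space_dirichlet_process[OF \<kappa>(1) H])
    have sP: "sets ?P = sets (prob_algebra borel)" by (simp add: dirichlet_process_def)
    have supp: "emeasure ?P {\<nu> \<in> space (prob_algebra borel). emeasure \<nu> {-L..L} \<noteq> 1} = 0"
      by (rule dirichlet_process_support[OF \<kappa>(1) H]) (auto intro!: AE_uniform_measureI)
    \<comment> \<open>With precision \<open>n powr (-1/32)\<close>, squaring leaves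
      \<open>n powr (1 - 1/16)\<close>, and 128 = 8^2 * 2.\<close>
    define E where "E = exp (- (real n * (real n powr (-1/32) / 8)\<^sup>2 / 2))"
    have E: "E = exp (- (real n powr (15/16) / 128))"
    proof -
      have "real n * (real n powr (-1/32))\<^sup>2 = real n powr 1 * (real n powr (-1/32) * real n powr (-1/32))"
        using e by (simp add: power2_eq_square)
      also have "\<dots> = real n powr (15/16)" by (simp only: powr_add[symmetric]) simp
      finally show ?thesis by (simp add: E_def power_divide)
    qed
    show "?f n \<le> ennreal (bound n)"
    proof (rule SUP_least)
      fix \<nu>' assume "\<nu>' \<in> finite_mixing L"
      note \<nu>' = finite_mixing_support[OF this]
      let ?A = "{\<nu> \<in> space (prob_algebra borel). wasserstein1 \<nu> \<nu>' \<ge> ennreal (M * (ln (ln (real n)) / ln (real n)))}"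
      have rd: "real_distribution \<nu>" if "\<nu> \<in> space (prob_algebra borel)" for \<nu>
        using that by (simp add: space_prob_algebra real_distribution_def real_distribution_axioms_def)
      have "(\<integral>\<^sup>+x. emeasure (posterior ?P n x) ?A \<partial>(\<Pi>\<^sub>M i\<in>{..<n}. gauss_mixture \<nu>'))
        \<le> ennreal (4 * real (D n) + 2) * (ennreal (real n * (2 * L + 2) / (real n powr (9/8))) + ennreal (2 * E) + ennreal (2 * E) / ennreal d)"
        unfolding E_def
      proof (rule posterior_char_ball_le[OF P sP supp \<nu>' assms(1) d])
        show "ennreal d * joint_density n \<nu>' x \<le> (\<integral>\<^sup>+\<mu>. joint_density n \<mu> x \<partial>?P)"
          if "(\<Sum>i<n. \<bar>x i\<bar> + L) \<le> real n powr (9/8)" for x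
          unfolding d_def using m by (intro evidence_ge assms(1) \<kappa> \<nu>' that) auto
        show "\<exists>j :: int. \<bar>j\<bar> \<le> int (D n) \<and> real n powr (-1/32) < cmod (char \<nu> (of_int j / real (D n)) - char \<nu>' (of_int j / real (D n)))"
          if \<nu>: "\<nu> \<in> ?A" "emeasure \<nu> {-L..L} = 1" for \<nu>
        proof (rule ccontr)
          \<comment> \<open>If no tested frequency separates \<open>\<nu>\<close> from
            \<open>\<nu>'\<close>, the comparison of \<open>wasserstein1_rate\<close> puts
            \<open>\<nu>\<close> strictly inside the ball.\<close>
          assume "\<not> ?thesis"
          then have "wasserstein1 \<nu> \<nu>' < ennreal (M * (ln (ln (real n)) / ln (real n)))"
            using r rd \<nu> \<nu>' by (simp add: not_less)
          with \<nu> show False by (simp add: not_le[symmetric])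
        qed
      qed (use e r in auto)
      also have "\<dots> \<le> ennreal (4 * ln (real n) + 2) * (ennreal ((2 * L + 2) * real n powr (-1/8)) + ennreal (2 * E) + ennreal (2 * exp (R n) * E))"
      proof -
        have tests: "ennreal (4 * real (D n) + 2) \<le> ennreal (4 * ln (real n) + 2)"
          using r by (intro ennreal_leI) simp
        have "real n / real n powr (9/8) = real n powr 1 / real n powr (9/8)" using e by simp
        also have "\<dots> = real n powr (-1/8)" by (simp only: powr_diff[symmetric]) simp
        finally have "real n * (2 * L + 2) / real n powr (9/8) = (2 * L + 2) * real n powr (-1/8)"
          by (simp only: times_divide_eq_right[symmetric] mult.commute[of "real n"])
        then have tail: "ennreal (real n * (2 * L + 2) / real n powr (9/8)) \<le> ennreal ((2 * L + 2) * real n powr (-1/8))"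
          by simp
        have "2 * E / d \<le> 2 * E / exp (- R n)"
          using dR d by (intro divide_left_mono) (auto simp: E)
        also have "\<dots> = 2 * exp (R n) * E" by (simp add: exp_minus field_simps)
        finally have ratio: "ennreal (2 * E) / ennreal d \<le> ennreal (2 * exp (R n) * E)"
          using d by (simp add: divide_ennreal E ennreal_leI)
        show ?thesis
          by (rule mult_mono[OF tests add_mono[OF add_mono[OF tail order_refl] ratio]]) (rule zero_le)+
      qed
      also have "\<dots> = ennreal (bound n)"
      proof -
        let ?a = "4 * ln (real n) + 2" and ?b = "(2 * L + 2) * real n powr (-1/8)" and ?c = "2 * exp (R n) * E"
        have "exp (R n - real n powr (15/16) / 128) = exp (R n) * E"
          by (simp only: E exp_add[symmetric] diff_conv_add_uminus)
        then have "bound n = ?a * (?b + 2 * E + ?c)"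
          by (simp only: bound_def E[symmetric] mult.assoc)
        moreover have "0 \<le> ?a" "0 \<le> ?b" "0 \<le> 2 * E" "0 \<le> ?c" "0 \<le> ?b + 2 * E" "0 \<le> ?b + 2 * E + ?c"
          using e assms(1) by (simp_all add: E_def)
        ultimately show ?thesis by (simp only: ennreal_mult ennreal_plus)
      qed
      finally show "(\<integral>\<^sup>+x. emeasure (posterior ?P n x) ?A \<partial>(\<Pi>\<^sub>M i\<in>{..<n}. gauss_mixture \<nu>')) \<le> ennreal (bound n)" .
    qed
  qed
  \<comment> \<open>\<open>bound\<close> is free of \<open>\<nu>'\<close>, so it dominates the
    supremum, and the sandwich with 0 gives the limit.\<close>
  have "(\<lambda>n. ennreal (bound n)) \<longlonglongrightarrow> 0" using tendsto_ennrealI[OF lim] by simp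
  then have "?f \<longlonglongrightarrow> 0"
    by (rule tendsto_sandwich[OF always_eventually[OF allI[OF zero_le]] upper tendsto_const])
  with M show ?thesis by blast
qed

end
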